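(* Let $n\geq 3$ and let $\mathcal{O}$ be the ring of integers of a number field whose group of units $\mathcal{O}^\times$ is finite. If $H$ is any group such that $H\equiv\mathrm{T}_n(\mathcal{O})$, then $H\cong\mathrm{T}_n(R)$ for some ring $R\equiv\mathcal{O}$.
   Context: Rings are commutative, associative and unital. $\mathrm{T}_n(R)$ is the group of all invertible upper triangular $n\times n$ matrices over $R$. The symbol $\equiv$ denotes elementary equivalence, in the first-order language of groups for groups and in the first-order language of unitary rings for rings. *)

theory Defs
  imports "Jordan_Normal_Form.Matrix" "HOL-Algebra.Algebra"
begin

section \<open>First-order logic with equality over purely functional signatures\<close>

text \<open>The parameter \<open>'t\<close> is the type of terms; variables are natural numbers.\<close>

datatype 't fm = Eq 't 't | Neg "'t fm" | Conj "'t fm" "'t fm" | Ex nat "'t fm"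

primrec fm_fv :: "('t \<Rightarrow> nat set) \<Rightarrow> 't fm \<Rightarrow> nat set" where
  "fm_fv tv (Eq s t) = tv s \<union> tv t"
| "fm_fv tv (Neg \<phi>) = fm_fv tv \<phi>"
| "fm_fv tv (Conj \<phi> \<psi>) = fm_fv tv \<phi> \<union> fm_fv tv \<psi>"
| "fm_fv tv (Ex x \<phi>) = fm_fv tv \<phi> - {x}"

primrec sat :: "'a set \<Rightarrow> ((nat \<Rightarrow> 'a) \<Rightarrow> 't \<Rightarrow> 'a) \<Rightarrow> (nat \<Rightarrow> 'a) \<Rightarrow> 't fm \<Rightarrow> bool" where
  "sat A ev e (Eq s t) \<longleftrightarrow> ev e s = ev e t"
| "sat A ev e (Neg \<phi>) \<longleftrightarrow> \<not> sat A ev e \<phi>"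
| "sat A ev e (Conj \<phi> \<psi>) \<longleftrightarrow> sat A ev e \<phi> \<and> sat A ev e \<psi>"
| "sat A ev e (Ex x \<phi>) \<longleftrightarrow> (\<exists>a\<in>A. sat A ev (e(x := a)) \<phi>)"

text \<open>Only applied to sentences, whose truth value does not depend on the assignment.\<close>

definition models :: "'a set \<Rightarrow> ((nat \<Rightarrow> 'a) \<Rightarrow> 't \<Rightarrow> 'a) \<Rightarrow> 't fm \<Rightarrow> bool" where
  "models A ev \<phi> \<longleftrightarrow> (\<forall>e. range e \<subseteq> A \<longrightarrow> sat A ev e \<phi>)"

datatype group_trm =
    GVar nat | GOne | GMult group_trm group_trm | GInv group_trm

primrec group_trm_vars :: "group_trm \<Rightarrow> nat set" where
  "group_trm_vars (GVar x) = {x}"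
| "group_trm_vars GOne = {}"
| "group_trm_vars (GMult s t) = group_trm_vars s \<union> group_trm_vars t"
| "group_trm_vars (GInv t) = group_trm_vars t"

primrec group_trm_val ::
  "('a, 'b) monoid_scheme \<Rightarrow> (nat \<Rightarrow> 'a) \<Rightarrow> group_trm \<Rightarrow> 'a" where
  "group_trm_val G e (GVar x) = e x"
| "group_trm_val G e GOne = \<one>\<^bsub>G\<^esub>"
| "group_trm_val G e (GMult s t) = group_trm_val G e s \<otimes>\<^bsub>G\<^esub> group_trm_val G e t"
| "group_trm_val G e (GInv t) = inv\<^bsub>G\<^esub> (group_trm_val G e t)"

definition group_elem_equiv ::
  "('a, 'm) monoid_scheme \<Rightarrow> ('b, 'n) monoid_scheme \<Rightarrow> bool" where
  "group_elem_equiv G H \<longleftrightarrow>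
     (\<forall>\<phi> :: group_trm fm. fm_fv group_trm_vars \<phi> = {} \<longrightarrow>
        (models (carrier G) (group_trm_val G) \<phi> \<longleftrightarrow> models (carrier H) (group_trm_val H) \<phi>))"

datatype ring_trm =
    RVar nat | RZero | ROne | RAdd ring_trm ring_trm | RNeg ring_trm | RMult ring_trm ring_trm

primrec ring_trm_vars :: "ring_trm \<Rightarrow> nat set" where
  "ring_trm_vars (RVar x) = {x}"
| "ring_trm_vars RZero = {}"
| "ring_trm_vars ROne = {}"
| "ring_trm_vars (RAdd s t) = ring_trm_vars s \<union> ring_trm_vars t"
| "ring_trm_vars (RNeg t) = ring_trm_vars t"
| "ring_trm_vars (RMult s t) = ring_trm_vars s \<union> ring_trm_vars t"

primrec ring_trm_val ::
  "('a, 'b) ring_scheme \<Rightarrow> (nat \<Rightarrow> 'a) \<Rightarrow> ring_trm \<Rightarrow> 'a" where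
  "ring_trm_val R e (RVar x) = e x"
| "ring_trm_val R e RZero = \<zero>\<^bsub>R\<^esub>"
| "ring_trm_val R e ROne = \<one>\<^bsub>R\<^esub>"
| "ring_trm_val R e (RAdd s t) = ring_trm_val R e s \<oplus>\<^bsub>R\<^esub> ring_trm_val R e t"
| "ring_trm_val R e (RNeg t) = \<ominus>\<^bsub>R\<^esub> (ring_trm_val R e t)"
| "ring_trm_val R e (RMult s t) = ring_trm_val R e s \<otimes>\<^bsub>R\<^esub> ring_trm_val R e t"

definition ring_elem_equiv ::
  "('a, 'm) ring_scheme \<Rightarrow> ('b, 'n) ring_scheme \<Rightarrow> bool" where
  "ring_elem_equiv R S \<longleftrightarrow>
     (\<forall>\<phi> :: ring_trm fm. fm_fv ring_trm_vars \<phi> = {} \<longrightarrow>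
        (models (carrier R) (ring_trm_val R) \<phi> \<longleftrightarrow> models (carrier S) (ring_trm_val S) \<phi>))"


section \<open>Upper triangular matrix groups\<close>

text \<open>The type \<^typ>\<open>'a mat\<close> serves only as a container here: the type-class operations on it
  are not available, since the entries come from the carrier of a ring record.\<close>

definition matrix_monoid :: "nat \<Rightarrow> ('a, 'm) ring_scheme \<Rightarrow> 'a mat monoid" where
  "matrix_monoid n R =
     \<lparr>carrier = {A \<in> carrier_mat n n. \<forall>i<n. \<forall>j<n. A $$ (i, j) \<in> carrier R},
      mult = (\<lambda>A B. mat n n (\<lambda>(i, j). \<Oplus>\<^bsub>R\<^esub>k\<in>{..<n}. A $$ (i, k) \<otimes>\<^bsub>R\<^esub> B $$ (k, j))),
      one = mat n n (\<lambda>(i, j). if i = j then \<one>\<^bsub>R\<^esub> else \<zero>\<^bsub>R\<^esub>)\<rparr>"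

definition triangular_group :: "nat \<Rightarrow> ('a, 'm) ring_scheme \<Rightarrow> 'a mat monoid" where
  "triangular_group n R =
     (matrix_monoid n R)\<lparr>carrier :=
        {A \<in> Units (matrix_monoid n R). \<forall>i<n. \<forall>j<i. A $$ (i, j) = \<zero>\<^bsub>R\<^esub>}\<rparr>"


section \<open>Number fields and their rings of integers\<close>

abbreviation rat_ring :: "rat ring" where
  "rat_ring \<equiv> \<lparr>carrier = UNIV, mult = (*), one = 1, ring.zero = 0, add = (+)\<rparr>"

definition number_field :: "('a, 'm) ring_scheme \<Rightarrow> bool" where
  "number_field K \<longleftrightarrow>
     field K \<and> (\<exists>h \<in> ring_hom rat_ring K. ring.finite_dimension K (range h) (carrier K))"

text \<open>Polynomials over \<open>K\<close> are coefficient lists with the leading coefficient first.\<close>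

definition integral_over_int :: "('a, 'm) ring_scheme \<Rightarrow> 'a \<Rightarrow> bool" where
  "integral_over_int K x \<longleftrightarrow>
     (\<exists>p \<in> carrier (univ_poly K (range (\<lambda>k :: int. add_pow K k \<one>\<^bsub>K\<^esub>))).
        p \<noteq> [] \<and> hd p = \<one>\<^bsub>K\<^esub> \<and> ring.eval K p x = \<zero>\<^bsub>K\<^esub>)"

definition ring_of_integers :: "('a, 'm) ring_scheme \<Rightarrow> ('a, 'm) ring_scheme" where
  "ring_of_integers K = K\<lparr>carrier := {x \<in> carrier K. integral_over_int K x}\<rparr>"

end

theory Submission
  imports Defs "HOL-Library.Countable"
begin

text \<open>Let \<open>G = T\<^sub>n(\<O>)\<close>. The root subgroup of the entry \<open>(1, n)\<close> is definable in \<open>G\<close> without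
  parameters, and it is a copy of the additive group of \<open>\<O>\<close>. The commutator pairing of two further
  definable sets has values in it, and a pair \<open>(a, b)\<close> with suitable surjectivity properties turns
  it into a ring. The multiplication is bilinear over \<open>\<O>\<close> and has a unit, whence every such pair
  in \<open>G\<close> yields a ring isomorphic to \<open>\<O>\<close>; therefore every such pair in \<open>H\<close> yields a ring
  elementarily equivalent to \<open>\<O>\<close>.

  Both the group of diagonal matrices and \<open>\<O> / 2\<O>\<close> are finite, so finitely many parameters suffice to
  define all root subgroups and the diagonal coordinates, hence all matrix entries of an element of
  \<open>G\<close>. That the entries give an isomorphism onto the triangular group over the interpreted ring is
  one first-order statement about the parameters. It is satisfiable in \<open>G\<close>, hence in \<open>H\<close>.\<close>

section \<open>Definability in pairs of groups\<close>

text \<open>What the group separates poorly from unipotent matrices is the diagonal. Raising to the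
  power \<open>m\<close>, the number of units, removes it uniformly: an m-th power has diagonal 1,
  while in characteristic 0 the m-th power of an elementary matrix with entry 1 keeps the nonzero
  entry m, which can be cancelled in a domain.

  A general root subgroup is reached through commutators with diagonal sign matrices, and such a
  commutator doubles the entry. This is where the classes modulo 2 come from: their representatives
  supply what doubling misses.

  Two transfers of different kind are combined. The isomorphism is a single statement about
  parameters, so \<open>H\<close> has parameters satisfying it, but nothing else is known about
  them. Elementary equivalence of the rings involves infinitely many sentences, all about these same
  parameters. It is therefore drawn from statements about all frames: in T_n(\<O>) every frame
  yields the product r s / e with a unit e, so all frames agree on each ring sentence, and for each
  sentence this agreement passes to \<open>H\<close>.\<close>

lemma sat_cong:
  assumes "\<And>t e e'. (\<forall>x\<in>tv t. e x = e' x) \<Longrightarrow> ev e t = ev e' t"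
    and "\<forall>x\<in>fm_fv tv \<phi>. e x = e' x"
  shows "sat A ev e \<phi> \<longleftrightarrow> sat A ev e' \<phi>"
  using assms(2)
proof (induction \<phi> arbitrary: e e')
  case (Eq s t)
  then show ?case using assms(1)[of s e e'] assms(1)[of t e e'] by auto
next
  case (Ex x \<phi>)
  have "sat A ev (e(x := a)) \<phi> \<longleftrightarrow> sat A ev (e'(x := a)) \<phi>" for a
    by (rule Ex.IH) (use Ex.prems in auto)
  then show ?case by simp
next
  case (Neg \<phi>)
  then have "sat A ev e \<phi> \<longleftrightarrow> sat A ev e' \<phi>" by (intro Neg.IH) auto
  then show ?case by simp
next
  case (Conj \<phi> \<psi>)
  then have "sat A ev e \<phi> \<longleftrightarrow> sat A ev e' \<phi>" "sat A ev e \<psi> \<longleftrightarrow> sat A ev e' \<psi>"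
    by (auto intro!: Conj.IH)
  then show ?case by simp
qed

lemma group_trm_val_cong:
  "\<forall>x\<in>group_trm_vars t. e x = e' x \<Longrightarrow> group_trm_val G e t = group_trm_val G e' t"
  by (induction t) auto

lemma sat_group_cong:
  "\<forall>x\<in>fm_fv group_trm_vars \<phi>. e x = e' x \<Longrightarrow>
    sat A (group_trm_val G) e \<phi> \<longleftrightarrow> sat A (group_trm_val G) e' \<phi>"
  by (rule sat_cong[of group_trm_vars]) (auto intro: group_trm_val_cong)

text \<open>A block of quantifiers changes the assignment simultaneously on \<open>vs\<close>; a
  variable listed twice takes the inner value. This serves both to quantify over part of a tuple and
  to close a formula to a sentence.\<close>

lemma sat_foldr_Ex:
  "sat A ev e (foldr Ex vs \<phi>) \<longleftrightarrow>
    (\<exists>e'. (\<forall>x\<in>set vs. e' x \<in> A) \<and> (\<forall>x. x \<notin> set vs \<longrightarrow> e' x = e x) \<and> sat A ev e' \<phi>)"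
proof (induction vs arbitrary: e)
  case Nil
  have "e' = e" if "\<forall>x. e' x = e x" for e' using that by auto
  then show ?case by auto
next
  case (Cons v vs)
  show ?case
  proof
    assume "sat A ev e (foldr Ex (v # vs) \<phi>)"
    then obtain a e' where "a \<in> A" "\<forall>x\<in>set vs. e' x \<in> A"
      "\<forall>x. x \<notin> set vs \<longrightarrow> e' x = (e(v := a)) x" "sat A ev e' \<phi>"
      using Cons by auto
    then show "\<exists>e'. (\<forall>x\<in>set (v # vs). e' x \<in> A) \<and> (\<forall>x. x \<notin> set (v # vs) \<longrightarrow> e' x = e x) \<and> sat A ev e' \<phi>"
      by (intro exI[of _ e']) (cases "v \<in> set vs"; auto)
  next
    assume "\<exists>e'. (\<forall>x\<in>set (v # vs). e' x \<in> A) \<and> (\<forall>x. x \<notin> set (v # vs) \<longrightarrow> e' x = e x) \<and> sat A ev e' \<phi>"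
    then obtain e' where e': "\<forall>x\<in>set (v # vs). e' x \<in> A" "\<forall>x. x \<notin> set (v # vs) \<longrightarrow> e' x = e x"
      "sat A ev e' \<phi>" by blast
    then have "sat A ev (e(v := e' v)) (foldr Ex vs \<phi>)"
      by (intro iffD2[OF Cons] exI[of _ e']) auto
    with e'(1) show "sat A ev e (foldr Ex (v # vs) \<phi>)" by auto
  qed
qed

primrec rename_trm :: "(nat \<Rightarrow> nat) \<Rightarrow> group_trm \<Rightarrow> group_trm" where
  "rename_trm f (GVar x) = GVar (f x)"
| "rename_trm f GOne = GOne"
| "rename_trm f (GMult s t) = GMult (rename_trm f s) (rename_trm f t)"
| "rename_trm f (GInv t) = GInv (rename_trm f t)"

text \<open>Bound variables are renamed too; injectivity on all variables of the formula, free and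
  bound, then excludes capture.\<close>

primrec rename_fm :: "(nat \<Rightarrow> nat) \<Rightarrow> group_trm fm \<Rightarrow> group_trm fm" where
  "rename_fm f (Eq s t) = Eq (rename_trm f s) (rename_trm f t)"
| "rename_fm f (Neg \<phi>) = Neg (rename_fm f \<phi>)"
| "rename_fm f (Conj \<phi> \<psi>) = Conj (rename_fm f \<phi>) (rename_fm f \<psi>)"
| "rename_fm f (Ex x \<phi>) = Ex (f x) (rename_fm f \<phi>)"

primrec all_vars :: "group_trm fm \<Rightarrow> nat set" where
  "all_vars (Eq s t) = group_trm_vars s \<union> group_trm_vars t"
| "all_vars (Neg \<phi>) = all_vars \<phi>"
| "all_vars (Conj \<phi> \<psi>) = all_vars \<phi> \<union> all_vars \<psi>"
| "all_vars (Ex x \<phi>) = insert x (all_vars \<phi>)"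

lemma finite_group_trm_vars: "finite (group_trm_vars t)"
  by (induction t) auto

lemma finite_all_vars: "finite (all_vars \<phi>)"
  by (induction \<phi>) (auto simp: finite_group_trm_vars)

lemma fm_fv_subset_all_vars: "fm_fv group_trm_vars \<phi> \<subseteq> all_vars \<phi>"
  by (induction \<phi>) auto

lemma rename_trm_val: "group_trm_val G e (rename_trm f t) = group_trm_val G (\<lambda>v. e (f v)) t"
  by (induction t) auto

lemma sat_rename_fm:
  "inj_on f (all_vars \<phi>) \<Longrightarrow>
    sat A (group_trm_val G) e (rename_fm f \<phi>) \<longleftrightarrow> sat A (group_trm_val G) (\<lambda>v. e (f v)) \<phi>"
proof (induction \<phi> arbitrary: e)
  case (Ex x \<phi>)
  have "sat A (group_trm_val G) (e(f x := a)) (rename_fm f \<phi>) \<longleftrightarrow>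
        sat A (group_trm_val G) ((\<lambda>v. e (f v))(x := a)) \<phi>" for a
  proof -
    have "sat A (group_trm_val G) (e(f x := a)) (rename_fm f \<phi>) \<longleftrightarrow>
        sat A (group_trm_val G) (\<lambda>v. (e(f x := a)) (f v)) \<phi>"
      by (rule Ex.IH) (use Ex.prems in \<open>auto simp: inj_on_def\<close>)
    also have "\<dots> \<longleftrightarrow> sat A (group_trm_val G) ((\<lambda>v. e (f v))(x := a)) \<phi>"
    proof (rule sat_group_cong, rule ballI)
      fix y assume "y \<in> fm_fv group_trm_vars \<phi>"
      then have "y \<in> all_vars \<phi>" using fm_fv_subset_all_vars by auto
      then show "(e(f x := a)) (f y) = ((\<lambda>v. e (f v))(x := a)) y"
        using Ex.prems by (auto simp: inj_on_def)
    qed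
    finally show ?thesis .
  qed
  then show ?case by simp
qed (auto simp: rename_trm_val inj_on_def)

section \<open>Predicates defined by one formula in two groups\<close>

locale group_pair = G: group G + H: group H
  for G :: "('a, 'm) monoid_scheme" (structure) and H :: "('b, 'n) monoid_scheme" (structure)
begin

text \<open>One formula has to serve both groups. The closure rules for such pairs of predicates
  build it behind the scenes, so no formula of the interpretation is ever written down.\<close>

definition definable :: "((nat \<Rightarrow> 'a) \<Rightarrow> bool) \<Rightarrow> ((nat \<Rightarrow> 'b) \<Rightarrow> bool) \<Rightarrow> bool" where
  "definable P Q \<longleftrightarrow> (\<exists>\<phi>.
     (\<forall>e. range e \<subseteq> carrier G \<longrightarrow> (sat (carrier G) (group_trm_val G) e \<phi> \<longleftrightarrow> P e)) \<and>
     (\<forall>e. range e \<subseteq> carrier H \<longrightarrow> (sat (carrier H) (group_trm_val H) e \<phi> \<longleftrightarrow> Q e)))"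

lemma definable_cong:
  assumes "definable P Q" "\<And>e. range e \<subseteq> carrier G \<Longrightarrow> P e \<longleftrightarrow> P' e"
    "\<And>e. range e \<subseteq> carrier H \<Longrightarrow> Q e \<longleftrightarrow> Q' e"
  shows "definable P' Q'"
  using assms unfolding definable_def by simp

lemma definable_not: "definable P Q \<Longrightarrow> definable (\<lambda>e. \<not> P e) (\<lambda>e. \<not> Q e)"
  unfolding definable_def by (metis sat.simps(2))

lemma definable_conj:
  assumes "definable P Q" "definable P' Q'"
  shows "definable (\<lambda>e. P e \<and> P' e) (\<lambda>e. Q e \<and> Q' e)"
proof -
  from assms obtain \<phi> \<psi> where
    "\<forall>e. range e \<subseteq> carrier G \<longrightarrow> (sat (carrier G) (group_trm_val G) e \<phi> \<longleftrightarrow> P e)"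
    "\<forall>e. range e \<subseteq> carrier H \<longrightarrow> (sat (carrier H) (group_trm_val H) e \<phi> \<longleftrightarrow> Q e)"
    "\<forall>e. range e \<subseteq> carrier G \<longrightarrow> (sat (carrier G) (group_trm_val G) e \<psi> \<longleftrightarrow> P' e)"
    "\<forall>e. range e \<subseteq> carrier H \<longrightarrow> (sat (carrier H) (group_trm_val H) e \<psi> \<longleftrightarrow> Q' e)"
    unfolding definable_def by auto
  then show ?thesis unfolding definable_def by (intro exI[of _ "Conj \<phi> \<psi>"]) simp
qed

lemma definable_disj:
  assumes "definable P Q" "definable P' Q'"
  shows "definable (\<lambda>e. P e \<or> P' e) (\<lambda>e. Q e \<or> Q' e)"
  using definable_not[OF definable_conj[OF definable_not[OF assms(1)] definable_not[OF assms(2)]]]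
  by simp

lemma definable_imp:
  assumes "definable P Q" "definable P' Q'"
  shows "definable (\<lambda>e. P e \<longrightarrow> P' e) (\<lambda>e. Q e \<longrightarrow> Q' e)"
  using definable_disj[OF definable_not[OF assms(1)] assms(2)] by simp

lemma definable_iff:
  assumes "definable P Q" "definable P' Q'"
  shows "definable (\<lambda>e. P e \<longleftrightarrow> P' e) (\<lambda>e. Q e \<longleftrightarrow> Q' e)"
  by (rule definable_cong[OF definable_conj[OF definable_imp[OF assms] definable_imp[OF assms(2,1)]]]) blast+

lemma definable_const: "definable (\<lambda>e. c) (\<lambda>e. c)"
  unfolding definable_def
  by (rule exI[of _ "if c then Eq GOne GOne else Neg (Eq GOne GOne)"]) simp

lemma definable_Ball:
  assumes "finite I" "\<And>i. i \<in> I \<Longrightarrow> definable (P i) (Q i)"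
  shows "definable (\<lambda>e. \<forall>i\<in>I. P i e) (\<lambda>e. \<forall>i\<in>I. Q i e)"
  using assms by (induction rule: finite_induct) (auto intro: definable_const definable_conj)

lemma definable_Bex:
  assumes "finite I" "\<And>i. i \<in> I \<Longrightarrow> definable (P i) (Q i)"
  shows "definable (\<lambda>e. \<exists>i\<in>I. P i e) (\<lambda>e. \<exists>i\<in>I. Q i e)"
  using assms by (induction rule: finite_induct) (auto intro: definable_const definable_disj)

text \<open>\<open>pos\<close> sorts the variables of the defining formula into those read from the
  outer assignment (\<open>Inl\<close>) and those to be quantified (\<open>Inr\<close>). As only
  finitely many variables occur, quantifying over all of \<open>F\<close> amounts to quantifying
  over finitely many of its components.\<close>

lemma definable_Ex_gen:
  fixes pos :: "nat \<Rightarrow> nat + nat"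
  assumes "inj pos" and "definable P Q"
  shows "definable
     (\<lambda>e. \<exists>F. (\<forall>k::nat. F k \<in> carrier G) \<and> P (\<lambda>v. case pos v of Inl i \<Rightarrow> e i | Inr k \<Rightarrow> F k))
     (\<lambda>e. \<exists>F. (\<forall>k::nat. F k \<in> carrier H) \<and> Q (\<lambda>v. case pos v of Inl i \<Rightarrow> e i | Inr k \<Rightarrow> F k))"
proof -
  obtain \<phi> where \<phi>:
    "\<And>e. range e \<subseteq> carrier G \<Longrightarrow> sat (carrier G) (group_trm_val G) e \<phi> \<longleftrightarrow> P e"
    "\<And>e. range e \<subseteq> carrier H \<Longrightarrow> sat (carrier H) (group_trm_val H) e \<phi> \<longleftrightarrow> Q e"
    using assms(2) unfolding definable_def by blast
  define V where "V = all_vars \<phi>"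
  have finV: "finite V" unfolding V_def by (rule finite_all_vars)
  have "finite {i. Inl i \<in> pos ` V}"
    using finite_vimageI[of "pos ` V" Inl] finV by (simp add: vimage_def)
  \<comment> \<open>\<open>M\<close> exceeds every outer variable in use, so \<open>M + k\<close> is
    free to hold the quantified component \<open>k\<close>.\<close>
  then obtain M where M: "\<And>i. Inl i \<in> pos ` V \<Longrightarrow> i < M"
    by (metis (mono_tags) finite_nat_set_iff_bounded mem_Collect_eq)
  define f where "f v = (case pos v of Inl i \<Rightarrow> i | Inr k \<Rightarrow> M + k)" for v
  have injf: "inj_on f V"
  proof (rule inj_onI)
    fix x y assume xy: "x \<in> V" "y \<in> V" "f x = f y"
    have lt: "i < M" if "v \<in> V" "pos v = Inl i" for v i using M that by (metis imageI)
    have "pos x = pos y"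
      using xy lt[of x] lt[of y] by (cases "pos x"; cases "pos y") (auto simp: f_def)
    then show "x = y" using assms(1) by (auto dest: injD)
  qed
  have "finite {k. Inr k \<in> pos ` V}"
    using finite_vimageI[of "pos ` V" Inr] finV by (simp add: vimage_def)
  then have fin: "finite ((\<lambda>k. M + k) ` {k. Inr k \<in> pos ` V})" by auto
  obtain L where L: "set L = (\<lambda>k. M + k) ` {k. Inr k \<in> pos ` V}"
    using finite_list[OF fin] by blast
  define \<psi> where "\<psi> = foldr Ex L (rename_fm f \<phi>)"
  have key: "sat (carrier S) (group_trm_val S) e \<psi> \<longleftrightarrow>
    (\<exists>F. (\<forall>k::nat. F k \<in> carrier S) \<and> B (\<lambda>v. case pos v of Inl i \<Rightarrow> e i | Inr k \<Rightarrow> F k))"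
    if B: "\<And>e. range e \<subseteq> carrier S \<Longrightarrow> sat (carrier S) (group_trm_val S) e \<phi> \<longleftrightarrow> B e"
      and e: "range e \<subseteq> carrier S"
    for S :: "('s, 't) monoid_scheme" and B e
  proof
    assume "sat (carrier S) (group_trm_val S) e \<psi>"
    then obtain e' where e': "\<forall>x\<in>set L. e' x \<in> carrier S" "\<forall>x. x \<notin> set L \<longrightarrow> e' x = e x"
      "sat (carrier S) (group_trm_val S) e' (rename_fm f \<phi>)"
      unfolding \<psi>_def sat_foldr_Ex by blast
    have s: "sat (carrier S) (group_trm_val S) (\<lambda>v. e' (f v)) \<phi>"
      using e'(3) injf by (simp add: sat_rename_fm V_def)
    \<comment> \<open>Components that the formula does not mention get the arbitrary value
      \<open>e 0\<close>.\<close>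
    define F where "F k = (if M + k \<in> set L then e' (M + k) else e 0)" for k
    have F: "F k \<in> carrier S" for k using e'(1) e by (auto simp: F_def)
    let ?E = "\<lambda>v. case pos v of Inl i \<Rightarrow> e i | Inr k \<Rightarrow> F k"
    have "sat (carrier S) (group_trm_val S) (\<lambda>v. e' (f v)) \<phi> \<longleftrightarrow> sat (carrier S) (group_trm_val S) ?E \<phi>"
    proof (rule sat_group_cong, rule ballI)
      fix v assume "v \<in> fm_fv group_trm_vars \<phi>"
      then have v: "v \<in> V" using fm_fv_subset_all_vars V_def by blast
      show "e' (f v) = ?E v"
      proof (cases "pos v")
        case (Inl i)
        then have "i < M" using v M by (metis imageI)
        then have "i \<notin> set L" using L by auto
        then show ?thesis using Inl e' by (simp add: f_def)
      next
        case (Inr k)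
        then have "M + k \<in> set L" using v L by (metis (mono_tags) image_eqI mem_Collect_eq)
        then show ?thesis using Inr by (simp add: f_def F_def)
      qed
    qed
    moreover have "range ?E \<subseteq> carrier S" using e F by (auto simp: image_subset_iff split: sum.splits)
    ultimately have "B ?E" using s B by simp
    then show "\<exists>F. (\<forall>k::nat. F k \<in> carrier S) \<and> B (\<lambda>v. case pos v of Inl i \<Rightarrow> e i | Inr k \<Rightarrow> F k)"
      using F by blast
  next
    assume "\<exists>F. (\<forall>k::nat. F k \<in> carrier S) \<and> B (\<lambda>v. case pos v of Inl i \<Rightarrow> e i | Inr k \<Rightarrow> F k)"
    then obtain F where F: "\<And>k::nat. F k \<in> carrier S"
      and BF: "B (\<lambda>v. case pos v of Inl i \<Rightarrow> e i | Inr k \<Rightarrow> F k)" by blast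
    let ?E = "\<lambda>v. case pos v of Inl i \<Rightarrow> e i | Inr k \<Rightarrow> F k"
    have "range ?E \<subseteq> carrier S" using e F by (auto simp: image_subset_iff split: sum.splits)
    then have s: "sat (carrier S) (group_trm_val S) ?E \<phi>" using B BF by simp
    define e' where "e' x = (if x \<in> set L then F (x - M) else e x)" for x
    have "sat (carrier S) (group_trm_val S) (\<lambda>v. e' (f v)) \<phi> \<longleftrightarrow> sat (carrier S) (group_trm_val S) ?E \<phi>"
    proof (rule sat_group_cong, rule ballI)
      fix v assume "v \<in> fm_fv group_trm_vars \<phi>"
      then have v: "v \<in> V" using fm_fv_subset_all_vars V_def by blast
      show "e' (f v) = ?E v"
      proof (cases "pos v")
        case (Inl i)
        then have "i < M" using v M by (metis imageI)
        then have "i \<notin> set L" using L by auto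
        then show ?thesis using Inl by (simp add: f_def e'_def)
      next
        case (Inr k)
        then have "M + k \<in> set L" using v L by (metis (mono_tags) image_eqI mem_Collect_eq)
        then show ?thesis using Inr by (simp add: f_def e'_def)
      qed
    qed
    then have "sat (carrier S) (group_trm_val S) e' (rename_fm f \<phi>)"
      using s injf by (simp add: sat_rename_fm V_def)
    moreover have "\<forall>x\<in>set L. e' x \<in> carrier S" "\<forall>x. x \<notin> set L \<longrightarrow> e' x = e x"
      using F by (auto simp: e'_def)
    ultimately show "sat (carrier S) (group_trm_val S) e \<psi>"
      unfolding \<psi>_def sat_foldr_Ex by blast
  qed
  show ?thesis
    unfolding definable_def
    by (intro exI[of _ \<psi>] conjI allI impI key) (use \<phi> in auto)
qed

text \<open>A formula has only finitely many variables, so it may quantify over an infinite tuple \<open>F\<close>: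
  the even variables carry \<open>F\<close>, the odd ones the previous assignment.\<close>

lemma definable_Ex_fun:
  fixes P :: "(nat \<Rightarrow> 'a) \<Rightarrow> ('i::countable \<Rightarrow> 'a) \<Rightarrow> bool" and Q :: "(nat \<Rightarrow> 'b) \<Rightarrow> ('i \<Rightarrow> 'b) \<Rightarrow> bool"
  assumes "definable (\<lambda>e. P (\<lambda>i. e (2 * i + 1)) (\<lambda>x. e (2 * to_nat x)))
                     (\<lambda>e. Q (\<lambda>i. e (2 * i + 1)) (\<lambda>x. e (2 * to_nat x)))"
  shows "definable (\<lambda>e. \<exists>F. (\<forall>x. F x \<in> carrier G) \<and> P e F) (\<lambda>e. \<exists>F. (\<forall>x. F x \<in> carrier H) \<and> Q e F)"
proof -
  let ?pos = "\<lambda>v::nat. if odd v then Inl (v div 2) else Inr (v div 2)"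
  have "inj ?pos"
  proof (rule injI)
    fix x y assume "?pos x = ?pos y"
    then have "odd x \<longleftrightarrow> odd y" "x div 2 = y div 2" by (auto split: if_splits)
    then show "x = y" by presburger
  qed
  have eq: "(\<exists>F. (\<forall>k::nat. F k \<in> C) \<and> B (\<lambda>i. (\<lambda>v. case ?pos v of Inl i \<Rightarrow> e i | Inr k \<Rightarrow> F k) (2 * i + 1))
          (\<lambda>x. (\<lambda>v. case ?pos v of Inl i \<Rightarrow> e i | Inr k \<Rightarrow> F k) (2 * to_nat x)))
        \<longleftrightarrow> (\<exists>F. (\<forall>x. F x \<in> C) \<and> B e F)"
    for C and B :: "(nat \<Rightarrow> 'c) \<Rightarrow> ('i \<Rightarrow> 'c) \<Rightarrow> bool" and e :: "nat \<Rightarrow> 'c"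
  proof
    assume "\<exists>F. (\<forall>x. F x \<in> C) \<and> B e F"
    then obtain F where "\<forall>x. F x \<in> C" "B e F" by blast
    then show "\<exists>F. (\<forall>k::nat. F k \<in> C) \<and> B (\<lambda>i. (\<lambda>v. case ?pos v of Inl i \<Rightarrow> e i | Inr k \<Rightarrow> F k) (2 * i + 1))
          (\<lambda>x. (\<lambda>v. case ?pos v of Inl i \<Rightarrow> e i | Inr k \<Rightarrow> F k) (2 * to_nat x))"
      by (intro exI[of _ "\<lambda>k. F (from_nat k)"]) auto
  qed auto
  show ?thesis
    by (rule definable_cong[OF definable_Ex_gen[OF \<open>inj ?pos\<close> assms]]) (rule eq)+
qed

text \<open>As with de Bruijn indices, the bound element takes variable 0 and the outer variables
  move up by one. Nested quantifiers can then be treated by \<open>intro\<close> without naming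
  variables.\<close>

lemma definable_Ex:
  assumes "definable (\<lambda>e. P (\<lambda>i. e (Suc i)) (e 0)) (\<lambda>e. Q (\<lambda>i. e (Suc i)) (e 0))"
  shows "definable (\<lambda>e. \<exists>x\<in>carrier G. P e x) (\<lambda>e. \<exists>x\<in>carrier H. Q e x)"
proof -
  let ?pos = "\<lambda>v::nat. case v of 0 \<Rightarrow> Inr 0 | Suc i \<Rightarrow> Inl i"
  have "inj ?pos" by (rule injI) (auto split: nat.splits)
  have eq: "(\<exists>F. (\<forall>k::nat. F k \<in> C) \<and> B (\<lambda>i. (\<lambda>v. case ?pos v of Inl i \<Rightarrow> e i | Inr k \<Rightarrow> F k) (Suc i))
          ((\<lambda>v. case ?pos v of Inl i \<Rightarrow> e i | Inr k \<Rightarrow> F k) 0))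
        \<longleftrightarrow> (\<exists>x\<in>C. B e x)"
    for C and B :: "(nat \<Rightarrow> 'c) \<Rightarrow> 'c \<Rightarrow> bool" and e :: "nat \<Rightarrow> 'c"
  proof
    assume "\<exists>x\<in>C. B e x"
    then obtain x where "x \<in> C" "B e x" by blast
    then show "(\<exists>F. (\<forall>k::nat. F k \<in> C) \<and> B (\<lambda>i. (\<lambda>v. case ?pos v of Inl i \<Rightarrow> e i | Inr k \<Rightarrow> F k) (Suc i))
          ((\<lambda>v. case ?pos v of Inl i \<Rightarrow> e i | Inr k \<Rightarrow> F k) 0))"
      by (intro exI[of _ "\<lambda>k. x"]) auto
  qed auto
  show ?thesis
    by (rule definable_cong[OF definable_Ex_gen[OF \<open>inj ?pos\<close> assms]]) (rule eq)+
qed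

lemma definable_All:
  assumes "definable (\<lambda>e. P (\<lambda>i. e (Suc i)) (e 0)) (\<lambda>e. Q (\<lambda>i. e (Suc i)) (e 0))"
  shows "definable (\<lambda>e. \<forall>x\<in>carrier G. P e x) (\<lambda>e. \<forall>x\<in>carrier H. Q e x)"
  using definable_not[OF definable_Ex[OF definable_not[OF assms]]] by simp

lemma definable_All_fun:
  fixes P :: "(nat \<Rightarrow> 'a) \<Rightarrow> ('i::countable \<Rightarrow> 'a) \<Rightarrow> bool" and Q :: "(nat \<Rightarrow> 'b) \<Rightarrow> ('i \<Rightarrow> 'b) \<Rightarrow> bool"
  assumes "definable (\<lambda>e. P (\<lambda>i. e (2 * i + 1)) (\<lambda>x. e (2 * to_nat x)))
                     (\<lambda>e. Q (\<lambda>i. e (2 * i + 1)) (\<lambda>x. e (2 * to_nat x)))"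
  shows "definable (\<lambda>e. \<forall>F. (\<forall>x. F x \<in> carrier G) \<longrightarrow> P e F) (\<lambda>e. \<forall>F. (\<forall>x. F x \<in> carrier H) \<longrightarrow> Q e F)"
  using definable_not[OF definable_Ex_fun[where P = "\<lambda>e F. \<not> P e F" and Q = "\<lambda>e F. \<not> Q e F",
        OF definable_not[OF assms]]] by (simp only: not_ex de_Morgan_conj not_not imp_conv_disj not_all)

lemma definable_reindex:
  assumes "inj g" "definable P Q"
  shows "definable (\<lambda>e. P (\<lambda>i. e (g i))) (\<lambda>e. Q (\<lambda>i. e (g i)))"
proof -
  obtain \<phi> where \<phi>:
    "\<And>e. range e \<subseteq> carrier G \<Longrightarrow> sat (carrier G) (group_trm_val G) e \<phi> \<longleftrightarrow> P e"
    "\<And>e. range e \<subseteq> carrier H \<Longrightarrow> sat (carrier H) (group_trm_val H) e \<phi> \<longleftrightarrow> Q e"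
    using assms(2) unfolding definable_def by blast
  have "inj_on g (all_vars \<phi>)" using assms(1) by (rule inj_on_subset) simp
  then show ?thesis unfolding definable_def
    by (intro exI[of _ "rename_fm g \<phi>"]) (auto simp: sat_rename_fm \<phi> image_subset_iff)
qed

text \<open>A function enters through its graph, because \<open>corner_mult\<close> below is not the
  value of a group term. Closedness of the carriers is included so that such functions can be
  nested.\<close>

definition definable_fun :: "((nat \<Rightarrow> 'a) \<Rightarrow> 'a) \<Rightarrow> ((nat \<Rightarrow> 'b) \<Rightarrow> 'b) \<Rightarrow> bool" where
  "definable_fun f g \<longleftrightarrow> (\<forall>e. range e \<subseteq> carrier G \<longrightarrow> f e \<in> carrier G) \<and>
     (\<forall>e. range e \<subseteq> carrier H \<longrightarrow> g e \<in> carrier H) \<and>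
     definable (\<lambda>e. e 0 = f (\<lambda>i. e (Suc i))) (\<lambda>e. e 0 = g (\<lambda>i. e (Suc i)))"

lemma definable_fun_var: "definable_fun (\<lambda>e. e k) (\<lambda>e. e k)"
  unfolding definable_fun_def definable_def
  by (intro conjI exI[of _ "Eq (GVar 0) (GVar (Suc k))"]) auto

lemma definable_subst:
  assumes "\<And>k. definable_fun (U k) (W k)" "definable P Q"
  shows "definable (\<lambda>e. P (\<lambda>k. U k e)) (\<lambda>e. Q (\<lambda>k. W k e))"
proof -
  obtain \<phi> where \<phi>:
    "\<And>e. range e \<subseteq> carrier G \<Longrightarrow> sat (carrier G) (group_trm_val G) e \<phi> \<longleftrightarrow> P e"
    "\<And>e. range e \<subseteq> carrier H \<Longrightarrow> sat (carrier H) (group_trm_val H) e \<phi> \<longleftrightarrow> Q e"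
    using assms(2) unfolding definable_def by blast
  define V where "V = all_vars \<phi>"
  have finV: "finite V" unfolding V_def by (rule finite_all_vars)
  have step: "definable (\<lambda>e. e (2 * to_nat k) = U k (\<lambda>i. e (2 * i + 1)))
      (\<lambda>e. e (2 * to_nat k) = W k (\<lambda>i. e (2 * i + 1)))" for k
  proof -
    let ?g = "\<lambda>i. case i of 0 \<Rightarrow> 2 * to_nat k | Suc i \<Rightarrow> 2 * i + 1"
    have parity: "2 * a \<noteq> Suc (2 * b)" "Suc (2 * b) \<noteq> 2 * a" for a b :: nat by presburger+
    have "inj ?g" by (rule injI) (auto split: nat.splits simp: parity)
    from definable_reindex[OF this, of "\<lambda>e. e 0 = U k (\<lambda>i. e (Suc i))" "\<lambda>e. e 0 = W k (\<lambda>i. e (Suc i))"]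
      assms(1)[of k] show ?thesis
      unfolding definable_fun_def by simp
  qed
  have shift: "definable (\<lambda>e. P (\<lambda>k. e (2 * to_nat k))) (\<lambda>e. Q (\<lambda>k. e (2 * to_nat k)))"
    by (rule definable_reindex[OF _ assms(2)]) (auto intro!: injI)
  \<comment> \<open>Substitution is replaced by quantifying over the substituted tuple. It is pinned
    down only on the finite set \<open>V\<close>, since an equation for every \<open>k\<close> would
    be an infinite conjunction; values outside \<open>V\<close> do not influence
    \<open>P\<close>.\<close>
  have "definable (\<lambda>e. \<exists>F. (\<forall>k::nat. F k \<in> carrier G) \<and> ((\<forall>k\<in>V. F k = U k e) \<and> P F))
                  (\<lambda>e. \<exists>F. (\<forall>k::nat. F k \<in> carrier H) \<and> ((\<forall>k\<in>V. F k = W k e) \<and> Q F))"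
    by (rule definable_Ex_fun) (intro definable_conj definable_Ball finV step shift)
  then show ?thesis
  proof (rule definable_cong)
    fix e :: "nat \<Rightarrow> 'a" assume e: "range e \<subseteq> carrier G"
    have U: "range (\<lambda>k. U k e) \<subseteq> carrier G" using assms(1) e by (auto simp: definable_fun_def)
    have "P F \<longleftrightarrow> P (\<lambda>k. U k e)" if F: "\<forall>k. F k \<in> carrier G" "\<forall>k\<in>V. F k = U k e" for F
    proof -
      have "sat (carrier G) (group_trm_val G) F \<phi> \<longleftrightarrow> sat (carrier G) (group_trm_val G) (\<lambda>k. U k e) \<phi>"
        using F fm_fv_subset_all_vars[of \<phi>] by (intro sat_group_cong) (auto simp: V_def)
      then show ?thesis using \<phi>(1)[of F] \<phi>(1)[OF U] F by auto
    qed
    note indep = this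
    show "(\<exists>F. (\<forall>k::nat. F k \<in> carrier G) \<and> ((\<forall>k\<in>V. F k = U k e) \<and> P F)) \<longleftrightarrow> P (\<lambda>k. U k e)" (is "?L \<longleftrightarrow> ?R")
    proof (rule iffI)
      assume ?R
      then show ?L using U by (intro exI[of _ "\<lambda>k. U k e"]) auto
    qed (use indep in blast)
  next
    fix e :: "nat \<Rightarrow> 'b" assume e: "range e \<subseteq> carrier H"
    have U: "range (\<lambda>k. W k e) \<subseteq> carrier H" using assms(1) e by (auto simp: definable_fun_def)
    have "Q F \<longleftrightarrow> Q (\<lambda>k. W k e)" if F: "\<forall>k. F k \<in> carrier H" "\<forall>k\<in>V. F k = W k e" for F
    proof -
      have "sat (carrier H) (group_trm_val H) F \<phi> \<longleftrightarrow> sat (carrier H) (group_trm_val H) (\<lambda>k. W k e) \<phi>"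
        using F fm_fv_subset_all_vars[of \<phi>] by (intro sat_group_cong) (auto simp: V_def)
      then show ?thesis using \<phi>(2)[of F] \<phi>(2)[OF U] F by auto
    qed
    note indep = this
    show "(\<exists>F. (\<forall>k::nat. F k \<in> carrier H) \<and> ((\<forall>k\<in>V. F k = W k e) \<and> Q F)) \<longleftrightarrow> Q (\<lambda>k. W k e)" (is "?L \<longleftrightarrow> ?R")
    proof (rule iffI)
      assume ?R
      then show ?L using U by (intro exI[of _ "\<lambda>k. W k e"]) auto
    qed (use indep in blast)
  qed
qed

lemma definable_subst1:
  assumes "definable (\<lambda>e. P (e 0)) (\<lambda>e. Q (e 0))" "definable_fun x y"
  shows "definable (\<lambda>e. P (x e)) (\<lambda>e. Q (y e))"
  using definable_subst[where U = "\<lambda>k. x" and W = "\<lambda>k. y", OF assms(2,1)] by simp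

lemma definable_subst2:
  assumes "definable (\<lambda>e. P (e 0) (e 1)) (\<lambda>e. Q (e 0) (e 1))"
    "definable_fun x x'" "definable_fun y y'"
  shows "definable (\<lambda>e. P (x e) (y e)) (\<lambda>e. Q (x' e) (y' e))"
  using definable_subst[where U = "\<lambda>k. if k = 0 then x else y" and W = "\<lambda>k. if k = 0 then x' else y'",
      OF _ assms(1)] assms(2,3) by simp

lemma definable_subst3:
  assumes "definable (\<lambda>e. P (e 0) (e 1) (e 2)) (\<lambda>e. Q (e 0) (e 1) (e 2))"
    "definable_fun x x'" "definable_fun y y'" "definable_fun z z'"
  shows "definable (\<lambda>e. P (x e) (y e) (z e)) (\<lambda>e. Q (x' e) (y' e) (z' e))"
  using definable_subst[where U = "\<lambda>k. if k = 0 then x else if k = 1 then y else z"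
      and W = "\<lambda>k. if k = 0 then x' else if k = 1 then y' else z'", OF _ assms(1)] assms(2-) by simp

lemma definable_eq:
  assumes "definable_fun x x'" "definable_fun y y'"
  shows "definable (\<lambda>e. x e = y e) (\<lambda>e. x' e = y' e)"
proof (rule definable_subst2[OF _ assms])
  show "definable (\<lambda>e. e 0 = e 1) (\<lambda>e. e 0 = e 1)"
    unfolding definable_def by (rule exI[of _ "Eq (GVar 0) (GVar 1)"]) simp
qed

lemma definable_fun_comp:
  assumes "\<And>k. definable_fun (U k) (W k)" "definable_fun f g"
  shows "definable_fun (\<lambda>e. f (\<lambda>k. U k e)) (\<lambda>e. g (\<lambda>k. W k e))"
proof -
  have suc: "definable_fun (\<lambda>e. U k (\<lambda>i. e (Suc i))) (\<lambda>e. W k (\<lambda>i. e (Suc i)))" for k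
  proof -
    have "inj (\<lambda>i. case i of 0 \<Rightarrow> 0 | Suc i \<Rightarrow> Suc (Suc i))"
      by (rule injI) (auto split: nat.splits)
    from definable_reindex[OF this, of "\<lambda>e. e 0 = U k (\<lambda>i. e (Suc i))" "\<lambda>e. e 0 = W k (\<lambda>i. e (Suc i))"]
      assms(1)[of k] show ?thesis
      unfolding definable_fun_def by (simp add: image_subset_iff)
  qed
  have "definable (\<lambda>e. e 0 = f (\<lambda>k. U k (\<lambda>i. e (Suc i)))) (\<lambda>e. e 0 = g (\<lambda>k. W k (\<lambda>i. e (Suc i))))"
    using definable_subst[where P = "\<lambda>e. e 0 = f (\<lambda>i. e (Suc i))" and Q = "\<lambda>e. e 0 = g (\<lambda>i. e (Suc i))"
        and U = "\<lambda>k. case k of 0 \<Rightarrow> (\<lambda>e. e 0) | Suc k \<Rightarrow> (\<lambda>e. U k (\<lambda>i. e (Suc i)))"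
        and W = "\<lambda>k. case k of 0 \<Rightarrow> (\<lambda>e. e 0) | Suc k \<Rightarrow> (\<lambda>e. W k (\<lambda>i. e (Suc i)))"]
      assms(2) suc definable_fun_var by (auto simp: definable_fun_def split: nat.split)
  moreover have "f (\<lambda>k. U k e) \<in> carrier G" if "range e \<subseteq> carrier G" for e
  proof -
    have "range (\<lambda>k. U k e) \<subseteq> carrier G" using assms(1) that by (auto simp: definable_fun_def)
    then show ?thesis using assms(2) by (auto simp: definable_fun_def)
  qed
  moreover have "g (\<lambda>k. W k e) \<in> carrier H" if "range e \<subseteq> carrier H" for e
  proof -
    have "range (\<lambda>k. W k e) \<subseteq> carrier H" using assms(1) that by (auto simp: definable_fun_def)
    then show ?thesis using assms(2) by (auto simp: definable_fun_def)
  qed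
  ultimately show ?thesis unfolding definable_fun_def by blast
qed

lemma definable_fun_comp2:
  assumes "definable_fun (\<lambda>e. f (e 0) (e 1)) (\<lambda>e. g (e 0) (e 1))"
    "definable_fun x x'" "definable_fun y y'"
  shows "definable_fun (\<lambda>e. f (x e) (y e)) (\<lambda>e. g (x' e) (y' e))"
  using definable_fun_comp[where U = "\<lambda>k. if k = 0 then x else y" and W = "\<lambda>k. if k = 0 then x' else y'",
      OF _ assms(1)] assms(2,3) by simp

lemma definable_fun_one: "definable_fun (\<lambda>e. \<one>\<^bsub>G\<^esub>) (\<lambda>e. \<one>\<^bsub>H\<^esub>)"
  unfolding definable_fun_def definable_def by (intro conjI exI[of _ "Eq (GVar 0) GOne"]) auto

lemma definable_fun_mult:
  assumes "definable_fun x x'" "definable_fun y y'"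
  shows "definable_fun (\<lambda>e. x e \<otimes>\<^bsub>G\<^esub> y e) (\<lambda>e. x' e \<otimes>\<^bsub>H\<^esub> y' e)"
proof (rule definable_fun_comp2[OF _ assms])
  show "definable_fun (\<lambda>e. e 0 \<otimes>\<^bsub>G\<^esub> e 1) (\<lambda>e. e 0 \<otimes>\<^bsub>H\<^esub> e 1)"
    unfolding definable_fun_def definable_def
    by (intro conjI exI[of _ "Eq (GVar 0) (GMult (GVar 1) (GVar 2))"])
      (auto simp: image_subset_iff numeral_2_eq_2)
qed

lemma definable_fun_inv:
  assumes "definable_fun x x'"
  shows "definable_fun (\<lambda>e. inv\<^bsub>G\<^esub> x e) (\<lambda>e. inv\<^bsub>H\<^esub> x' e)"
proof -
  have "definable_fun (\<lambda>e. inv\<^bsub>G\<^esub> (e 0)) (\<lambda>e. inv\<^bsub>H\<^esub> (e 0))"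
    unfolding definable_fun_def definable_def
    by (intro conjI exI[of _ "Eq (GVar 0) (GInv (GVar 1))"]) (auto simp: image_subset_iff)
  from definable_fun_comp[OF assms this] show ?thesis by simp
qed

lemma definable_fun_pow:
  assumes "definable_fun x x'"
  shows "definable_fun (\<lambda>e. x e [^]\<^bsub>G\<^esub> (k::nat)) (\<lambda>e. x' e [^]\<^bsub>H\<^esub> k)"
proof -
  have "definable_fun (\<lambda>e. e 0 [^]\<^bsub>G\<^esub> k) (\<lambda>e. e 0 [^]\<^bsub>H\<^esub> k)"
    by (induction k) (auto intro!: definable_fun_one definable_fun_mult definable_fun_var)
  from definable_fun_comp[OF assms this] show ?thesis by simp
qed

lemma definable_fun_foldr:
  assumes "\<And>x. x \<in> set xs \<Longrightarrow> definable_fun (f x) (g x)"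
    and op: "definable_fun (\<lambda>e. u (e 0) (e 1)) (\<lambda>e. v (e 0) (e 1))" and "definable_fun c d"
  shows "definable_fun (\<lambda>e. foldr (\<lambda>x. u (f x e)) xs (c e)) (\<lambda>e. foldr (\<lambda>x. v (g x e)) xs (d e))"
  using assms(1) by (induction xs) (auto intro!: assms(3) definable_fun_comp2[OF op])

text \<open>The formula behind a parameter-free statement may still have free variables. Its truth
  does not depend on their values, so quantifying all its variables existentially gives a sentence
  with the same truth value.\<close>

lemma definable_elem_equiv:
  assumes "group_elem_equiv G H" and "definable (\<lambda>e. p) (\<lambda>e. q)"
  shows "p \<longleftrightarrow> q"
proof -
  obtain \<phi> where \<phi>:
    "\<And>e. range e \<subseteq> carrier G \<Longrightarrow> sat (carrier G) (group_trm_val G) e \<phi> \<longleftrightarrow> p"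
    "\<And>e. range e \<subseteq> carrier H \<Longrightarrow> sat (carrier H) (group_trm_val H) e \<phi> \<longleftrightarrow> q"
    using assms(2) unfolding definable_def by blast
  obtain L where L: "set L = all_vars \<phi>" using finite_list[OF finite_all_vars] by blast
  have fv: "fm_fv group_trm_vars (foldr Ex L \<phi>) = fm_fv group_trm_vars \<phi> - set L"
    by (induction L) auto
  have key: "models (carrier S) (group_trm_val S) (foldr Ex L \<phi>) \<longleftrightarrow> b"
    if S: "group S" and B: "\<And>e. range e \<subseteq> carrier S \<Longrightarrow> sat (carrier S) (group_trm_val S) e \<phi> \<longleftrightarrow> b"
    for S :: "('s, 't) monoid_scheme" and b
  proof -
    interpret S: group S by (rule S)
    have "sat (carrier S) (group_trm_val S) e (foldr Ex L \<phi>) \<longleftrightarrow> b" if e: "range e \<subseteq> carrier S" for e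
    proof -
      have "sat (carrier S) (group_trm_val S) e' \<phi> \<longleftrightarrow> b"
        if "\<forall>x\<in>set L. e' x \<in> carrier S" "\<forall>x. x \<notin> set L \<longrightarrow> e' x = e x" for e'
      proof (rule B, rule image_subsetI)
        fix x show "e' x \<in> carrier S"
          using that e by (cases "x \<in> set L") auto
      qed
      then show ?thesis unfolding sat_foldr_Ex using e by (auto intro: exI[of _ e] simp: image_subset_iff)
    qed
    \<comment> \<open>Some assignment into the carrier exists, so the universal quantifier in
      \<open>models\<close> is not vacuous.\<close>
    moreover have "range (\<lambda>_::nat. \<one>\<^bsub>S\<^esub>) \<subseteq> carrier S" by auto
    ultimately show ?thesis unfolding models_def by blast
  qed
  have "models (carrier G) (group_trm_val G) (foldr Ex L \<phi>) \<longleftrightarrow>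
      models (carrier H) (group_trm_val H) (foldr Ex L \<phi>)"
    using assms(1) fv L fm_fv_subset_all_vars unfolding group_elem_equiv_def by (metis Diff_eq_empty_iff)
  then show ?thesis using key[OF G.group_axioms \<phi>(1)] key[OF H.group_axioms \<phi>(2)] by simp
qed

end


section \<open>Upper triangular matrices over a commutative ring\<close>

text \<open>Rows come in decreasing order. With the factors in this order, a product of elementary
  matrices has its parameters as entries, without mixed terms; see
  \<open>foldr_elem_entry\<close>.\<close>

definition upper_pairs :: "nat \<Rightarrow> (nat \<times> nat) list" where
  "upper_pairs n = concat (map (\<lambda>i. map (Pair i) [Suc i..<n]) (rev [0..<n]))"

text \<open>The factorization into a diagonal and a unipotent part, stated as a word so that it
  makes sense in a group not known to consist of matrices.\<close>

definition tri_word :: "('g, 'm) monoid_scheme \<Rightarrow> nat \<Rightarrow> (nat \<Rightarrow> 'g) \<Rightarrow> (nat \<times> nat \<Rightarrow> 'g) \<Rightarrow> 'g" where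
  "tri_word G n d x =
    foldr (\<lambda>k. mult G (d k)) [0..<n] (foldr (\<lambda>p. mult G (x p)) (upper_pairs n) (one G))"

lemma set_upper_pairs: "set (upper_pairs n) = {(i, j). i < j \<and> j < n}"
  by (auto simp: upper_pairs_def image_iff)

text \<open>Reading the list from the right, row \<open>j\<close> is still untouched when a multiple of it is added
  to row \<open>i < j\<close>.\<close>

lemma sorted_upper_pairs: "sorted_wrt (\<lambda>(i, j) (k, l). k \<noteq> j \<and> (i, j) \<noteq> (k, l)) (upper_pairs n)"
proof -
  have "sorted_wrt (\<lambda>(i, j) (k, l). k \<noteq> j \<and> (i, j) \<noteq> (k, l))
      (concat (map (\<lambda>i. map (Pair i) [Suc i..<n]) (rev [0..<m])))" for m
  proof (induction m)
    case (Suc m)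
    have "sorted_wrt (\<lambda>(i, j) (k, l). k \<noteq> j \<and> (i, j) \<noteq> (k, l)) (map (Pair m) [Suc m..<n])"
      by (auto simp: sorted_wrt_map intro: sorted_wrt_mono_rel[OF _ sorted_wrt_upt])
    then show ?case using Suc by (auto simp: sorted_wrt_append)
  qed simp
  then show ?thesis unfolding upper_pairs_def .
qed

lemma (in abelian_monoid) finsum_swap:
  assumes "finite A" "finite B" "\<And>x y. x \<in> A \<Longrightarrow> y \<in> B \<Longrightarrow> f x y \<in> carrier G"
  shows "(\<Oplus>x\<in>A. \<Oplus>y\<in>B. f x y) = (\<Oplus>y\<in>B. \<Oplus>x\<in>A. f x y)"
  using assms(1,3)
proof (induction A rule: finite_induct)
  case empty
  then show ?case by (simp add: add.finprod_one)
next
  case (insert a A)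
  have "(\<Oplus>x\<in>insert a A. \<Oplus>y\<in>B. f x y) = (\<Oplus>y\<in>B. f a y) \<oplus> (\<Oplus>x\<in>A. \<Oplus>y\<in>B. f x y)"
    using insert by (intro finsum_insert) (auto intro!: finsum_closed)
  also have "\<dots> = (\<Oplus>y\<in>B. f a y) \<oplus> (\<Oplus>y\<in>B. \<Oplus>x\<in>A. f x y)" using insert by simp
  also have "\<dots> = (\<Oplus>y\<in>B. f a y \<oplus> (\<Oplus>x\<in>A. f x y))"
    using insert.prems by (intro finsum_addf[symmetric]) (auto intro!: finsum_closed)
  also have "\<dots> = (\<Oplus>y\<in>B. \<Oplus>x\<in>insert a A. f x y)"
    by (intro finsum_cong') (use insert in \<open>auto intro!: finsum_closed finsum_insert[symmetric]\<close>)
  finally show ?case .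
qed

locale matrices = cring R for R :: "('a, 'm) ring_scheme" (structure) + fixes n :: nat
begin

abbreviation "M \<equiv> matrix_monoid n R"
abbreviation "T \<equiv> triangular_group n R"

lemma mult_T: "mult T = mult M" and one_T: "one T = one M"
  by (simp_all add: triangular_group_def)

lemma carrier_M:
  "A \<in> carrier M \<longleftrightarrow> A \<in> carrier_mat n n \<and> (\<forall>i<n. \<forall>j<n. A $$ (i, j) \<in> carrier R)"
  by (simp add: matrix_monoid_def)

lemma entry_closed: "A \<in> carrier M \<Longrightarrow> i < n \<Longrightarrow> j < n \<Longrightarrow> A $$ (i, j) \<in> carrier R"
  by (simp add: carrier_M)

lemma M_eqI:
  assumes "A \<in> carrier M" "B \<in> carrier M" "\<And>i j. i < n \<Longrightarrow> j < n \<Longrightarrow> A $$ (i, j) = B $$ (i, j)"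
  shows "A = B"
  by (rule eq_matI) (use assms in \<open>auto simp: carrier_M\<close>)

lemma one_entry: "i < n \<Longrightarrow> j < n \<Longrightarrow> \<one>\<^bsub>M\<^esub> $$ (i, j) = (if i = j then \<one> else \<zero>)"
  by (simp add: matrix_monoid_def)

lemma mult_entry:
  "i < n \<Longrightarrow> j < n \<Longrightarrow> (A \<otimes>\<^bsub>M\<^esub> B) $$ (i, j) = (\<Oplus>k\<in>{..<n}. A $$ (i, k) \<otimes> B $$ (k, j))"
  by (simp add: matrix_monoid_def)

lemma mult_entry_support:
  assumes "A \<in> carrier M" "B \<in> carrier M" "i < n" "j < n" "S \<subseteq> {..<n}"
    "\<And>k. k < n \<Longrightarrow> k \<notin> S \<Longrightarrow> A $$ (i, k) = \<zero> \<or> B $$ (k, j) = \<zero>"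
  shows "(A \<otimes>\<^bsub>M\<^esub> B) $$ (i, j) = (\<Oplus>k\<in>S. A $$ (i, k) \<otimes> B $$ (k, j))"
  unfolding mult_entry[OF assms(3,4)]
proof (rule add.finprod_mono_neutral_cong_right)
  fix k assume "k \<in> {..<n} - S"
  then show "A $$ (i, k) \<otimes> B $$ (k, j) = \<zero>"
    using assms(6)[of k] assms(1-4) entry_closed by fastforce
qed (use assms entry_closed in auto)

lemma mult_M_closed: "A \<in> carrier M \<Longrightarrow> B \<in> carrier M \<Longrightarrow> A \<otimes>\<^bsub>M\<^esub> B \<in> carrier M"
  unfolding carrier_M by (auto simp: matrix_monoid_def intro!: finsum_closed)

lemma one_M_closed: "\<one>\<^bsub>M\<^esub> \<in> carrier M"
  unfolding carrier_M by (auto simp: matrix_monoid_def)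

lemma monoid_M: "monoid M"
proof (rule monoidI)
  fix A B C assume ABC: "A \<in> carrier M" "B \<in> carrier M" "C \<in> carrier M"
  show "A \<otimes>\<^bsub>M\<^esub> B \<otimes>\<^bsub>M\<^esub> C = A \<otimes>\<^bsub>M\<^esub> (B \<otimes>\<^bsub>M\<^esub> C)"
  proof (rule M_eqI)
    fix i j assume ij: "i < n" "j < n"
    note cl = entry_closed[OF ABC(1)] entry_closed[OF ABC(2)] entry_closed[OF ABC(3)]
    have "(A \<otimes>\<^bsub>M\<^esub> B \<otimes>\<^bsub>M\<^esub> C) $$ (i, j) = (\<Oplus>k\<in>{..<n}. (\<Oplus>l\<in>{..<n}. A $$ (i, l) \<otimes> B $$ (l, k)) \<otimes> C $$ (k, j))"
      unfolding mult_entry[OF ij] by (intro finsum_cong') (use ij cl in \<open>auto simp: mult_entry intro!: finsum_closed\<close>)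
    also have "\<dots> = (\<Oplus>k\<in>{..<n}. \<Oplus>l\<in>{..<n}. A $$ (i, l) \<otimes> B $$ (l, k) \<otimes> C $$ (k, j))"
      by (intro finsum_cong') (use ij cl in \<open>auto simp: finsum_ldistr intro!: finsum_closed\<close>)
    also have "\<dots> = (\<Oplus>l\<in>{..<n}. \<Oplus>k\<in>{..<n}. A $$ (i, l) \<otimes> B $$ (l, k) \<otimes> C $$ (k, j))"
      by (rule finsum_swap) (use ij cl in auto)
    also have "\<dots> = (\<Oplus>l\<in>{..<n}. A $$ (i, l) \<otimes> (\<Oplus>k\<in>{..<n}. B $$ (l, k) \<otimes> C $$ (k, j)))"
      by (intro finsum_cong') (use ij cl in \<open>auto simp: finsum_rdistr m_assoc intro!: finsum_closed finsum_cong'\<close>)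
    also have "\<dots> = (A \<otimes>\<^bsub>M\<^esub> (B \<otimes>\<^bsub>M\<^esub> C)) $$ (i, j)"
      unfolding mult_entry[OF ij] by (intro finsum_cong') (use ij cl in \<open>auto simp: mult_entry intro!: finsum_closed\<close>)
    finally show "(A \<otimes>\<^bsub>M\<^esub> B \<otimes>\<^bsub>M\<^esub> C) $$ (i, j) = (A \<otimes>\<^bsub>M\<^esub> (B \<otimes>\<^bsub>M\<^esub> C)) $$ (i, j)" .
  qed (use ABC mult_M_closed in auto)
next
  fix A assume A: "A \<in> carrier M"
  show "\<one>\<^bsub>M\<^esub> \<otimes>\<^bsub>M\<^esub> A = A"
  proof (rule M_eqI)
    fix i j assume ij: "i < n" "j < n"
    have "(\<one>\<^bsub>M\<^esub> \<otimes>\<^bsub>M\<^esub> A) $$ (i, j) = (\<Oplus>k\<in>{i}. \<one>\<^bsub>M\<^esub> $$ (i, k) \<otimes> A $$ (k, j))"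
      by (rule mult_entry_support) (use A ij one_M_closed one_entry in auto)
    then show "(\<one>\<^bsub>M\<^esub> \<otimes>\<^bsub>M\<^esub> A) $$ (i, j) = A $$ (i, j)"
      using entry_closed[OF A] ij by (simp add: one_entry finsum_insert)
  qed (use A one_M_closed mult_M_closed in auto)
  show "A \<otimes>\<^bsub>M\<^esub> \<one>\<^bsub>M\<^esub> = A"
  proof (rule M_eqI)
    fix i j assume ij: "i < n" "j < n"
    have "(A \<otimes>\<^bsub>M\<^esub> \<one>\<^bsub>M\<^esub>) $$ (i, j) = (\<Oplus>k\<in>{j}. A $$ (i, k) \<otimes> \<one>\<^bsub>M\<^esub> $$ (k, j))"
      by (rule mult_entry_support) (use A ij one_M_closed one_entry in auto)
    then show "(A \<otimes>\<^bsub>M\<^esub> \<one>\<^bsub>M\<^esub>) $$ (i, j) = A $$ (i, j)"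
      using entry_closed[OF A] ij by (simp add: one_entry finsum_insert)
  qed (use A one_M_closed mult_M_closed in auto)
qed (use mult_M_closed one_M_closed in auto)

section \<open>Elementary and diagonal matrices and their products\<close>

definition elem :: "nat \<Rightarrow> nat \<Rightarrow> 'a \<Rightarrow> 'a mat" where
  "elem i j r = mat n n (\<lambda>(k, l). if k = l then \<one> else if k = i \<and> l = j then r else \<zero>)"

definition diag :: "nat \<Rightarrow> 'a \<Rightarrow> 'a mat" where
  "diag i u = mat n n (\<lambda>(k, l). if k = l then (if k = i then u else \<one>) else \<zero>)"

lemma elem_entry:
  "k < n \<Longrightarrow> l < n \<Longrightarrow> elem i j r $$ (k, l) = (if k = l then \<one> else if k = i \<and> l = j then r else \<zero>)"
  by (simp add: elem_def)

lemma diag_entry: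
  "k < n \<Longrightarrow> l < n \<Longrightarrow> diag i u $$ (k, l) = (if k = l then (if k = i then u else \<one>) else \<zero>)"
  by (simp add: diag_def)

lemma elem_M: "r \<in> carrier R \<Longrightarrow> elem i j r \<in> carrier M"
  unfolding carrier_M by (auto simp: elem_def)

lemma diag_M: "u \<in> carrier R \<Longrightarrow> diag i u \<in> carrier M"
  unfolding carrier_M by (auto simp: diag_def)

lemma elem_mult_entry:
  assumes "A \<in> carrier M" "r \<in> carrier R" "i \<noteq> j" "i < n" "j < n" "k < n" "l < n"
  shows "(elem i j r \<otimes>\<^bsub>M\<^esub> A) $$ (k, l) = A $$ (k, l) \<oplus> (if k = i then r \<otimes> A $$ (j, l) else \<zero>)"
proof -
  have "(elem i j r \<otimes>\<^bsub>M\<^esub> A) $$ (k, l) =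
      (\<Oplus>m\<in>(if k = i then {i, j} else {k}). elem i j r $$ (k, m) \<otimes> A $$ (m, l))"
    by (rule mult_entry_support) (use assms elem_M elem_entry in \<open>auto split: if_splits\<close>)
  then show ?thesis using assms entry_closed[OF assms(1)]
    by (auto simp: finsum_insert elem_entry split: if_splits)
qed

lemma mult_elem_entry:
  assumes "A \<in> carrier M" "r \<in> carrier R" "i \<noteq> j" "i < n" "j < n" "k < n" "l < n"
  shows "(A \<otimes>\<^bsub>M\<^esub> elem i j r) $$ (k, l) = A $$ (k, l) \<oplus> (if l = j then A $$ (k, i) \<otimes> r else \<zero>)"
proof -
  have "(A \<otimes>\<^bsub>M\<^esub> elem i j r) $$ (k, l) =
      (\<Oplus>m\<in>(if l = j then {j, i} else {l}). A $$ (k, m) \<otimes> elem i j r $$ (m, l))"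
    by (rule mult_entry_support) (use assms elem_M elem_entry in \<open>auto split: if_splits\<close>)
  then show ?thesis using assms entry_closed[OF assms(1)]
    by (auto simp: finsum_insert elem_entry split: if_splits)
qed

lemma diag_mult_entry:
  assumes "A \<in> carrier M" "u \<in> carrier R" "k < n" "l < n"
  shows "(diag i u \<otimes>\<^bsub>M\<^esub> A) $$ (k, l) = (if k = i then u \<otimes> A $$ (k, l) else A $$ (k, l))"
proof -
  have "(diag i u \<otimes>\<^bsub>M\<^esub> A) $$ (k, l) = (\<Oplus>m\<in>{k}. diag i u $$ (k, m) \<otimes> A $$ (m, l))"
    by (rule mult_entry_support) (use assms diag_M diag_entry in \<open>auto split: if_splits\<close>)
  then show ?thesis using assms entry_closed[OF assms(1)]
    by (auto simp: finsum_insert diag_entry)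
qed

lemma mult_diag_entry:
  assumes "A \<in> carrier M" "u \<in> carrier R" "k < n" "l < n"
  shows "(A \<otimes>\<^bsub>M\<^esub> diag i u) $$ (k, l) = (if l = i then A $$ (k, l) \<otimes> u else A $$ (k, l))"
proof -
  have "(A \<otimes>\<^bsub>M\<^esub> diag i u) $$ (k, l) = (\<Oplus>m\<in>{l}. A $$ (k, m) \<otimes> diag i u $$ (m, l))"
    by (rule mult_entry_support) (use assms diag_M diag_entry in \<open>auto split: if_splits\<close>)
  then show ?thesis using assms entry_closed[OF assms(1)]
    by (auto simp: finsum_insert diag_entry)
qed

lemma elem_mult_elem:
  assumes "r \<in> carrier R" "s \<in> carrier R" "i \<noteq> j" "i < n" "j < n"
  shows "elem i j r \<otimes>\<^bsub>M\<^esub> elem i j s = elem i j (r \<oplus> s)"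
  by (rule M_eqI) (use assms in \<open>auto simp: elem_mult_entry elem_entry elem_M mult_M_closed a_comm\<close>)

lemma elem_zero: "elem i j \<zero> = \<one>\<^bsub>M\<^esub>"
  by (rule M_eqI) (auto simp: elem_entry one_entry elem_M one_M_closed)

lemma elem_Units:
  assumes "r \<in> carrier R" "i \<noteq> j" "i < n" "j < n"
  shows "elem i j r \<in> Units M"
  unfolding Units_def using assms
  by (auto simp: elem_M elem_mult_elem r_neg l_neg elem_zero intro!: bexI[of _ "elem i j (\<ominus> r)"])

lemma diag_Units:
  assumes "u \<in> Units R"
  shows "diag i u \<in> Units M"
proof -
  have "diag i u \<otimes>\<^bsub>M\<^esub> diag i v = \<one>\<^bsub>M\<^esub>" if "u \<in> carrier R" "v \<in> carrier R" "u \<otimes> v = \<one>" for u v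
    by (rule M_eqI) (use that in \<open>auto simp: diag_mult_entry diag_entry one_entry diag_M mult_M_closed one_M_closed\<close>)
  then show ?thesis
    unfolding Units_def using assms Units_closed[OF assms] Units_inv_closed[OF assms]
    by (auto simp: diag_M Units_l_inv Units_r_inv intro!: bexI[of _ "diag i (inv u)"])
qed

lemma foldr_elem_entry:
  assumes "\<forall>(i, j)\<in>set L. i < j \<and> j < n \<and> r i j \<in> carrier R"
    and "sorted_wrt (\<lambda>(i, j) (k, l). k \<noteq> j \<and> (i, j) \<noteq> (k, l)) L"
  shows "foldr (\<lambda>p. mult M (case p of (i, j) \<Rightarrow> elem i j (r i j))) L \<one>\<^bsub>M\<^esub> \<in> Units M \<and>
    (\<forall>k<n. \<forall>l<n. foldr (\<lambda>p. mult M (case p of (i, j) \<Rightarrow> elem i j (r i j))) L \<one>\<^bsub>M\<^esub> $$ (k, l) =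
      (if k = l then \<one> else if (k, l) \<in> set L then r k l else \<zero>))"
  using assms
proof (induction L)
  case Nil
  interpret M: monoid M by (rule monoid_M)
  show ?case by (auto simp: one_entry)
next
  case (Cons p L)
  interpret M: monoid M by (rule monoid_M)
  obtain i j where p: "p = (i, j)" by (cases p)
  let ?F = "foldr (\<lambda>p. mult M (case p of (i, j) \<Rightarrow> elem i j (r i j))) L \<one>\<^bsub>M\<^esub>"
  have ij: "i < j" "j < n" "i < n" "r i j \<in> carrier R" using Cons.prems p by auto
  have IH: "?F \<in> Units M" "\<And>k l. k < n \<Longrightarrow> l < n \<Longrightarrow> ?F $$ (k, l) =
      (if k = l then \<one> else if (k, l) \<in> set L then r k l else \<zero>)"
    using Cons by auto
  have FM: "?F \<in> carrier M" using IH(1) by (rule M.Units_closed)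
  \<comment> \<open>By the ordering, row \<open>j\<close> of the remaining product is still a row of
    the identity and its entry \<open>(i, j)\<close> is 0, so the new factor changes this one entry
    only.\<close>
  have nj: "(j, l) \<notin> set L" and nij: "(i, j) \<notin> set L" for l using Cons.prems(2) p by fastforce+
  have carr: "r k l \<in> carrier R" if "(k, l) \<in> set L" for k l using Cons.prems that by auto
  have "(elem i j (r i j) \<otimes>\<^bsub>M\<^esub> ?F) $$ (k, l) =
      (if k = l then \<one> else if (k, l) \<in> set (p # L) then r k l else \<zero>)" if kl: "k < n" "l < n" for k l
    unfolding elem_mult_entry[OF FM ij(4) less_imp_neq[OF ij(1)] ij(3,2) kl]
    using ij nj nij kl carr by (auto simp: IH(2) p)
  moreover have "elem i j (r i j) \<otimes>\<^bsub>M\<^esub> ?F \<in> Units M"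
    using elem_Units[of "r i j" i j] ij IH(1) by auto
  ultimately show ?case using p by simp
qed

lemma foldr_diag_entry:
  assumes "distinct L" "\<forall>k\<in>set L. d k \<in> Units R" "A \<in> Units M"
  shows "foldr (\<lambda>k. mult M (diag k (d k))) L A \<in> Units M \<and>
    (\<forall>k<n. \<forall>l<n. foldr (\<lambda>k. mult M (diag k (d k))) L A $$ (k, l) =
      (if k \<in> set L then d k \<otimes> A $$ (k, l) else A $$ (k, l)))"
  using assms
proof (induction L)
  case (Cons i L)
  interpret M: monoid M by (rule monoid_M)
  have "diag i (d i) \<in> Units M" "d i \<in> carrier R" using Cons.prems diag_Units by auto
  then show ?case using Cons by (auto simp: diag_mult_entry M.Units_closed)
qed simp

lemma tri_word_entry:
  assumes "\<And>i j. i < j \<Longrightarrow> j < n \<Longrightarrow> r i j \<in> carrier R" "\<And>k. k < n \<Longrightarrow> d k \<in> Units R"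
  shows "tri_word M n (\<lambda>k. diag k (d k)) (\<lambda>(i, j). elem i j (r i j)) \<in> Units M"
    and "\<And>k l. k < n \<Longrightarrow> l < n \<Longrightarrow>
      tri_word M n (\<lambda>k. diag k (d k)) (\<lambda>(i, j). elem i j (r i j)) $$ (k, l) =
      (if k = l then d k else if k < l then d k \<otimes> r k l else \<zero>)"
proof -
  let ?F = "foldr (\<lambda>p. mult M (case p of (i, j) \<Rightarrow> elem i j (r i j))) (upper_pairs n) \<one>\<^bsub>M\<^esub>"
  have F: "?F \<in> Units M" "\<And>k l. k < n \<Longrightarrow> l < n \<Longrightarrow> ?F $$ (k, l) =
      (if k = l then \<one> else if (k, l) \<in> set (upper_pairs n) then r k l else \<zero>)"
    using foldr_elem_entry[OF _ sorted_upper_pairs, of n r] assms(1)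
    by (auto simp: set_upper_pairs)
  have D: "foldr (\<lambda>k. mult M (diag k (d k))) [0..<n] ?F \<in> Units M" "\<And>k l. k < n \<Longrightarrow> l < n \<Longrightarrow>
      foldr (\<lambda>k. mult M (diag k (d k))) [0..<n] ?F $$ (k, l) = d k \<otimes> ?F $$ (k, l)"
    using foldr_diag_entry[of "[0..<n]" d ?F] assms(2) F(1) by auto
  show "tri_word M n (\<lambda>k. diag k (d k)) (\<lambda>(i, j). elem i j (r i j)) \<in> Units M"
    unfolding tri_word_def using D(1) .
  show "tri_word M n (\<lambda>k. diag k (d k)) (\<lambda>(i, j). elem i j (r i j)) $$ (k, l) =
      (if k = l then d k else if k < l then d k \<otimes> r k l else \<zero>)" if kl: "k < n" "l < n" for k l
    unfolding tri_word_def D(2)[OF kl] F(2)[OF kl] using Units_closed[OF assms(2)[OF kl(1)]] kl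
    by (auto simp: set_upper_pairs)
qed

lemma tri_word_T: "tri_word T n d x = tri_word M n d x"
  by (simp add: tri_word_def mult_T one_T)

text \<open>Induction from the last row upwards. Below row \<open>i\<close> the inverse is already
  known to be triangular, so for \<open>j \<le> i\<close> the entry \<open>(i, j)\<close> of the
  product is the single term \<open>A $$ (i, i) \<otimes> B $$ (i, j)\<close>. For
  \<open>j = i\<close> it makes the diagonal entry a unit, which then forces the entries with
  \<open>j < i\<close> to vanish.\<close>

lemma upper_inverse_entries:
  assumes AB: "A \<in> carrier M" "B \<in> carrier M" "A \<otimes>\<^bsub>M\<^esub> B = \<one>\<^bsub>M\<^esub>"
    and upper: "\<And>i j. i < n \<Longrightarrow> j < i \<Longrightarrow> A $$ (i, j) = \<zero>"
    and "i < n"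
  shows "A $$ (i, i) \<otimes> B $$ (i, i) = \<one> \<and> (\<forall>j<i. B $$ (i, j) = \<zero>)"
  using \<open>i < n\<close>
proof (induction "n - i" arbitrary: i rule: less_induct)
  case less
  have low: "B $$ (k, j) = \<zero>" if "i < k" "k < n" "j \<le> i" for k j
    using less.hyps[of k] that less.prems by auto
  have prod: "A $$ (i, i) \<otimes> B $$ (i, j) = (if i = j then \<one> else \<zero>)" if "j \<le> i" for j
  proof -
    have "(A \<otimes>\<^bsub>M\<^esub> B) $$ (i, j) = (\<Oplus>k\<in>{i}. A $$ (i, k) \<otimes> B $$ (k, j))"
      by (rule mult_entry_support[OF AB(1,2)])
        (use less.prems that upper low in \<open>auto, metis linorder_neqE_nat\<close>)
    then show ?thesis
      using AB less.prems that entry_closed[OF AB(1)] entry_closed[OF AB(2)] by (simp add: one_entry finsum_insert)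
  qed
  have u: "A $$ (i, i) \<otimes> B $$ (i, i) = \<one>" using prod[of i] by simp
  have "B $$ (i, j) = \<zero>" if "j < i" for j
  proof -
    have cl: "A $$ (i, i) \<in> carrier R" "B $$ (i, i) \<in> carrier R" "B $$ (i, j) \<in> carrier R"
      using that less.prems AB entry_closed by auto
    have "B $$ (i, j) = (A $$ (i, i) \<otimes> B $$ (i, i)) \<otimes> B $$ (i, j)" using u cl by simp
    also have "\<dots> = B $$ (i, i) \<otimes> (A $$ (i, i) \<otimes> B $$ (i, j))" using cl by (simp add: m_ac)
    finally show ?thesis using prod[of j] that cl by simp
  qed
  then show ?case using u by blast
qed

text \<open>The definition asks for an inverse among all matrices; here this becomes a condition on
  the diagonal. From right to left, \<open>A\<close> is recognized as a \<open>tri_word\<close> of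
  invertible diagonal and elementary matrices.\<close>

lemma carrier_T:
  "A \<in> carrier T \<longleftrightarrow> A \<in> carrier M \<and> (\<forall>i<n. \<forall>j<i. A $$ (i, j) = \<zero>) \<and> (\<forall>i<n. A $$ (i, i) \<in> Units R)"
proof
  assume A: "A \<in> carrier T"
  then obtain B where AM: "A \<in> carrier M" and B: "B \<in> carrier M" "A \<otimes>\<^bsub>M\<^esub> B = \<one>\<^bsub>M\<^esub>"
    and upper: "\<forall>i<n. \<forall>j<i. A $$ (i, j) = \<zero>"
    unfolding triangular_group_def Units_def by auto
  have "A $$ (i, i) \<in> Units R" if "i < n" for i
  proof -
    have "A $$ (i, i) \<otimes> B $$ (i, i) = \<one>" using upper_inverse_entries[OF AM B _ that] upper by blast
    then show ?thesis using that entry_closed[OF AM] entry_closed[OF B(1)]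
      by (auto simp: Units_def m_comm intro!: bexI[of _ "B $$ (i, i)"])
  qed
  then show "A \<in> carrier M \<and> (\<forall>i<n. \<forall>j<i. A $$ (i, j) = \<zero>) \<and> (\<forall>i<n. A $$ (i, i) \<in> Units R)"
    using AM upper by blast
next
  assume *: "A \<in> carrier M \<and> (\<forall>i<n. \<forall>j<i. A $$ (i, j) = \<zero>) \<and> (\<forall>i<n. A $$ (i, i) \<in> Units R)"
  then have A: "A \<in> carrier M" and upper: "\<And>i j. i < n \<Longrightarrow> j < i \<Longrightarrow> A $$ (i, j) = \<zero>"
    and u: "\<And>i. i < n \<Longrightarrow> A $$ (i, i) \<in> Units R" by auto
  interpret M: monoid M by (rule monoid_M)
  let ?W = "tri_word M n (\<lambda>k. diag k (A $$ (k, k))) (\<lambda>(i, j). elem i j (inv (A $$ (i, i)) \<otimes> A $$ (i, j)))"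
  have W: "?W \<in> Units M" "\<And>k l. k < n \<Longrightarrow> l < n \<Longrightarrow> ?W $$ (k, l) =
     (if k = l then A $$ (k, k) else if k < l then A $$ (k, k) \<otimes> (inv (A $$ (k, k)) \<otimes> A $$ (k, l)) else \<zero>)"
    by (rule tri_word_entry; use u A entry_closed in force)+
  have "?W = A"
  proof (rule M_eqI)
    fix k l assume kl: "k < n" "l < n"
    have "A $$ (k, k) \<otimes> (inv (A $$ (k, k)) \<otimes> A $$ (k, l)) = A $$ (k, l)"
      using u[OF kl(1)] entry_closed[OF A kl] by (simp add: m_assoc[symmetric] Units_r_inv Units_closed)
    then show "?W $$ (k, l) = A $$ (k, l)" unfolding W(2)[OF kl] using upper kl by auto
  qed (use W A in auto)
  then show "A \<in> carrier T" using W(1) upper unfolding triangular_group_def by auto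
qed

lemma group_T: "group T"
proof (rule groupI)
  interpret M: monoid M by (rule monoid_M)
  have TM: "A \<in> carrier M" if "A \<in> carrier T" for A using that by (simp add: carrier_T)
  show "A \<otimes>\<^bsub>T\<^esub> B \<in> carrier T" if A: "A \<in> carrier T" and B: "B \<in> carrier T" for A B
  proof -
    have "A \<in> Units M" "B \<in> Units M" using A B by (auto simp: triangular_group_def)
    then have "A \<otimes>\<^bsub>M\<^esub> B \<in> Units M" by simp
    moreover have "(A \<otimes>\<^bsub>M\<^esub> B) $$ (i, j) = \<zero>" if "i < n" "j < i" for i j
    proof -
      have "(A \<otimes>\<^bsub>M\<^esub> B) $$ (i, j) = (\<Oplus>k\<in>{}. A $$ (i, k) \<otimes> B $$ (k, j))"
        by (rule mult_entry_support) (use A B TM that in \<open>auto simp: carrier_T, metis less_trans linorder_neqE_nat\<close>)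
      then show ?thesis by simp
    qed
    ultimately show ?thesis unfolding mult_T by (auto simp: triangular_group_def)
  qed
  show "\<one>\<^bsub>T\<^esub> \<in> carrier T" unfolding one_T carrier_T using one_M_closed by (auto simp: one_entry)
  show "\<exists>B\<in>carrier T. B \<otimes>\<^bsub>T\<^esub> A = \<one>\<^bsub>T\<^esub>" if A: "A \<in> carrier T" for A
  proof -
    have U: "A \<in> Units M" using A by (auto simp: triangular_group_def)
    then have "m_inv M A \<in> Units M" "A \<otimes>\<^bsub>M\<^esub> m_inv M A = \<one>\<^bsub>M\<^esub>" "m_inv M A \<otimes>\<^bsub>M\<^esub> A = \<one>\<^bsub>M\<^esub>" by auto
    moreover have "m_inv M A $$ (i, j) = \<zero>" if "i < n" "j < i" for i j
      using upper_inverse_entries[OF TM[OF A] _ calculation(2) _ that(1)] A calculation(1) that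
      by (auto simp: carrier_T)
    ultimately show ?thesis unfolding mult_T one_T
      by (intro bexI[of _ "m_inv M A"]) (auto simp: triangular_group_def)
  qed
qed (use monoid.m_assoc[OF monoid_M] monoid.l_one[OF monoid_M] in \<open>auto simp: mult_T one_T carrier_T\<close>)

end


section \<open>Interpreting a ring in a group\<close>

text \<open>If \<open>m\<close> is the number of units of \<open>R\<close>, then \<open>m\<close>-th powers in \<open>T\<^sub>n(R)\<close> are unipotent, and the sets
  below are: the root subgroup of the entry \<open>(1, n)\<close>; the scalar multiples of the products of the
  root subgroups of \<open>(1, n - 1)\<close>, \<open>(2, n)\<close> and \<open>(1, n)\<close>; a subgroup containing all unipotent
  matrices. The commutator induces the pairing \<open>x\<^sub>1\<^sub>2 y\<^sub>2\<^sub>n - y\<^sub>1\<^sub>,\<^sub>n\<^sub>-\<^sub>1 x\<^sub>n\<^sub>-\<^sub>1\<^sub>,\<^sub>n\<close> of \<open>corner_dual\<close> with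
  \<open>second_corner\<close>, whose values lie in \<open>corner\<close>. (Here rows and columns are numbered from 1, in the
  code from 0.)\<close>

definition corner :: "nat \<Rightarrow> ('a, 'm) monoid_scheme \<Rightarrow> 'a set" where
  "corner m G = {x \<in> carrier G.
     (\<forall>h\<in>carrier G. x \<otimes>\<^bsub>G\<^esub> (h [^]\<^bsub>G\<^esub> m) = (h [^]\<^bsub>G\<^esub> m) \<otimes>\<^bsub>G\<^esub> x) \<and>
     (\<exists>g\<in>carrier G. \<exists>h\<in>carrier G. g \<otimes>\<^bsub>G\<^esub> h = x \<otimes>\<^bsub>G\<^esub> (h \<otimes>\<^bsub>G\<^esub> g))}"

text \<open>\<open>z\<close> is the commutator of \<open>x\<close> and \<open>y\<close>, accepted
  only if it lies in the corner.\<close>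

definition comm_rel :: "nat \<Rightarrow> ('a, 'm) monoid_scheme \<Rightarrow> 'a \<Rightarrow> 'a \<Rightarrow> 'a \<Rightarrow> bool" where
  "comm_rel m G x y z \<longleftrightarrow> z \<in> corner m G \<and> x \<otimes>\<^bsub>G\<^esub> y = z \<otimes>\<^bsub>G\<^esub> (y \<otimes>\<^bsub>G\<^esub> x)"

definition second_corner :: "nat \<Rightarrow> ('a, 'm) monoid_scheme \<Rightarrow> 'a set" where
  "second_corner m G = {g \<in> carrier G. \<forall>h\<in>carrier G. \<exists>z\<in>carrier G. comm_rel m G g (h [^]\<^bsub>G\<^esub> m) z}"

definition corner_dual :: "nat \<Rightarrow> ('a, 'm) monoid_scheme \<Rightarrow> 'a set" where
  "corner_dual m G = {x \<in> carrier G. (\<forall>z\<in>carrier G. z \<in> corner m G \<longrightarrow> x \<otimes>\<^bsub>G\<^esub> z = z \<otimes>\<^bsub>G\<^esub> x) \<and>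
     (\<forall>y\<in>carrier G. y \<in> second_corner m G \<longrightarrow> (\<exists>z\<in>carrier G. comm_rel m G x y z))}"

text \<open>Modulo the kernel of the pairing of \<open>corner_dual\<close> with \<open>second_corner\<close>, this is the
  line spanned by \<open>a\<close>.\<close>

definition dual_line :: "nat \<Rightarrow> ('a, 'm) monoid_scheme \<Rightarrow> 'a \<Rightarrow> 'a set" where
  "dual_line m G a = {x \<in> carrier G. x \<in> corner_dual m G \<and>
     (\<forall>y\<in>carrier G. y \<in> second_corner m G \<longrightarrow> a \<otimes>\<^bsub>G\<^esub> y = y \<otimes>\<^bsub>G\<^esub> a \<longrightarrow> x \<otimes>\<^bsub>G\<^esub> y = y \<otimes>\<^bsub>G\<^esub> x)}"

text \<open>If \<open>x'\<close> is \<open>t\<close> times \<open>a\<close> modulo the kernel of the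
  pairing, then \<open>x\<close>, \<open>y\<close>, \<open>z\<close> encode \<open>t\<close> times
  the value at \<open>(a, b)\<close>, the value at \<open>(a, y')\<close>, and \<open>t\<close>
  times the latter. Hence \<open>z\<close> is the product of \<open>x\<close> and \<open>y\<close>
  divided by the value at \<open>(a, b)\<close>.\<close>

definition corner_prod_rel :: "nat \<Rightarrow> ('a, 'm) monoid_scheme \<Rightarrow> 'a \<Rightarrow> 'a \<Rightarrow> 'a \<Rightarrow> 'a \<Rightarrow> 'a \<Rightarrow> bool" where
  "corner_prod_rel m G a b x y z \<longleftrightarrow> (\<exists>x'\<in>carrier G. \<exists>y'\<in>carrier G. x' \<in> dual_line m G a \<and>
     y' \<in> second_corner m G \<and> comm_rel m G x' b x \<and> comm_rel m G a y' y \<and> comm_rel m G x' y' z)"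

text \<open>The default value makes this a total operation on the carrier for all \<open>a\<close>
  and \<open>b\<close>, frame or not, as \<open>definable_fun\<close> requires.\<close>

definition corner_mult :: "nat \<Rightarrow> ('a, 'm) monoid_scheme \<Rightarrow> 'a \<Rightarrow> 'a \<Rightarrow> 'a \<Rightarrow> 'a \<Rightarrow> 'a" where
  "corner_mult m G a b x y =
     (if \<exists>!z. z \<in> carrier G \<and> corner_prod_rel m G a b x y z
      then THE z. z \<in> carrier G \<and> corner_prod_rel m G a b x y z else \<one>\<^bsub>G\<^esub>)"

text \<open>The commutator of \<open>a\<close> and \<open>b\<close>. The product divides by the
  value of the pairing at \<open>(a, b)\<close>, so this element acts as the unit.\<close>

definition corner_one :: "('a, 'm) monoid_scheme \<Rightarrow> 'a \<Rightarrow> 'a \<Rightarrow> 'a" where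
  "corner_one G a b = (a \<otimes>\<^bsub>G\<^esub> b) \<otimes>\<^bsub>G\<^esub> inv\<^bsub>G\<^esub> (b \<otimes>\<^bsub>G\<^esub> a)"

definition corner_ring :: "nat \<Rightarrow> ('a, 'm) monoid_scheme \<Rightarrow> 'a \<Rightarrow> 'a \<Rightarrow> 'a ring" where
  "corner_ring m G a b = \<lparr>carrier = corner m G, mult = corner_mult m G a b, one = corner_one G a b,
     ring.zero = \<one>\<^bsub>G\<^esub>, add = mult G\<rparr>"

text \<open>The two surjectivity properties supply the \<open>y'\<close> and \<open>x'\<close> that
  \<open>corner_prod_rel\<close> asks for. In the triangular group they also force the value of the
  pairing at \<open>(a, b)\<close> to be a unit.\<close>

definition corner_frame :: "nat \<Rightarrow> ('a, 'm) monoid_scheme \<Rightarrow> 'a \<Rightarrow> 'a \<Rightarrow> bool" where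
  "corner_frame m G a b \<longleftrightarrow> a \<in> corner_dual m G \<and> b \<in> second_corner m G \<and>
     (\<forall>y\<in>carrier G. y \<in> corner m G \<longrightarrow> (\<exists>y'\<in>carrier G. y' \<in> second_corner m G \<and> comm_rel m G a y' y)) \<and>
     (\<forall>x\<in>carrier G. x \<in> corner m G \<longrightarrow> (\<exists>x'\<in>carrier G. x' \<in> dual_line m G a \<and> comm_rel m G x' b x))"

text \<open>The axioms of a commutative ring, in a form that is visibly first-order over \<open>G\<close>.\<close>

definition corner_ring_axioms :: "nat \<Rightarrow> ('a, 'm) monoid_scheme \<Rightarrow> 'a \<Rightarrow> 'a \<Rightarrow> bool" where
  "corner_ring_axioms m G a b \<longleftrightarrow>
     \<one>\<^bsub>G\<^esub> \<in> corner m G \<and> corner_one G a b \<in> corner m G \<and>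
     (\<forall>x\<in>carrier G. x \<in> corner m G \<longrightarrow> inv\<^bsub>G\<^esub> x \<in> corner m G \<and> corner_mult m G a b (corner_one G a b) x = x) \<and>
     (\<forall>x\<in>carrier G. \<forall>y\<in>carrier G. x \<in> corner m G \<and> y \<in> corner m G \<longrightarrow>
        x \<otimes>\<^bsub>G\<^esub> y \<in> corner m G \<and> x \<otimes>\<^bsub>G\<^esub> y = y \<otimes>\<^bsub>G\<^esub> x \<and>
        corner_mult m G a b x y \<in> corner m G \<and> corner_mult m G a b x y = corner_mult m G a b y x) \<and>
     (\<forall>x\<in>carrier G. \<forall>y\<in>carrier G. \<forall>z\<in>carrier G. x \<in> corner m G \<and> y \<in> corner m G \<and> z \<in> corner m G \<longrightarrow>
        corner_mult m G a b (corner_mult m G a b x y) z = corner_mult m G a b x (corner_mult m G a b y z) \<and>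
        corner_mult m G a b (x \<otimes>\<^bsub>G\<^esub> y) z = corner_mult m G a b x z \<otimes>\<^bsub>G\<^esub> corner_mult m G a b y z)"

lemma corner_carrier: "x \<in> corner m G \<Longrightarrow> x \<in> carrier G"
  by (simp add: corner_def)

lemma corner_ring_simps [simp]:
  "carrier (corner_ring m G a b) = corner m G"
  "mult (corner_ring m G a b) = corner_mult m G a b"
  "one (corner_ring m G a b) = corner_one G a b"
  "\<zero>\<^bsub>corner_ring m G a b\<^esub> = \<one>\<^bsub>G\<^esub>"
  "add (corner_ring m G a b) = mult G"
  by (simp_all add: corner_ring_def)

lemma cring_corner_ringI:
  assumes "group G" "corner_ring_axioms m G a b"
  shows "cring (corner_ring m G a b)"
proof -
  interpret group G by fact
  note ax = assms(2)[unfolded corner_ring_axioms_def]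
  have one: "\<one>\<^bsub>G\<^esub> \<in> corner m G" "corner_one G a b \<in> corner m G" using ax by blast+
  have un: "inv\<^bsub>G\<^esub> x \<in> corner m G" "corner_mult m G a b (corner_one G a b) x = x"
    if "x \<in> corner m G" for x
    using ax that corner_carrier[OF that] by blast+
  have bin: "x \<otimes>\<^bsub>G\<^esub> y \<in> corner m G" "x \<otimes>\<^bsub>G\<^esub> y = y \<otimes>\<^bsub>G\<^esub> x"
    "corner_mult m G a b x y \<in> corner m G" "corner_mult m G a b x y = corner_mult m G a b y x"
    if "x \<in> corner m G" "y \<in> corner m G" for x y
    using ax that corner_carrier[OF that(1)] corner_carrier[OF that(2)] by blast+
  have ter: "corner_mult m G a b (corner_mult m G a b x y) z = corner_mult m G a b x (corner_mult m G a b y z)"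
    "corner_mult m G a b (x \<otimes>\<^bsub>G\<^esub> y) z = corner_mult m G a b x z \<otimes>\<^bsub>G\<^esub> corner_mult m G a b y z"
    if "x \<in> corner m G" "y \<in> corner m G" "z \<in> corner m G" for x y z
    using ax that corner_carrier[OF that(1)] corner_carrier[OF that(2)] corner_carrier[OF that(3)] by blast+
  show ?thesis
  proof (rule cringI)
    show "abelian_group (corner_ring m G a b)"
    proof (rule abelian_groupI; unfold corner_ring_simps)
      fix x assume x: "x \<in> corner m G"
      show "\<exists>y\<in>corner m G. y \<otimes>\<^bsub>G\<^esub> x = \<one>\<^bsub>G\<^esub>"
        using un(1)[OF x] corner_carrier[OF x] by (intro bexI[of _ "inv\<^bsub>G\<^esub> x"]) simp_all
      show "\<one>\<^bsub>G\<^esub> \<otimes>\<^bsub>G\<^esub> x = x" using corner_carrier[OF x] by simp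
    qed (rule one bin m_assoc | rule corner_carrier | assumption)+
    show "Group.comm_monoid (corner_ring m G a b)"
      by (rule Group.comm_monoidI; unfold corner_ring_simps) (rule one un bin ter | assumption)+
  qed (unfold corner_ring_simps, rule ter)
qed

text \<open>Ring terms evaluated by group operations alone, with the group inverse for the additive
  inverse. This makes sense for all \<open>a\<close> and \<open>b\<close>, and definability follows
  by induction on terms.\<close>

primrec corner_trm_val ::
  "nat \<Rightarrow> ('a, 'm) monoid_scheme \<Rightarrow> 'a \<Rightarrow> 'a \<Rightarrow> (nat \<Rightarrow> 'a) \<Rightarrow> ring_trm \<Rightarrow> 'a" where
  "corner_trm_val m G a b e (RVar x) = e x"
| "corner_trm_val m G a b e RZero = \<one>\<^bsub>G\<^esub>"
| "corner_trm_val m G a b e ROne = corner_one G a b"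
| "corner_trm_val m G a b e (RAdd s t) = corner_trm_val m G a b e s \<otimes>\<^bsub>G\<^esub> corner_trm_val m G a b e t"
| "corner_trm_val m G a b e (RNeg t) = inv\<^bsub>G\<^esub> (corner_trm_val m G a b e t)"
| "corner_trm_val m G a b e (RMult s t) =
     corner_mult m G a b (corner_trm_val m G a b e s) (corner_trm_val m G a b e t)"

lemma ring_trm_val_closed:
  assumes "ring R" "range e \<subseteq> carrier R"
  shows "ring_trm_val R e t \<in> carrier R"
proof -
  interpret ring R by fact
  show ?thesis using assms(2) by (induction t) auto
qed

lemma corner_trm_val_eq:
  assumes "group G" "ring (corner_ring m G a b)" "range e \<subseteq> corner m G"
  shows "ring_trm_val (corner_ring m G a b) e t = corner_trm_val m G a b e t"
proof (induction t)
  case (RNeg t)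
  interpret group G by fact
  interpret R: ring "corner_ring m G a b" by fact
  let ?v = "ring_trm_val (corner_ring m G a b) e t"
  have v: "?v \<in> corner m G" using ring_trm_val_closed[OF assms(2), of e t] assms(3) by simp
  have "\<ominus>\<^bsub>corner_ring m G a b\<^esub> ?v \<in> corner m G" using R.a_inv_closed[of ?v] v by simp
  moreover have "\<ominus>\<^bsub>corner_ring m G a b\<^esub> ?v \<otimes>\<^bsub>G\<^esub> ?v = \<one>\<^bsub>G\<^esub>" using R.l_neg[of ?v] v by simp
  ultimately have "inv\<^bsub>G\<^esub> ?v = \<ominus>\<^bsub>corner_ring m G a b\<^esub> ?v"
    using v by (intro inv_equality) (auto intro: corner_carrier)
  then show ?case using RNeg by simp
qed auto

lemma sat_ev_cong:
  assumes "\<And>e t. range e \<subseteq> A \<Longrightarrow> ev e t = ev' e t" "range e \<subseteq> A"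
  shows "sat A ev e \<phi> \<longleftrightarrow> sat A ev' e \<phi>"
  using assms(2)
proof (induction \<phi> arbitrary: e)
  case (Ex x \<phi>)
  have "sat A ev (e(x := a)) \<phi> \<longleftrightarrow> sat A ev' (e(x := a)) \<phi>" if "a \<in> A" for a
    using Ex that by (intro Ex.IH) auto
  then show ?case by auto
qed (use assms(1) in auto)

lemma sat_iso:
  assumes bij: "bij_betw h A B" and ev: "\<And>e t. range e \<subseteq> A \<Longrightarrow> h (ev e t) = ev' (\<lambda>i. h (e i)) t"
    and closed: "\<And>e t. range e \<subseteq> A \<Longrightarrow> ev e t \<in> A" and "range e \<subseteq> A"
  shows "sat A ev e \<phi> \<longleftrightarrow> sat B ev' (\<lambda>i. h (e i)) \<phi>"
  using assms(4)
proof (induction \<phi> arbitrary: e)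
  case (Eq s t)
  then show ?case using ev closed bij by (metis bij_betw_def inj_on_def sat.simps(1))
next
  case (Ex x \<phi>)
  have upd: "(\<lambda>i. h ((e(x := a)) i)) = (\<lambda>i. h (e i))(x := h a)" for a by auto
  have "sat A ev (e(x := a)) \<phi> \<longleftrightarrow> sat B ev' ((\<lambda>i. h (e i))(x := h a)) \<phi>" if "a \<in> A" for a
  proof -
    have "range (e(x := a)) \<subseteq> A" using Ex.prems that by auto
    from Ex.IH[OF this] show ?thesis unfolding upd .
  qed
  moreover have "B = h ` A" using bij by (simp add: bij_betw_def)
  ultimately show ?case by auto
qed auto

section \<open>Coordinates\<close>

text \<open>The parameters \<open>p (i, j, k)\<close> stand for elementary matrices (\<open>i < j\<close>) and diagonal
  matrices (\<open>i = j\<close>) with entry the \<open>k\<close>-th of \<open>q\<close> fixed scalars; the scalars of index \<open>ko\<close>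
  and \<open>kn\<close> are \<open>1\<close> and \<open>- 1\<close>. The second factor \<open>w\<close> below is the commutator of a diagonal
  sign matrix with \<open>y\<close>, which runs through the elementary matrices with even entry.\<close>

type_synonym 'a params = "nat \<times> nat \<times> nat \<Rightarrow> 'a"

definition root_elem :: "('a, 'm) monoid_scheme \<Rightarrow> nat \<Rightarrow> nat \<Rightarrow> nat \<Rightarrow> 'a params \<Rightarrow> nat \<Rightarrow> nat \<Rightarrow> 'a \<Rightarrow> bool" where
  "root_elem G n q kn p i j x \<longleftrightarrow> (\<exists>k\<in>{..<q}. \<exists>w\<in>carrier G. \<exists>y\<in>carrier G.
     (\<forall>l\<in>{..<n} - {i, j}. y \<otimes>\<^bsub>G\<^esub> p (l, l, kn) = p (l, l, kn) \<otimes>\<^bsub>G\<^esub> y) \<and>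
     w \<otimes>\<^bsub>G\<^esub> (y \<otimes>\<^bsub>G\<^esub> p (i, i, kn)) = p (i, i, kn) \<otimes>\<^bsub>G\<^esub> y \<and> x = p (i, j, k) \<otimes>\<^bsub>G\<^esub> w)"

text \<open>Commutators with the elementary matrices of entry 1 at \<open>(j, n - 1)\<close> and at
  \<open>(0, i)\<close> move an entry from \<open>(i, j)\<close> to \<open>(i, n - 1)\<close> and on
  to \<open>(0, n - 1)\<close> without changing it. The cases skip the moves that are not called
  for.\<close>

definition root_coord :: "('a, 'm) monoid_scheme \<Rightarrow> nat \<Rightarrow> nat \<Rightarrow> 'a params \<Rightarrow> nat \<Rightarrow> nat \<Rightarrow> 'a \<Rightarrow> 'a \<Rightarrow> bool" where
  "root_coord G n ko p i j x v =
     (if i = 0 \<and> j = n - 1 then v = x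
      else if i = 0 then x \<otimes>\<^bsub>G\<^esub> p (j, n - 1, ko) = v \<otimes>\<^bsub>G\<^esub> (p (j, n - 1, ko) \<otimes>\<^bsub>G\<^esub> x)
      else if j = n - 1 then p (0, i, ko) \<otimes>\<^bsub>G\<^esub> x = v \<otimes>\<^bsub>G\<^esub> (x \<otimes>\<^bsub>G\<^esub> p (0, i, ko))
      else \<exists>w\<in>carrier G. x \<otimes>\<^bsub>G\<^esub> p (j, n - 1, ko) = w \<otimes>\<^bsub>G\<^esub> (p (j, n - 1, ko) \<otimes>\<^bsub>G\<^esub> x) \<and>
        p (0, i, ko) \<otimes>\<^bsub>G\<^esub> w = v \<otimes>\<^bsub>G\<^esub> (w \<otimes>\<^bsub>G\<^esub> p (0, i, ko)))"

abbreviation "params_mult m G n ko p \<equiv> corner_mult m G (p (0, 1, ko)) (p (1, n - 1, ko))"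

text \<open>\<open>c\<close> holds the entries of \<open>g\<close>, encoded in the corner.
  \<open>\<kappa>\<close> picks the diagonal entries out of finitely many units, so its quantifier
  is a finite disjunction; \<open>y\<close> encodes the entries of the elementary factors
  \<open>x\<close>. Multiplying the unipotent part by the diagonal on the left scales row
  \<open>i\<close>, which explains the product in \<open>c (i, j)\<close>.\<close>

definition coord_rel :: "nat \<Rightarrow> ('a, 'm) monoid_scheme \<Rightarrow> nat \<Rightarrow> nat \<Rightarrow> nat \<Rightarrow> nat \<Rightarrow> nat set \<Rightarrow>
    'a params \<Rightarrow> (nat \<times> nat \<Rightarrow> 'a) \<Rightarrow> 'a \<Rightarrow> bool" where
  "coord_rel m G n q ko kn U p c g \<longleftrightarrow> (\<exists>\<kappa>\<in>{..<n} \<rightarrow>\<^sub>E U.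
     (\<forall>i\<in>{..<n}. c (i, i) = p (0, n - 1, \<kappa> i)) \<and>
     (\<exists>x. (\<forall>ij. x ij \<in> carrier G) \<and> (\<exists>y. (\<forall>ij. y ij \<in> carrier G) \<and>
       (\<forall>i\<in>{..<n}. \<forall>j\<in>{i<..<n}. y (i, j) \<in> corner m G \<and> root_elem G n q kn p i j (x (i, j)) \<and>
         root_coord G n ko p i j (x (i, j)) (y (i, j)) \<and>
         c (i, j) = params_mult m G n ko p (p (0, n - 1, \<kappa> i)) (y (i, j))) \<and>
       g = tri_word G n (\<lambda>i. p (i, i, \<kappa> i)) x)))"

text \<open>By \<open>carrier_T\<close>, these are the members of the triangular group over the
  corner ring, in terms of the group alone.\<close>

definition coord_mat :: "nat \<Rightarrow> ('a, 'm) monoid_scheme \<Rightarrow> nat \<Rightarrow> nat \<Rightarrow> 'a params \<Rightarrow> (nat \<times> nat \<Rightarrow> 'a) \<Rightarrow> bool" where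
  "coord_mat m G n ko p c \<longleftrightarrow> (\<forall>i\<in>{..<n}. \<forall>j\<in>{..<n}. c (i, j) \<in> corner m G) \<and>
     (\<forall>i\<in>{..<n}. \<forall>j\<in>{..<i}. c (i, j) = \<one>\<^bsub>G\<^esub>) \<and>
     (\<forall>i\<in>{..<n}. \<exists>y\<in>carrier G. y \<in> corner m G \<and>
        params_mult m G n ko p (c (i, i)) y = corner_one G (p (0, 1, ko)) (p (1, n - 1, ko)))"

definition coord_prod :: "nat \<Rightarrow> ('a, 'm) monoid_scheme \<Rightarrow> nat \<Rightarrow> nat \<Rightarrow> 'a params \<Rightarrow>
    (nat \<times> nat \<Rightarrow> 'a) \<Rightarrow> (nat \<times> nat \<Rightarrow> 'a) \<Rightarrow> nat \<times> nat \<Rightarrow> 'a" where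
  "coord_prod m G n ko p c d = (\<lambda>(i, j).
     foldr (\<lambda>k. mult G (params_mult m G n ko p (c (i, k)) (d (k, j)))) [0..<n] \<one>\<^bsub>G\<^esub>)"

text \<open>The one statement that is transferred to \<open>H\<close>. Beyond the frame and the ring
  axioms, it says that \<open>coord_rel\<close> is the graph of an isomorphism: matrices and group
  elements correspond in both directions, equality on one side is equality on the other, and
  products match. The product matrix is introduced as a further tuple \<open>f\<close>, given by its
  entries.\<close>

definition coordinatized :: "nat \<Rightarrow> ('a, 'm) monoid_scheme \<Rightarrow> nat \<Rightarrow> nat \<Rightarrow> nat \<Rightarrow> nat \<Rightarrow> nat set \<Rightarrow>
    'a params \<Rightarrow> bool" where
  "coordinatized m G n q ko kn U p \<longleftrightarrow>
     corner_frame m G (p (0, 1, ko)) (p (1, n - 1, ko)) \<and>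
     corner_ring_axioms m G (p (0, 1, ko)) (p (1, n - 1, ko)) \<and>
     (\<forall>c. (\<forall>ij. c ij \<in> carrier G) \<longrightarrow> coord_mat m G n ko p c \<longrightarrow>
        (\<exists>g\<in>carrier G. coord_rel m G n q ko kn U p c g)) \<and>
     (\<forall>g\<in>carrier G. \<exists>c. (\<forall>ij. c ij \<in> carrier G) \<and> coord_mat m G n ko p c \<and>
        coord_rel m G n q ko kn U p c g) \<and>
     (\<forall>c. (\<forall>ij. c ij \<in> carrier G) \<longrightarrow> (\<forall>d. (\<forall>ij. d ij \<in> carrier G) \<longrightarrow>
        (\<forall>g\<in>carrier G. \<forall>h\<in>carrier G.
          coord_mat m G n ko p c \<and> coord_mat m G n ko p d \<and>
          coord_rel m G n q ko kn U p c g \<and> coord_rel m G n q ko kn U p d h \<longrightarrow>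
          (g = h \<longleftrightarrow> (\<forall>i\<in>{..<n}. \<forall>j\<in>{..<n}. c (i, j) = d (i, j))) \<and>
          (\<forall>f. (\<forall>ij. f ij \<in> carrier G) \<longrightarrow> (\<forall>gh\<in>carrier G. gh = g \<otimes>\<^bsub>G\<^esub> h \<longrightarrow>
             (\<forall>i\<in>{..<n}. \<forall>j\<in>{..<n}. f (i, j) = coord_prod m G n ko p c d (i, j)) \<longrightarrow>
             coord_rel m G n q ko kn U p f gh)))))"

text \<open>Replaces the description operator, default value included, by quantifiers over the
  carrier, which makes the graph of \<open>corner_mult\<close> first-order.\<close>

lemma corner_mult_eq_iff:
  assumes "w \<in> carrier S"
  shows "w = corner_mult m S a b x y \<longleftrightarrow>
    ((\<exists>z\<in>carrier S. corner_prod_rel m S a b x y z \<and> (\<forall>z'\<in>carrier S. corner_prod_rel m S a b x y z' \<longrightarrow> z' = z)) \<and>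
       corner_prod_rel m S a b x y w) \<or>
    (\<not> (\<exists>z\<in>carrier S. corner_prod_rel m S a b x y z \<and> (\<forall>z'\<in>carrier S. corner_prod_rel m S a b x y z' \<longrightarrow> z' = z)) \<and>
       w = \<one>\<^bsub>S\<^esub>)"
proof -
  let ?P = "\<lambda>z. z \<in> carrier S \<and> corner_prod_rel m S a b x y z"
  have ex: "(\<exists>z\<in>carrier S. corner_prod_rel m S a b x y z \<and>
      (\<forall>z'\<in>carrier S. corner_prod_rel m S a b x y z' \<longrightarrow> z' = z)) \<longleftrightarrow> (\<exists>!z. ?P z)"
    by auto
  show ?thesis unfolding ex corner_mult_def using theI'[of ?P] the1_equality[of ?P w] assms by auto
qed

lemma corner_mult_closed: "group S \<Longrightarrow> corner_mult m S a b x y \<in> carrier S"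
  using theI'[of "\<lambda>z. z \<in> carrier S \<and> corner_prod_rel m S a b x y z"]
  by (auto simp: corner_mult_def group.is_monoid monoid.one_closed)

section \<open>Uniform definability of the interpretation\<close>

context group_pair
begin

lemma definable_in_carrier: "definable (\<lambda>e. e k \<in> carrier G) (\<lambda>e. e k \<in> carrier H)"
  by (rule definable_cong[OF definable_const[of True]]) auto

lemmas definable_intros = definable_conj definable_disj definable_imp definable_not
  definable_Ex definable_All definable_in_carrier definable_Ball definable_Bex definable_eq
  definable_fun_var definable_fun_one definable_fun_mult definable_fun_inv definable_fun_pow

lemma definable_corner: "definable (\<lambda>e. e k \<in> corner m G) (\<lambda>e. e k \<in> corner m H)"
  unfolding corner_def mem_Collect_eq by (intro definable_intros)

lemma definable_corner': "definable_fun x y \<Longrightarrow> definable (\<lambda>e. x e \<in> corner m G) (\<lambda>e. y e \<in> corner m H)"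
  by (rule definable_subst1[where P = "\<lambda>z. z \<in> corner m G" and Q = "\<lambda>z. z \<in> corner m H", OF definable_corner])

lemma definable_comm_rel_var:
  "definable (\<lambda>e. comm_rel m G (e i) (e j) (e k)) (\<lambda>e. comm_rel m H (e i) (e j) (e k))"
  unfolding comm_rel_def by (intro definable_intros definable_corner)

lemma definable_comm_rel:
  "definable_fun x x' \<Longrightarrow> definable_fun y y' \<Longrightarrow> definable_fun z z' \<Longrightarrow>
    definable (\<lambda>e. comm_rel m G (x e) (y e) (z e)) (\<lambda>e. comm_rel m H (x' e) (y' e) (z' e))"
  by (rule definable_subst3[where P = "comm_rel m G" and Q = "comm_rel m H", OF definable_comm_rel_var])

lemma definable_second_corner: "definable (\<lambda>e. e k \<in> second_corner m G) (\<lambda>e. e k \<in> second_corner m H)"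
  unfolding second_corner_def mem_Collect_eq by (intro definable_intros definable_comm_rel)

lemma definable_corner_dual: "definable (\<lambda>e. e k \<in> corner_dual m G) (\<lambda>e. e k \<in> corner_dual m H)"
  unfolding corner_dual_def mem_Collect_eq
  by (intro definable_intros definable_comm_rel definable_corner definable_second_corner)

lemma definable_dual_line: "definable (\<lambda>e. e k \<in> dual_line m G (e i)) (\<lambda>e. e k \<in> dual_line m H (e i))"
  unfolding dual_line_def mem_Collect_eq
  by (intro definable_intros definable_corner_dual definable_second_corner)

lemma definable_corner_prod_rel:
  "definable (\<lambda>e. corner_prod_rel m G (e a) (e b) (e x) (e y) (e z))
             (\<lambda>e. corner_prod_rel m H (e a) (e b) (e x) (e y) (e z))"
  unfolding corner_prod_rel_def
  by (intro definable_intros definable_comm_rel definable_dual_line definable_second_corner)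

lemma definable_fun_corner_mult_var:
  "definable_fun (\<lambda>e. corner_mult m G (e a) (e b) (e x) (e y)) (\<lambda>e. corner_mult m H (e a) (e b) (e x) (e y))"
  unfolding definable_fun_def
proof (intro conjI allI impI corner_mult_closed)
  have "definable
   (\<lambda>e. ((\<exists>z\<in>carrier G. corner_prod_rel m G (e (Suc a)) (e (Suc b)) (e (Suc x)) (e (Suc y)) z \<and>
          (\<forall>z'\<in>carrier G. corner_prod_rel m G (e (Suc a)) (e (Suc b)) (e (Suc x)) (e (Suc y)) z' \<longrightarrow> z' = z)) \<and>
        corner_prod_rel m G (e (Suc a)) (e (Suc b)) (e (Suc x)) (e (Suc y)) (e 0)) \<or>
      (\<not> (\<exists>z\<in>carrier G. corner_prod_rel m G (e (Suc a)) (e (Suc b)) (e (Suc x)) (e (Suc y)) z \<and>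
          (\<forall>z'\<in>carrier G. corner_prod_rel m G (e (Suc a)) (e (Suc b)) (e (Suc x)) (e (Suc y)) z' \<longrightarrow> z' = z)) \<and>
        e 0 = \<one>\<^bsub>G\<^esub>))
   (\<lambda>e. ((\<exists>z\<in>carrier H. corner_prod_rel m H (e (Suc a)) (e (Suc b)) (e (Suc x)) (e (Suc y)) z \<and>
          (\<forall>z'\<in>carrier H. corner_prod_rel m H (e (Suc a)) (e (Suc b)) (e (Suc x)) (e (Suc y)) z' \<longrightarrow> z' = z)) \<and>
        corner_prod_rel m H (e (Suc a)) (e (Suc b)) (e (Suc x)) (e (Suc y)) (e 0)) \<or>
      (\<not> (\<exists>z\<in>carrier H. corner_prod_rel m H (e (Suc a)) (e (Suc b)) (e (Suc x)) (e (Suc y)) z \<and>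
          (\<forall>z'\<in>carrier H. corner_prod_rel m H (e (Suc a)) (e (Suc b)) (e (Suc x)) (e (Suc y)) z' \<longrightarrow> z' = z)) \<and>
        e 0 = \<one>\<^bsub>H\<^esub>))"
    by (intro definable_intros definable_corner_prod_rel)
  then show "definable
     (\<lambda>e. e 0 = corner_mult m G (e (Suc a)) (e (Suc b)) (e (Suc x)) (e (Suc y)))
     (\<lambda>e. e 0 = corner_mult m H (e (Suc a)) (e (Suc b)) (e (Suc x)) (e (Suc y)))"
    by (rule definable_cong)
      (rule corner_mult_eq_iff[symmetric]; (rule G.group_axioms H.group_axioms | simp add: range_subsetD))+
qed (rule G.group_axioms H.group_axioms)+

lemma definable_fun_corner_mult:
  assumes "definable_fun x x'" "definable_fun y y'"
  shows "definable_fun (\<lambda>e. corner_mult m G (e a) (e b) (x e) (y e)) (\<lambda>e. corner_mult m H (e a) (e b) (x' e) (y' e))"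
  using definable_fun_comp[where U = "\<lambda>k. if k = 0 then (\<lambda>e. e a) else if k = 1 then (\<lambda>e. e b) else if k = 2 then x else y"
      and W = "\<lambda>k. if k = 0 then (\<lambda>e. e a) else if k = 1 then (\<lambda>e. e b) else if k = 2 then x' else y'",
      OF _ definable_fun_corner_mult_var[of m 0 1 2 3]] assms definable_fun_var by simp

lemma definable_fun_corner_one: "definable_fun (\<lambda>e. corner_one G (e a) (e b)) (\<lambda>e. corner_one H (e a) (e b))"
  unfolding corner_one_def by (intro definable_intros)

lemma definable_corner_frame: "definable (\<lambda>e. corner_frame m G (e a) (e b)) (\<lambda>e. corner_frame m H (e a) (e b))"
  unfolding corner_frame_def
  by (intro definable_intros definable_comm_rel definable_dual_line definable_second_corner
      definable_corner_dual definable_corner)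

lemma definable_corner_ring_axioms:
  "definable (\<lambda>e. corner_ring_axioms m G (e a) (e b)) (\<lambda>e. corner_ring_axioms m H (e a) (e b))"
  unfolding corner_ring_axioms_def
  by (intro definable_intros definable_corner' definable_fun_corner_mult definable_fun_corner_one)

lemma definable_fun_corner_trm_val:
  "definable_fun (\<lambda>e. corner_trm_val m G (e 0) (e 1) (\<lambda>i. e (i + 2)) t)
                 (\<lambda>e. corner_trm_val m H (e 0) (e 1) (\<lambda>i. e (i + 2)) t)"
proof (induction t)
  case (RMult s t)
  then show ?case unfolding corner_trm_val.simps by (intro definable_fun_corner_mult)
next
  case (RAdd s t)
  then show ?case unfolding corner_trm_val.simps by (intro definable_fun_mult)
next
  case (RNeg t)
  then show ?case unfolding corner_trm_val.simps by (intro definable_fun_inv)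
qed (simp_all only: corner_trm_val.simps definable_fun_var definable_fun_one definable_fun_corner_one)

text \<open>In contrast to \<open>definable_Ex\<close>, the bound variable keeps its name; this
  suits an induction over ring formulas.\<close>

lemma definable_Ex_upd:
  assumes "definable P Q"
  shows "definable (\<lambda>e. \<exists>z\<in>carrier G. P (e(k := z))) (\<lambda>e. \<exists>z\<in>carrier H. Q (e(k := z)))"
proof -
  obtain \<phi> where \<phi>:
    "\<And>e. range e \<subseteq> carrier G \<Longrightarrow> sat (carrier G) (group_trm_val G) e \<phi> \<longleftrightarrow> P e"
    "\<And>e. range e \<subseteq> carrier H \<Longrightarrow> sat (carrier H) (group_trm_val H) e \<phi> \<longleftrightarrow> Q e"
    using assms unfolding definable_def by blast
  have upd: "range (e(k := z)) \<subseteq> C" if "range e \<subseteq> C" "z \<in> C" for e :: "nat \<Rightarrow> 'c" and z C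
    using that by auto
  then show ?thesis unfolding definable_def
    by (intro exI[of _ "Ex k \<phi>"] conjI allI impI; unfold sat.simps; intro bex_cong refl \<phi> upd)
qed

text \<open>The usual translation of formulas along an interpretation, with quantifiers relativized
  to the corner. Variables 0 and 1 hold the frame, hence the shift by 2.\<close>

lemma definable_corner_sat:
  "definable (\<lambda>e. sat (corner m G) (corner_trm_val m G (e 0) (e 1)) (\<lambda>i. e (i + 2)) \<phi>)
             (\<lambda>e. sat (corner m H) (corner_trm_val m H (e 0) (e 1)) (\<lambda>i. e (i + 2)) \<phi>)"
proof (induction \<phi>)
  case (Eq s t)
  show ?case unfolding sat.simps by (intro definable_eq definable_fun_corner_trm_val)
next
  case (Ex x \<phi>)
  have eq: "(\<exists>z\<in>carrier S. (e(x + 2 := z)) (x + 2) \<in> corner m S \<and>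
      sat (corner m S) (corner_trm_val m S ((e(x + 2 := z)) 0) ((e(x + 2 := z)) 1)) (\<lambda>i. (e(x + 2 := z)) (i + 2)) \<phi>) \<longleftrightarrow>
    sat (corner m S) (corner_trm_val m S (e 0) (e 1)) (\<lambda>i. e (i + 2)) (Ex x \<phi>)"
    for S :: "('s, 't) monoid_scheme" and e
  proof -
    have "(\<lambda>i. (e(x + 2 := z)) (i + 2)) = (\<lambda>i. e (i + 2))(x := z)" for z by auto
    then show ?thesis by (auto intro: corner_carrier)
  qed
  show ?case
    by (rule definable_cong[OF definable_Ex_upd[OF definable_conj[OF definable_corner Ex], of "x + 2"]]) (rule eq)+
qed (simp_all add: definable_not definable_conj)

lemma definable_root_elem:
  "definable (\<lambda>e. root_elem G n q kn (\<lambda>x. e (f x)) i j (e k)) (\<lambda>e. root_elem H n q kn (\<lambda>x. e (f x)) i j (e k))"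
  unfolding root_elem_def by (intro definable_intros finite_Diff finite_lessThan)

lemma definable_root_coord:
  "definable (\<lambda>e. root_coord G n ko (\<lambda>x. e (f x)) i j (e k) (e l)) (\<lambda>e. root_coord H n ko (\<lambda>x. e (f x)) i j (e k) (e l))"
  unfolding root_coord_def if_bool_eq_conj by (intro definable_intros definable_const)

lemma definable_fun_tri_word:
  "definable_fun (\<lambda>e. tri_word G n (\<lambda>i. e (f i)) (\<lambda>x. e (g x))) (\<lambda>e. tri_word H n (\<lambda>i. e (f i)) (\<lambda>x. e (g x)))"
  unfolding tri_word_def by (intro definable_fun_foldr definable_intros)

lemma definable_coord_rel:
  assumes "finite U"
  shows "definable (\<lambda>e. coord_rel m G n q ko kn U (\<lambda>x. e (f x)) (\<lambda>x. e (g x)) (e k))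
             (\<lambda>e. coord_rel m H n q ko kn U (\<lambda>x. e (f x)) (\<lambda>x. e (g x)) (e k))"
  unfolding coord_rel_def
  by (intro definable_Ex_fun definable_intros definable_root_elem definable_root_coord definable_corner
      definable_fun_corner_mult definable_fun_tri_word finite_PiE assms finite_lessThan finite_greaterThanLessThan)

lemma definable_coord_mat:
  "definable (\<lambda>e. coord_mat m G n ko (\<lambda>x. e (f x)) (\<lambda>x. e (g x))) (\<lambda>e. coord_mat m H n ko (\<lambda>x. e (f x)) (\<lambda>x. e (g x)))"
  unfolding coord_mat_def
  by (intro definable_intros definable_corner definable_fun_corner_mult definable_fun_corner_one finite_lessThan)

lemma definable_fun_coord_prod:
  "definable_fun (\<lambda>e. coord_prod m G n ko (\<lambda>x. e (f x)) (\<lambda>x. e (g x)) (\<lambda>x. e (h x)) (i, j))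
     (\<lambda>e. coord_prod m H n ko (\<lambda>x. e (f x)) (\<lambda>x. e (g x)) (\<lambda>x. e (h x)) (i, j))"
  unfolding coord_prod_def prod.case
  by (intro definable_fun_foldr definable_intros definable_fun_corner_mult)

lemma definable_coordinatized:
  assumes "finite U"
  shows "definable (\<lambda>e. coordinatized m G n q ko kn U (\<lambda>x. e (f x))) (\<lambda>e. coordinatized m H n q ko kn U (\<lambda>x. e (f x)))"
  unfolding coordinatized_def
  by (intro definable_corner_frame definable_corner_ring_axioms definable_coord_mat definable_Ex_fun definable_All_fun
      definable_coord_rel[OF assms] definable_fun_coord_prod definable_iff definable_intros finite_lessThan)

end


section \<open>The interpreted ring in the triangular group\<close>

text \<open>The arithmetic of \<open>pairing_eq\<close>: \<open>x9\<close> and \<open>y9\<close>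
  stand for the entries at \<open>(0, n - 1)\<close>, and their terms are the same on both
  sides.\<close>

lemma (in cring) cancel_cross_terms:
  assumes "x0 \<in> carrier R" "x1 \<in> carrier R" "x2 \<in> carrier R" "x9 \<in> carrier R"
    "y0 \<in> carrier R" "y1 \<in> carrier R" "y2 \<in> carrier R" "y9 \<in> carrier R" "c \<in> carrier R"
    and eq: "x0 \<otimes> y9 \<oplus> (x1 \<otimes> y1 \<oplus> x9 \<otimes> y0) = y0 \<otimes> x9 \<oplus> (y2 \<otimes> x2 \<oplus> y9 \<otimes> x0) \<oplus> c \<otimes> (y0 \<otimes> x0)"
  shows "x1 \<otimes> y1 = y2 \<otimes> x2 \<oplus> c \<otimes> (y0 \<otimes> x0)"
proof -
  have "(x0 \<otimes> y9 \<oplus> y0 \<otimes> x9) \<oplus> x1 \<otimes> y1 =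
      (x0 \<otimes> y9 \<oplus> y0 \<otimes> x9) \<oplus> (y2 \<otimes> x2 \<oplus> c \<otimes> (y0 \<otimes> x0))"
    using assms by (simp add: m_comm a_ac)
  then show ?thesis
    using add.l_cancel[of "x0 \<otimes> y9 \<oplus> y0 \<otimes> x9" "x1 \<otimes> y1" "y2 \<otimes> x2 \<oplus> c \<otimes> (y0 \<otimes> x0)"]
      assms(1-9) by simp
qed

text \<open>By \<open>unit_pow\<close> the m-th powers have diagonal 1; by \<open>char_m\<close> the
  m-th power of an elementary matrix with entry 1 is not trivial, and its entry can be cancelled in
  a domain.\<close>

locale torsion_matrices = matrices R n + domain R
  for R :: "('a, 'm) ring_scheme" (structure) and n :: nat +
  fixes m :: nat
  assumes n3: "3 \<le> n"
    and unit_pow: "u \<in> Units R \<Longrightarrow> u [^] m = \<one>"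
    and char_m: "add_pow R m \<one> \<noteq> \<zero>"
begin

sublocale T: group T by (rule group_T)

abbreviation "E \<equiv> elem 0 (n - 1)"

lemmas mult_elem_T = mult_elem_entry[folded mult_T]
lemmas elem_mult_T = elem_mult_entry[folded mult_T]
lemmas mult_diag_T = mult_diag_entry[folded mult_T]
lemmas diag_mult_T = diag_mult_entry[folded mult_T]
lemmas mult_T_support = mult_entry_support[folded mult_T]

lemma T_M: "A \<in> carrier T \<Longrightarrow> A \<in> carrier M"
  by (simp add: carrier_T)

lemma T_entry: "A \<in> carrier T \<Longrightarrow> i < n \<Longrightarrow> j < n \<Longrightarrow> A $$ (i, j) \<in> carrier R"
  using T_M entry_closed by blast

lemma T_upper: "A \<in> carrier T \<Longrightarrow> i < n \<Longrightarrow> j < i \<Longrightarrow> A $$ (i, j) = \<zero>"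
  by (simp add: carrier_T)

lemma T_diag: "A \<in> carrier T \<Longrightarrow> i < n \<Longrightarrow> A $$ (i, i) \<in> Units R"
  by (simp add: carrier_T)

lemma T_eqI:
  assumes "A \<in> carrier T" "B \<in> carrier T"
    "\<And>i j. i < n \<Longrightarrow> j < n \<Longrightarrow> i \<le> j \<Longrightarrow> A $$ (i, j) = B $$ (i, j)"
  shows "A = B"
proof (rule M_eqI[OF T_M[OF assms(1)] T_M[OF assms(2)]])
  fix i j assume "i < n" "j < n"
  then show "A $$ (i, j) = B $$ (i, j)" using assms T_upper by (cases "i \<le> j") auto
qed

lemma elem_T: "r \<in> carrier R \<Longrightarrow> i < j \<Longrightarrow> j < n \<Longrightarrow> elem i j r \<in> carrier T"
  unfolding carrier_T by (auto simp: elem_M elem_entry)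

lemma diag_T: "u \<in> Units R \<Longrightarrow> diag i u \<in> carrier T"
  unfolding carrier_T by (intro conjI allI impI) (simp_all add: diag_M diag_entry Units_closed)

lemma E_T: "r \<in> carrier R \<Longrightarrow> E r \<in> carrier T"
  using n3 by (intro elem_T) auto

lemma elem_inj:
  assumes "elem i j r = elem i j s" "i < j" "j < n"
  shows "r = s"
  using arg_cong[OF assms(1), of "\<lambda>A. A $$ (i, j)"] assms(2,3) by (simp add: elem_entry)

lemma E_inj: "E r = E s \<Longrightarrow> r = s"
  by (erule elem_inj) (use n3 in auto)

lemma elem_zero_T: "elem i j \<zero> = \<one>\<^bsub>T\<^esub>"
  by (simp add: elem_zero one_T)

lemma elem_mult_elem_T:
  "r \<in> carrier R \<Longrightarrow> s \<in> carrier R \<Longrightarrow> i < j \<Longrightarrow> j < n \<Longrightarrow>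
    elem i j r \<otimes>\<^bsub>T\<^esub> elem i j s = elem i j (r \<oplus> s)"
  unfolding mult_T by (intro elem_mult_elem) auto

lemma T_mult_diag:
  assumes "A \<in> carrier T" "B \<in> carrier T" "i < n"
  shows "(A \<otimes>\<^bsub>T\<^esub> B) $$ (i, i) = A $$ (i, i) \<otimes> B $$ (i, i)"
proof -
  have "(A \<otimes>\<^bsub>T\<^esub> B) $$ (i, i) = (\<Oplus>k\<in>{i}. A $$ (i, k) \<otimes> B $$ (k, i))"
    by (rule mult_T_support[OF T_M T_M])
      (use assms T_upper in \<open>auto, metis linorder_neqE_nat\<close>)
  then show ?thesis using assms T_entry by simp
qed

lemma T_pow_diag: "A \<in> carrier T \<Longrightarrow> i < n \<Longrightarrow> (A [^]\<^bsub>T\<^esub> (k::nat)) $$ (i, i) = A $$ (i, i) [^] k"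
  by (induction k) (auto simp: T_mult_diag one_T one_entry)

lemma T_pow_m_diag: "A \<in> carrier T \<Longrightarrow> i < n \<Longrightarrow> (A [^]\<^bsub>T\<^esub> m) $$ (i, i) = \<one>"
  by (simp add: T_pow_diag unit_pow T_diag)

lemma elem_pow:
  "r \<in> carrier R \<Longrightarrow> i < j \<Longrightarrow> j < n \<Longrightarrow> elem i j r [^]\<^bsub>T\<^esub> (k::nat) = elem i j (add_pow R k r)"
  by (induction k) (auto simp: elem_zero one_T elem_mult_elem_T)

abbreviation "\<mu> \<equiv> add_pow R m \<one>"

section \<open>The definable sets, computed in the triangular group\<close>

lemma E_commutes:
  assumes u: "u \<in> carrier T" "u $$ (0, 0) = u $$ (n - 1, n - 1)" and r: "r \<in> carrier R"
  shows "E r \<otimes>\<^bsub>T\<^esub> u = u \<otimes>\<^bsub>T\<^esub> E r"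
proof (rule T_eqI)
  fix i j assume ij: "i < n" "j < n"
  have idx: "0 \<noteq> n - 1" "0 < n" "n - 1 < n" using n3 by auto
  have z: "u $$ (n - 1, j) = (if j = n - 1 then u $$ (0, 0) else \<zero>)"
    "u $$ (i, 0) = (if i = 0 then u $$ (0, 0) else \<zero>)"
    using T_upper[OF u(1), of "n - 1" j] T_upper[OF u(1), of i 0] u(2) ij idx by auto
  show "(E r \<otimes>\<^bsub>T\<^esub> u) $$ (i, j) = (u \<otimes>\<^bsub>T\<^esub> E r) $$ (i, j)"
    unfolding elem_mult_T[OF T_M[OF u(1)] r idx ij] mult_elem_T[OF T_M[OF u(1)] r idx ij] z
    using r T_entry[OF u(1)] ij idx by (auto simp: m_comm)
qed (use u r E_T in auto)

text \<open>The Steinberg relation, with the commutator equation written free of inverses.\<close>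

lemma elem_commutator:
  assumes "r \<in> carrier R" "s \<in> carrier R" "i < j" "j < k" "k < n"
  shows "elem i j r \<otimes>\<^bsub>T\<^esub> elem j k s = elem i k (r \<otimes> s) \<otimes>\<^bsub>T\<^esub> (elem j k s \<otimes>\<^bsub>T\<^esub> elem i j r)"
proof (rule T_eqI)
  fix a b assume ab: "a < n" "b < n"
  have "elem j k s \<otimes>\<^bsub>T\<^esub> elem i j r \<in> carrier T" using assms by (simp add: elem_T)
  then show "(elem i j r \<otimes>\<^bsub>T\<^esub> elem j k s) $$ (a, b) =
      (elem i k (r \<otimes> s) \<otimes>\<^bsub>T\<^esub> (elem j k s \<otimes>\<^bsub>T\<^esub> elem i j r)) $$ (a, b)"
    using assms ab by (auto simp: elem_mult_T T_M elem_T elem_M elem_entry a_ac)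
qed (use assms in \<open>auto simp: elem_T\<close>)

text \<open>The source of the entry equations below: right multiplication by the elementary matrix
  acts on column \<open>j\<close>, left multiplication on row \<open>i\<close>, and the common
  factor \<open>\<mu>\<close> cancels. The unknown \<open>c\<close> touches only the entry
  \<open>(0, n - 1)\<close>, which is left out unless \<open>c\<close> is 0.\<close>

lemma commute_up_to_corner:
  assumes g: "g \<in> carrier T" and c: "c \<in> carrier R" and ij: "i < j" "j < n"
    and eq: "g \<otimes>\<^bsub>T\<^esub> elem i j \<mu> = E c \<otimes>\<^bsub>T\<^esub> (elem i j \<mu> \<otimes>\<^bsub>T\<^esub> g)"
    and kl: "k < n" "l < n" "c = \<zero> \<or> (k, l) \<noteq> (0, n - 1)"
  shows "(if l = j then g $$ (k, i) else \<zero>) = (if k = i then g $$ (j, l) else \<zero>)"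
proof -
  have idx: "0 \<noteq> n - 1" "0 < n" "n - 1 < n" "i \<noteq> j" "i < n" "i \<noteq> n - 1" using n3 ij by auto
  have mu: "\<mu> \<in> carrier R" by simp
  let ?w = "elem i j \<mu> \<otimes>\<^bsub>T\<^esub> g"
  have w: "?w \<in> carrier T" using g ij elem_T[OF mu] by simp
  \<comment> \<open>\<open>E c\<close> adds \<open>c\<close> times the last row of \<open>?w\<close>
    to row 0, and this row vanishes before its last entry.\<close>
  have zero: "(if k = 0 then c \<otimes> ?w $$ (n - 1, l) else \<zero>) = \<zero>"
  proof (cases "c = \<zero>")
    case False
    then have "k = 0 \<Longrightarrow> l < n - 1" using kl by auto
    then show ?thesis using T_upper[OF w, of "n - 1" l] c idx by auto
  qed (use T_entry[OF w] idx kl in auto)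
  have "g $$ (k, l) \<oplus> (if l = j then g $$ (k, i) \<otimes> \<mu> else \<zero>) =
      g $$ (k, l) \<oplus> (if k = i then \<mu> \<otimes> g $$ (j, l) else \<zero>)"
    using arg_cong[OF eq, of "\<lambda>A. A $$ (k, l)"] zero T_entry[OF g] kl ij idx
    unfolding mult_elem_T[OF T_M[OF g] mu idx(4,5) ij(2) kl(1,2)]
      elem_mult_T[OF T_M[OF w] c idx(1,2,3) kl(1,2)] elem_mult_T[OF T_M[OF g] mu idx(4,5) ij(2) kl(1,2)]
    by (simp split: if_splits)
  moreover have cl: "g $$ (k, l) \<in> carrier R" "g $$ (k, i) \<in> carrier R" "g $$ (j, l) \<in> carrier R"
    using T_entry[OF g] kl ij idx by auto
  ultimately have "(if l = j then g $$ (k, i) \<otimes> \<mu> else \<zero>) = (if k = i then \<mu> \<otimes> g $$ (j, l) else \<zero>)"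
    using add.l_cancel[of "g $$ (k, l)" "if l = j then g $$ (k, i) \<otimes> \<mu> else \<zero>"
        "if k = i then \<mu> \<otimes> g $$ (j, l) else \<zero>"] mu by simp
  moreover have "(if l = j then g $$ (k, i) \<otimes> \<mu> else \<zero>) = \<mu> \<otimes> (if l = j then g $$ (k, i) else \<zero>)"
    using cl mu by (simp add: m_comm)
  moreover have "(if k = i then \<mu> \<otimes> g $$ (j, l) else \<zero>) = \<mu> \<otimes> (if k = i then g $$ (j, l) else \<zero>)"
    using cl mu by simp
  ultimately have "\<mu> \<otimes> (if l = j then g $$ (k, i) else \<zero>) = \<mu> \<otimes> (if k = i then g $$ (j, l) else \<zero>)"
    by simp
  then show ?thesis
    by (subst (asm) m_lcancel[OF char_m mu]) (use cl in simp_all)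
qed

text \<open>Commuting with the m-th powers of elementary matrices clears every off-diagonal entry
  except \<open>(0, n - 1)\<close>, and the second clause of \<open>corner\<close> forces the
  diagonal to be 1. Conversely, \<open>E r\<close> is the commutator of \<open>elem 0 1 r\<close>
  and \<open>elem 1 (n - 1) \<one>\<close>, which is where \<open>3 \<le> n\<close> enters.\<close>

lemma corner_T: "corner m T = E ` carrier R"
proof (intro equalityI subsetI)
  fix x assume "x \<in> E ` carrier R"
  then obtain r where r: "r \<in> carrier R" "x = E r" by blast
  have "x \<otimes>\<^bsub>T\<^esub> (h [^]\<^bsub>T\<^esub> m) = (h [^]\<^bsub>T\<^esub> m) \<otimes>\<^bsub>T\<^esub> x" if h: "h \<in> carrier T" for h
    unfolding r(2) by (rule E_commutes) (use h r T_pow_m_diag n3 in auto)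
  moreover have "elem 0 1 r \<otimes>\<^bsub>T\<^esub> elem 1 (n - 1) \<one> = x \<otimes>\<^bsub>T\<^esub> (elem 1 (n - 1) \<one> \<otimes>\<^bsub>T\<^esub> elem 0 1 r)"
    using elem_commutator[of r \<one> 0 1 "n - 1"] r n3 by simp
  ultimately show "x \<in> corner m T"
    unfolding corner_def using r E_T n3
    by (intro CollectI conjI ballI bexI[of _ "elem 0 1 r"] bexI[of _ "elem 1 (n - 1) \<one>"]) (auto intro!: elem_T)
next
  fix x assume "x \<in> corner m T"
  then have x: "x \<in> carrier T"
    and comm: "\<And>h. h \<in> carrier T \<Longrightarrow> x \<otimes>\<^bsub>T\<^esub> (h [^]\<^bsub>T\<^esub> m) = (h [^]\<^bsub>T\<^esub> m) \<otimes>\<^bsub>T\<^esub> x"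
    unfolding corner_def by auto
  from \<open>x \<in> corner m T\<close> obtain g h where gh: "g \<in> carrier T" "h \<in> carrier T"
    "g \<otimes>\<^bsub>T\<^esub> h = x \<otimes>\<^bsub>T\<^esub> (h \<otimes>\<^bsub>T\<^esub> g)" unfolding corner_def by auto
  have key: "(if l = j then x $$ (k, i) else \<zero>) = (if k = i then x $$ (j, l) else \<zero>)"
    if "i < j" "j < n" "k < n" "l < n" for i j k l
  proof (rule commute_up_to_corner[OF x zero_closed that(1,2)])
    have "elem i j \<one> [^]\<^bsub>T\<^esub> m = elem i j \<mu>" using that by (simp add: elem_pow)
    then show "x \<otimes>\<^bsub>T\<^esub> elem i j \<mu> = E \<zero> \<otimes>\<^bsub>T\<^esub> (elem i j \<mu> \<otimes>\<^bsub>T\<^esub> x)"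
      using comm[of "elem i j \<one>"] elem_T[of \<one> i j] elem_T[of \<mu> i j] that x by (simp add: elem_zero_T)
  qed (use that in auto)
  \<comment> \<open>Diagonal entries are multiplicative and \<open>R\<close> is commutative, so a
    commutator has diagonal 1; this excludes nontrivial scalars.\<close>
  have diag1: "x $$ (i, i) = \<one>" if i: "i < n" for i
  proof -
    have u: "g $$ (i, i) \<in> Units R" "h $$ (i, i) \<in> Units R" using gh i T_diag by auto
    have "g $$ (i, i) \<otimes> h $$ (i, i) = x $$ (i, i) \<otimes> (h $$ (i, i) \<otimes> g $$ (i, i))"
      using gh x i by (metis T_mult_diag T.m_closed)
    then have "\<one> \<otimes> (g $$ (i, i) \<otimes> h $$ (i, i)) = x $$ (i, i) \<otimes> (g $$ (i, i) \<otimes> h $$ (i, i))"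
      using u Units_closed by (simp add: m_comm)
    moreover have "g $$ (i, i) \<otimes> h $$ (i, i) \<in> Units R" using u by simp
    ultimately show ?thesis
      using T_entry[OF x i i] Units_closed by (metis m_rcancel one_closed zero_is_prime(1) Units_r_inv_ex l_null zero_not_one)
  qed
  have "x = E (x $$ (0, n - 1))"
  proof (rule T_eqI[OF x E_T])
    fix k l assume kl: "k < n" "l < n" "k \<le> l"
    have "x $$ (k, l) = \<zero>" if ne: "k \<noteq> l" "(k, l) \<noteq> (0, n - 1)"
    proof (cases "k = 0")
      case True
      then have l: "0 < l" "l < n - 1" using ne kl by auto
      then show ?thesis using key[of l "n - 1" 0 "n - 1"] True by simp
    next
      case False
      then show ?thesis using key[of 0 k 0 l] kl ne by simp
    qed
    then show "x $$ (k, l) = E (x $$ (0, n - 1)) $$ (k, l)"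
      using kl diag1 by (auto simp: elem_entry)
  qed (use x T_entry n3 in auto)
  then show "x \<in> E ` carrier R" using x T_entry n3 by force
qed

text \<open>Each equation tests \<open>y\<close> on the m-th power of one elementary matrix with
  entry 1, whose commutator with \<open>y\<close> must be some \<open>E c\<close>. Since
  \<open>c\<close> is unknown, the entry \<open>(0, n - 1)\<close> is never compared.\<close>

lemma second_corner_entries:
  assumes "y \<in> second_corner m T"
  shows "y \<in> carrier T" "\<And>i. 0 < i \<Longrightarrow> i < n - 2 \<Longrightarrow> y $$ (0, i) = \<zero>"
    "\<And>j. 1 < j \<Longrightarrow> j < n - 1 \<Longrightarrow> y $$ (j, n - 1) = \<zero>" "\<And>l. 1 < l \<Longrightarrow> l < n - 1 \<Longrightarrow> y $$ (1, l) = \<zero>"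
    "y $$ (0, 0) = y $$ (n - 1, n - 1)" "y $$ (1, 1) = y $$ (n - 1, n - 1)"
proof -
  show y: "y \<in> carrier T" using assms by (simp add: second_corner_def)
  have key: "(if l = j then y $$ (k, i) else \<zero>) = (if k = i then y $$ (j, l) else \<zero>)"
    if ij: "i < j" "j < n" "k < n" "l < n" "(k, l) \<noteq> (0, n - 1)" for i j k l
  proof -
    have e: "elem i j \<one> \<in> carrier T" using ij by (intro elem_T) auto
    then obtain z where z: "comm_rel m T y (elem i j \<one> [^]\<^bsub>T\<^esub> m) z"
      using assms unfolding second_corner_def by blast
    then obtain c where c: "c \<in> carrier R" "z = E c"
      unfolding comm_rel_def corner_T by blast
    have "y \<otimes>\<^bsub>T\<^esub> elem i j \<mu> = E c \<otimes>\<^bsub>T\<^esub> (elem i j \<mu> \<otimes>\<^bsub>T\<^esub> y)"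
      using z c ij unfolding comm_rel_def by (simp add: elem_pow)
    from commute_up_to_corner[OF y c(1) ij(1,2) this] show ?thesis using ij by auto
  qed
  show "y $$ (0, i) = \<zero>" if "0 < i" "i < n - 2" for i using key[of i "n - 2" 0 "n - 2"] that by simp
  show "y $$ (j, n - 1) = \<zero>" if "1 < j" "j < n - 1" for j using key[of 1 j 1 "n - 1"] that by simp
  show "y $$ (1, l) = \<zero>" if "1 < l" "l < n - 1" for l using key[of l "n - 1" 1 "n - 1"] that by simp
  show "y $$ (1, 1) = y $$ (n - 1, n - 1)" using key[of 1 "n - 1" 1 "n - 1"] n3 by simp
  moreover have "y $$ (0, 0) = y $$ (1, 1)" using key[of 0 1 0 1] n3 by simp
  ultimately show "y $$ (0, 0) = y $$ (n - 1, n - 1)" by simp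
qed

text \<open>For \<open>n = 3\<close> the two factors do not commute; in this order the entry
  \<open>(0, n - 1)\<close> stays 0.\<close>

definition second_elem :: "'a \<Rightarrow> 'a \<Rightarrow> 'a mat" where
  "second_elem p q = elem 1 (n - 1) q \<otimes>\<^bsub>T\<^esub> elem 0 (n - 2) p"

lemma second_elem_entry:
  assumes "p \<in> carrier R" "q \<in> carrier R" "k < n" "l < n"
  shows "second_elem p q $$ (k, l) = (if k = l then \<one> else if k = 0 \<and> l = n - 2 then p
    else if k = 1 \<and> l = n - 1 then q else \<zero>)"
  unfolding second_elem_def using assms n3
  by (auto simp: elem_mult_T elem_M elem_entry)

lemma second_elem_T: "p \<in> carrier R \<Longrightarrow> q \<in> carrier R \<Longrightarrow> second_elem p q \<in> carrier T"
  unfolding second_elem_def using n3 by (simp add: elem_T)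

text \<open>These matrices realize every pair of values of the coordinates \<open>sec1\<close> and
  \<open>sec2\<close> defined below, which allows test elements to be prescribed.\<close>

lemma second_elem_in:
  assumes p: "p \<in> carrier R" and q: "q \<in> carrier R"
  shows "second_elem p q \<in> second_corner m T"
proof -
  let ?y = "second_elem p q"
  have y: "?y \<in> carrier T" using second_elem_T[OF assms] .
  have "\<exists>z\<in>carrier T. comm_rel m T ?y (h [^]\<^bsub>T\<^esub> m) z" if h: "h \<in> carrier T" for h
  proof -
    define u where "u = h [^]\<^bsub>T\<^esub> m"
    have u: "u \<in> carrier T" and u1: "\<And>i. i < n \<Longrightarrow> u $$ (i, i) = \<one>"
      using h T_pow_m_diag unfolding u_def by auto
    note ue = T_entry[OF u] and u0 = T_upper[OF u]
    \<comment> \<open>At \<open>(0, n - 1)\<close> the product \<open>?y u\<close> gains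
      \<open>p\<close> times \<open>u $$ (n - 2, n - 1)\<close> over \<open>u\<close>, and
      \<open>u ?y\<close> gains \<open>q\<close> times \<open>u $$ (0, 1)\<close>. All other entries
      of the two products agree, because \<open>u\<close> has diagonal 1.\<close>
    define c where "c = p \<otimes> u $$ (n - 2, n - 1) \<ominus> q \<otimes> u $$ (0, 1)"
    have c: "c \<in> carrier R" unfolding c_def using p q ue n3 by auto
    have i1: "1 \<noteq> n - 1" "1 < n" "n - 1 < n" and i2: "0 \<noteq> n - 2" "0 < n" "n - 2 < n"
      and i3: "0 \<noteq> n - 1" using n3 by auto
    have eq: "?y \<otimes>\<^bsub>T\<^esub> u = E c \<otimes>\<^bsub>T\<^esub> (u \<otimes>\<^bsub>T\<^esub> ?y)"
    proof (rule T_eqI)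
      fix k l assume kl: "k < n" "l < n" "k \<le> l"
      have e2: "elem 0 (n - 2) p \<in> carrier T" and e1: "elem 1 (n - 1) q \<in> carrier T"
        using p q n3 by (auto intro!: elem_T)
      have L: "(?y \<otimes>\<^bsub>T\<^esub> u) $$ (k, l) = u $$ (k, l) \<oplus> (if k = 0 then p \<otimes> u $$ (n - 2, l) else \<zero>) \<oplus>
          (if k = 1 then q \<otimes> u $$ (n - 1, l) else \<zero>)"
      proof -
        have "?y \<otimes>\<^bsub>T\<^esub> u = elem 1 (n - 1) q \<otimes>\<^bsub>T\<^esub> (elem 0 (n - 2) p \<otimes>\<^bsub>T\<^esub> u)"
          unfolding second_elem_def using e1 e2 u by (simp add: T.m_assoc)
        moreover have "elem 0 (n - 2) p \<otimes>\<^bsub>T\<^esub> u \<in> carrier T" using e2 u by simp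
        ultimately show ?thesis using kl i1 i2 n3 p q ue
          by (simp add: elem_mult_T[OF T_M q i1, unfolded One_nat_def] elem_mult_T[OF T_M[OF u] p i2])
      qed
      have Rt: "(u \<otimes>\<^bsub>T\<^esub> ?y) $$ (k, l) = u $$ (k, l) \<oplus> (if l = n - 1 then u $$ (k, 1) \<otimes> q else \<zero>) \<oplus>
          (if l = n - 2 then u $$ (k, 0) \<otimes> p else \<zero>)" if kl: "k < n" "l < n" for k l
      proof -
        have "u \<otimes>\<^bsub>T\<^esub> ?y = (u \<otimes>\<^bsub>T\<^esub> elem 1 (n - 1) q) \<otimes>\<^bsub>T\<^esub> elem 0 (n - 2) p"
          unfolding second_elem_def using e1 e2 u by (simp add: T.m_assoc)
        moreover have "u \<otimes>\<^bsub>T\<^esub> elem 1 (n - 1) q \<in> carrier T" using e1 u by simp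
        ultimately show ?thesis using kl i1 i2 i3 n3 p q ue
          by (simp add: mult_elem_T[OF T_M p i2] mult_elem_T[OF T_M[OF u] q i1, unfolded One_nat_def])
      qed
      have uy: "u \<otimes>\<^bsub>T\<^esub> ?y \<in> carrier T" using u y by simp
      have last: "(u \<otimes>\<^bsub>T\<^esub> ?y) $$ (n - 1, l) = (if l = n - 1 then \<one> else \<zero>)"
        using T_upper[OF uy, of "n - 1" l] T_mult_diag[OF u y, of "n - 1"] kl i1 p q
        by (auto simp: u1 second_elem_entry)
      have ul: "u $$ (n - 1, l) = (if l = n - 1 then \<one> else \<zero>)"
        using u0[of "n - 1" l] u1 kl i1 by auto
      have uk0: "u $$ (k, 0) = (if k = 0 then \<one> else \<zero>)"
        using u0[of k 0] u1 kl by auto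
      have uk1: "u $$ (k, 1) = (if k = 0 then u $$ (0, 1) else if k = 1 then \<one> else \<zero>)"
        using u0[of k 1] u1 kl by auto
      have un2: "u $$ (n - 2, l) = (if l = n - 1 then u $$ (n - 2, n - 1) else if l = n - 2 then \<one> else \<zero>)"
        using u0[of "n - 2" l] u1 kl i2 by auto
      show "(?y \<otimes>\<^bsub>T\<^esub> u) $$ (k, l) = (E c \<otimes>\<^bsub>T\<^esub> (u \<otimes>\<^bsub>T\<^esub> ?y)) $$ (k, l)"
        unfolding elem_mult_T[OF T_M[OF uy] c i3 i2(2) i1(3) kl(1,2)] L Rt[OF kl(1,2)] last ul uk0 uk1 un2
        using kl ue[OF kl(1,2)] p q c ue[of "n - 2" "n - 1"] ue[of 0 1] i1 i2 n3
        by (auto simp: c_def a_minus_def a_ac m_comm r_neg r_neg1 r_neg2)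
    qed (use y u c E_T in auto)
    then show ?thesis
      unfolding comm_rel_def corner_T u_def[symmetric] using c E_T by (intro bexI[of _ "E c"]) auto
  qed
  then show ?thesis unfolding second_corner_def using y by blast
qed

text \<open>Both definable sets contain scalar multiples; division by the first diagonal entry makes
  these coordinates insensitive to them.\<close>

definition "dual1 x = inv (x $$ (0, 0)) \<otimes> x $$ (0, 1)"
definition "dual2 x = inv (x $$ (0, 0)) \<otimes> x $$ (n - 2, n - 1)"
definition "sec1 y = inv (y $$ (0, 0)) \<otimes> y $$ (0, n - 2)"
definition "sec2 y = inv (y $$ (0, 0)) \<otimes> y $$ (1, n - 1)"
definition "pairing x y = dual1 x \<otimes> sec2 y \<ominus> dual2 x \<otimes> sec1 y"

lemma coords_closed:
  assumes "x \<in> carrier T"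
  shows "dual1 x \<in> carrier R" "dual2 x \<in> carrier R" "sec1 x \<in> carrier R" "sec2 x \<in> carrier R"
  unfolding dual1_def dual2_def sec1_def sec2_def
  using T_entry[OF assms] T_diag[OF assms, of 0] n3 by auto

lemma pairing_closed: "x \<in> carrier T \<Longrightarrow> y \<in> carrier T \<Longrightarrow> pairing x y \<in> carrier R"
  unfolding pairing_def using coords_closed by simp

lemma second_elem_coords:
  assumes "p \<in> carrier R" "q \<in> carrier R"
  shows "sec1 (second_elem p q) = p" "sec2 (second_elem p q) = q"
  unfolding sec1_def sec2_def using n3 assms by (auto simp: second_elem_entry)

lemma corner_dual_carrier: "x \<in> corner_dual m T \<Longrightarrow> x \<in> carrier T"
  by (simp add: corner_dual_def)

text \<open>Commuting with the single element \<open>E \<one>\<close> yields this, by comparison of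
  the entries at \<open>(0, n - 1)\<close>.\<close>

lemma corner_dual_diag:
  assumes "x \<in> corner_dual m T"
  shows "x $$ (0, 0) = x $$ (n - 1, n - 1)"
proof -
  have x: "x \<in> carrier T" using assms by (rule corner_dual_carrier)
  have i: "0 \<noteq> n - 1" "0 < n" "n - 1 < n" using n3 by auto
  have "x \<otimes>\<^bsub>T\<^esub> E \<one> = E \<one> \<otimes>\<^bsub>T\<^esub> x"
    using assms E_T[of \<one>] unfolding corner_dual_def corner_T by auto
  from arg_cong[OF this, of "\<lambda>A. A $$ (0, n - 1)"] show ?thesis
    using T_entry[OF x] i
    by (simp add: mult_elem_T[OF T_M[OF x] one_closed i i(2,3), unfolded One_nat_def]
        elem_mult_T[OF T_M[OF x] one_closed i i(2,3), unfolded One_nat_def] add.l_cancel)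
qed

text \<open>Only the entries at \<open>(0, n - 1)\<close> are compared. The vanishing entries of
  \<open>y\<close> leave three terms in either product, and those containing an entry at
  \<open>(0, n - 1)\<close> cancel. Division by both diagonal entries gives the pairing.\<close>

lemma pairing_eq:
  assumes x: "x \<in> carrier T" "x $$ (0, 0) = x $$ (n - 1, n - 1)" and y: "y \<in> second_corner m T"
    and c: "c \<in> carrier R" and eq: "x \<otimes>\<^bsub>T\<^esub> y = E c \<otimes>\<^bsub>T\<^esub> (y \<otimes>\<^bsub>T\<^esub> x)"
  shows "c = pairing x y"
proof -
  note yT = second_corner_entries(1)[OF y]
  define \<xi> \<eta> where "\<xi> = x $$ (0, 0)" and "\<eta> = y $$ (0, 0)"
  have units: "\<xi> \<in> Units R" "\<eta> \<in> Units R" unfolding \<xi>_def \<eta>_def using T_diag x(1) yT n3 by auto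
  have ue: "\<xi> \<in> carrier R" "\<eta> \<in> carrier R" using units by auto
  have i: "0 \<noteq> n - 1" "0 < n" "n - 1 < n" "1 < n" "n - 2 < n" using n3 by auto
  note xe = T_entry[OF x(1)] and ye = T_entry[OF yT]
  have yx: "y \<otimes>\<^bsub>T\<^esub> x \<in> carrier T" using x yT by simp
  have "(x \<otimes>\<^bsub>T\<^esub> y) $$ (0, n - 1) = (\<Oplus>k\<in>{0, 1, n - 1}. x $$ (0, k) \<otimes> y $$ (k, n - 1))"
    by (rule mult_T_support[OF T_M T_M]) (use x yT i second_corner_entries(3)[OF y] in force)+
  also have "\<dots> = \<xi> \<otimes> y $$ (0, n - 1) \<oplus> (x $$ (0, 1) \<otimes> y $$ (1, n - 1) \<oplus> x $$ (0, n - 1) \<otimes> \<eta>)"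
    using i n3 xe ye second_corner_entries(5)[OF y] by (simp add: finsum_insert \<xi>_def \<eta>_def)
  finally have L: "(x \<otimes>\<^bsub>T\<^esub> y) $$ (0, n - 1) =
      \<xi> \<otimes> y $$ (0, n - 1) \<oplus> (x $$ (0, 1) \<otimes> y $$ (1, n - 1) \<oplus> x $$ (0, n - 1) \<otimes> \<eta>)" .
  have "(y \<otimes>\<^bsub>T\<^esub> x) $$ (0, n - 1) = (\<Oplus>k\<in>{0, n - 2, n - 1}. y $$ (0, k) \<otimes> x $$ (k, n - 1))"
    by (rule mult_T_support[OF T_M T_M]) (use x yT i second_corner_entries(2)[OF y] in force)+
  also have "\<dots> = \<eta> \<otimes> x $$ (0, n - 1) \<oplus> (y $$ (0, n - 2) \<otimes> x $$ (n - 2, n - 1) \<oplus> y $$ (0, n - 1) \<otimes> \<xi>)"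
    using i n3 xe ye x(2) by (simp add: finsum_insert \<xi>_def \<eta>_def)
  finally have Rt: "(y \<otimes>\<^bsub>T\<^esub> x) $$ (0, n - 1) =
      \<eta> \<otimes> x $$ (0, n - 1) \<oplus> (y $$ (0, n - 2) \<otimes> x $$ (n - 2, n - 1) \<oplus> y $$ (0, n - 1) \<otimes> \<xi>)" .
  have last: "(y \<otimes>\<^bsub>T\<^esub> x) $$ (n - 1, n - 1) = \<eta> \<otimes> \<xi>"
    using T_mult_diag[OF yT x(1) i(3)] x(2) second_corner_entries(5)[OF y] unfolding \<xi>_def \<eta>_def by simp
  have "(E c \<otimes>\<^bsub>T\<^esub> (y \<otimes>\<^bsub>T\<^esub> x)) $$ (0, n - 1) = (y \<otimes>\<^bsub>T\<^esub> x) $$ (0, n - 1) \<oplus> c \<otimes> (\<eta> \<otimes> \<xi>)"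
    using last by (simp add: elem_mult_T[OF T_M[OF yx] c i(1-3) i(2,3), unfolded One_nat_def])
  then have "\<xi> \<otimes> y $$ (0, n - 1) \<oplus> (x $$ (0, 1) \<otimes> y $$ (1, n - 1) \<oplus> x $$ (0, n - 1) \<otimes> \<eta>) =
      \<eta> \<otimes> x $$ (0, n - 1) \<oplus> (y $$ (0, n - 2) \<otimes> x $$ (n - 2, n - 1) \<oplus> y $$ (0, n - 1) \<otimes> \<xi>) \<oplus> c \<otimes> (\<eta> \<otimes> \<xi>)"
    using eq L Rt by simp
  then have main: "x $$ (0, 1) \<otimes> y $$ (1, n - 1) = y $$ (0, n - 2) \<otimes> x $$ (n - 2, n - 1) \<oplus> c \<otimes> (\<eta> \<otimes> \<xi>)"
    by (rule cancel_cross_terms[rotated -1]) (intro ue xe ye c i)+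
  have inve: "inv \<xi> \<in> carrier R" "inv \<eta> \<in> carrier R" using units by auto
  have "pairing x y = inv \<xi> \<otimes> inv \<eta> \<otimes> (x $$ (0, 1) \<otimes> y $$ (1, n - 1)) \<ominus>
      inv \<xi> \<otimes> inv \<eta> \<otimes> (y $$ (0, n - 2) \<otimes> x $$ (n - 2, n - 1))"
    unfolding pairing_def dual1_def dual2_def sec1_def sec2_def \<xi>_def[symmetric] \<eta>_def[symmetric]
    using i inve xe ye by (simp add: m_ac)
  also have "\<dots> = inv \<xi> \<otimes> inv \<eta> \<otimes> (c \<otimes> (\<eta> \<otimes> \<xi>))"
    unfolding main using i inve ue xe ye c by (simp add: r_distr a_minus_def a_ac r_neg r_neg1 r_neg2)
  also have "\<dots> = c \<otimes> (inv \<xi> \<otimes> \<xi>) \<otimes> (inv \<eta> \<otimes> \<eta>)" using inve ue c by (simp add: m_ac)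
  finally show ?thesis using units c by simp
qed

text \<open>Membership in \<open>corner_dual\<close> supplies some commutator in the corner, and
  \<open>pairing_eq\<close> leaves only one value for it. From here on commutators are values of a
  bilinear form.\<close>

lemma corner_dual_pairing:
  assumes x: "x \<in> corner_dual m T" and y: "y \<in> second_corner m T"
  shows "comm_rel m T x y z \<longleftrightarrow> z = E (pairing x y)" "x \<otimes>\<^bsub>T\<^esub> y = y \<otimes>\<^bsub>T\<^esub> x \<longleftrightarrow> pairing x y = \<zero>"
proof -
  note xT = corner_dual_carrier[OF x] and xd = corner_dual_diag[OF x] and yT = second_corner_entries(1)[OF y]
  obtain z0 where "comm_rel m T x y z0" using x y yT unfolding corner_dual_def by blast
  then obtain c where c: "c \<in> carrier R" "x \<otimes>\<^bsub>T\<^esub> y = E c \<otimes>\<^bsub>T\<^esub> (y \<otimes>\<^bsub>T\<^esub> x)"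
    unfolding comm_rel_def corner_T by blast
  have cp: "c = pairing x y" by (rule pairing_eq[OF xT xd y c])
  show "comm_rel m T x y z \<longleftrightarrow> z = E (pairing x y)"
    unfolding comm_rel_def corner_T using pairing_eq[OF xT xd y] c cp by auto
  show "x \<otimes>\<^bsub>T\<^esub> y = y \<otimes>\<^bsub>T\<^esub> x \<longleftrightarrow> pairing x y = \<zero>"
  proof
    assume "x \<otimes>\<^bsub>T\<^esub> y = y \<otimes>\<^bsub>T\<^esub> x"
    then have "x \<otimes>\<^bsub>T\<^esub> y = E \<zero> \<otimes>\<^bsub>T\<^esub> (y \<otimes>\<^bsub>T\<^esub> x)" using xT yT by (simp add: elem_zero_T)
    then show "pairing x y = \<zero>" using pairing_eq[OF xT xd y zero_closed] by simp
  qed (use c cp xT yT in \<open>simp add: elem_zero_T\<close>)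
qed

end


section \<open>The ring attached to an arbitrary frame\<close>

context torsion_matrices
begin

lemma corner_dual_pairing_closed:
  "x \<in> corner_dual m T \<Longrightarrow> y \<in> second_corner m T \<Longrightarrow> pairing x y \<in> carrier R"
  by (intro pairing_closed corner_dual_carrier second_corner_entries(1))

text \<open>The pairing is a 2 by 2 determinant in the coordinates, so the element \<open>v\<close>
  with the coordinates of \<open>a\<close> is orthogonal to \<open>a\<close>, and hence to
  \<open>x\<close>. The coordinate vectors of \<open>x\<close> and \<open>a\<close> thus have
  determinant 0. Since the coordinates of \<open>a\<close> generate the unit ideal, by way of
  \<open>y0\<close>, the vector of \<open>x\<close> is a multiple of that of \<open>a\<close>, with
  factor \<open>pairing x y0\<close>.\<close>

lemma dual_line_proportional:
  assumes a: "a \<in> corner_dual m T" and x: "x \<in> dual_line m T a"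
    and y0: "y0 \<in> second_corner m T" "pairing a y0 = \<one>" and y: "y \<in> second_corner m T"
  shows "pairing x y = pairing x y0 \<otimes> pairing a y"
proof -
  have xd: "x \<in> corner_dual m T" using x by (simp add: dual_line_def)
  note ac = coords_closed[OF corner_dual_carrier[OF a]]
  note xc = coords_closed[OF corner_dual_carrier[OF xd]]
  note yc = coords_closed[OF second_corner_entries(1)[OF y]]
  note y0c = coords_closed[OF second_corner_entries(1)[OF y0(1)]]
  define v where "v = second_elem (dual1 a) (dual2 a)"
  have v: "v \<in> second_corner m T" unfolding v_def by (rule second_elem_in[OF ac(1,2)])
  have coords: "sec1 v = dual1 a" "sec2 v = dual2 a"
    unfolding v_def by (rule second_elem_coords[OF ac(1,2)])+
  have "pairing a v = \<zero>"
    unfolding pairing_def coords using ac by (simp add: m_comm a_minus_def r_neg)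
  then have "a \<otimes>\<^bsub>T\<^esub> v = v \<otimes>\<^bsub>T\<^esub> a" using corner_dual_pairing(2)[OF a v] by simp
  then have "x \<otimes>\<^bsub>T\<^esub> v = v \<otimes>\<^bsub>T\<^esub> x"
    using x v second_corner_entries(1)[OF v] unfolding dual_line_def by blast
  then have "pairing x v = \<zero>" using corner_dual_pairing(2)[OF xd v] by simp
  then have cross: "dual1 x \<otimes> dual2 a = dual2 x \<otimes> dual1 a"
    unfolding pairing_def coords using ac xc by (simp add: r_right_minus_eq)
  have one: "dual1 a \<otimes> sec2 y0 \<ominus> dual2 a \<otimes> sec1 y0 = \<one>"
    using y0(2) unfolding pairing_def .
  define \<kappa> where "\<kappa> = pairing x y0"
  have \<kappa>: "\<kappa> \<in> carrier R" unfolding \<kappa>_def by (rule corner_dual_pairing_closed[OF xd y0(1)])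
  have "dual1 x = dual1 x \<otimes> (dual1 a \<otimes> sec2 y0 \<ominus> dual2 a \<otimes> sec1 y0)"
    using xc unfolding one by simp
  also have "\<dots> = dual1 x \<otimes> dual1 a \<otimes> sec2 y0 \<ominus> (dual1 x \<otimes> dual2 a) \<otimes> sec1 y0"
    using ac xc y0c by (simp add: a_minus_def r_distr r_minus m_assoc)
  also have "\<dots> = \<kappa> \<otimes> dual1 a"
    unfolding cross \<kappa>_def pairing_def using ac xc y0c by (simp add: a_minus_def l_distr l_minus r_distr r_minus m_ac)
  finally have k1: "dual1 x = \<kappa> \<otimes> dual1 a" .
  have "dual2 x = dual2 x \<otimes> (dual1 a \<otimes> sec2 y0 \<ominus> dual2 a \<otimes> sec1 y0)"
    using xc unfolding one by simp
  also have "\<dots> = (dual2 x \<otimes> dual1 a) \<otimes> sec2 y0 \<ominus> dual2 x \<otimes> dual2 a \<otimes> sec1 y0"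
    using ac xc y0c by (simp add: a_minus_def r_distr r_minus m_assoc)
  also have "\<dots> = \<kappa> \<otimes> dual2 a"
    unfolding cross[symmetric] \<kappa>_def pairing_def using ac xc y0c by (simp add: a_minus_def l_distr l_minus r_distr r_minus m_ac)
  finally have k2: "dual2 x = \<kappa> \<otimes> dual2 a" .
  show ?thesis
    unfolding \<kappa>_def[symmetric] unfolding pairing_def k1 k2 using ac yc \<kappa>
    by (simp add: a_minus_def r_distr r_minus l_minus m_assoc)
qed

text \<open>Nothing is assumed about the frame beyond its definition. By proportionality,
  \<open>pairing x b\<close> and \<open>pairing x y\<close> are \<open>pairing x y0\<close> times
  \<open>e\<close> and times \<open>pairing a y\<close>; eliminating \<open>pairing x y0\<close>
  leaves the factor \<open>inv e\<close>.\<close>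

lemma corner_frame_mult:
  assumes frame: "corner_frame m T a b"
  obtains e where "e \<in> Units R" "corner_one T a b = E e"
    "\<And>r s. r \<in> carrier R \<Longrightarrow> s \<in> carrier R \<Longrightarrow> corner_mult m T a b (E r) (E s) = E (r \<otimes> s \<otimes> inv e)"
proof -
  have a: "a \<in> corner_dual m T" and b: "b \<in> second_corner m T" using frame by (auto simp: corner_frame_def)
  have aT: "a \<in> carrier T" and bT: "b \<in> carrier T"
    using corner_dual_carrier[OF a] second_corner_entries(1)[OF b] by auto
  define e where "e = pairing a b"
  have e: "e \<in> carrier R" unfolding e_def by (rule corner_dual_pairing_closed[OF a b])
  have onto_y: "\<exists>y\<in>second_corner m T. pairing a y = s" if s: "s \<in> carrier R" for s
  proof -
    obtain y where y: "y \<in> second_corner m T" "comm_rel m T a y (E s)"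
      using frame s E_T[OF s] unfolding corner_frame_def corner_T by blast
    then have "E s = E (pairing a y)" using corner_dual_pairing(1)[OF a y(1)] by blast
    then show ?thesis using E_inj y(1) by metis
  qed
  obtain y0 where y0: "y0 \<in> second_corner m T" "pairing a y0 = \<one>" using onto_y[OF one_closed] by blast
  have onto_x: "\<exists>x\<in>dual_line m T a. pairing x b = r" if r: "r \<in> carrier R" for r
  proof -
    obtain x where x: "x \<in> dual_line m T a" "comm_rel m T x b (E r)"
      using frame r E_T[OF r] unfolding corner_frame_def corner_T by blast
    have "x \<in> corner_dual m T" using x(1) by (simp add: dual_line_def)
    then have "E r = E (pairing x b)" using corner_dual_pairing(1)[OF _ b] x(2) by blast
    then show ?thesis using E_inj x(1) by metis
  qed
  have scale: "pairing x b = pairing x y0 \<otimes> e" "pairing x y = pairing x y0 \<otimes> pairing a y"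
    "pairing x y0 \<in> carrier R" "x \<in> corner_dual m T"
    if "x \<in> dual_line m T a" "y \<in> second_corner m T" for x y
  proof -
    show "x \<in> corner_dual m T" using that(1) by (simp add: dual_line_def)
    then show "pairing x y0 \<in> carrier R" using corner_dual_pairing_closed y0(1) by blast
  qed (use dual_line_proportional[OF a that(1) y0] b that(2) in \<open>auto simp: e_def\<close>)
  \<comment> \<open>The second surjectivity property provides the value 1 at \<open>(x1, b)\<close>.
    This value is a multiple of \<open>e\<close>, so \<open>e\<close> is a unit.\<close>
  obtain x1 where x1: "x1 \<in> dual_line m T a" "pairing x1 b = \<one>" using onto_x[OF one_closed] by blast
  have eU: "e \<in> Units R"
    using scale(1,3)[OF x1(1) b] x1(2) e by (auto simp: Units_def m_comm intro!: bexI[of _ "pairing x1 y0"])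
  have inv_e: "inv e \<in> carrier R" using eU by auto
  have one: "corner_one T a b = E e"
  proof -
    have "comm_rel m T a b (E e)" using corner_dual_pairing(1)[OF a b] e_def by simp
    then have "a \<otimes>\<^bsub>T\<^esub> b = E e \<otimes>\<^bsub>T\<^esub> (b \<otimes>\<^bsub>T\<^esub> a)" unfolding comm_rel_def by blast
    then show ?thesis unfolding corner_one_def using aT bT E_T[OF e] by (simp add: T.m_assoc)
  qed
  have rel: "corner_prod_rel m T a b (E r) (E s) z \<longleftrightarrow> z = E (r \<otimes> s \<otimes> inv e)"
    if r: "r \<in> carrier R" and s: "s \<in> carrier R" for r s z
  proof -
    have val: "pairing x y = r \<otimes> s \<otimes> inv e"
      if x: "x \<in> dual_line m T a" "pairing x b = r" and y: "y \<in> second_corner m T" "pairing a y = s" for x y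
    proof -
      have k: "pairing x y0 \<in> carrier R" using scale(3)[OF x(1) y(1)] .
      have "r \<otimes> s \<otimes> inv e = pairing x y0 \<otimes> s \<otimes> (e \<otimes> inv e)"
        using scale(1)[OF x(1) y(1)] x(2) k s e inv_e by (simp add: m_ac)
      then show ?thesis using scale(2)[OF x(1) y(1)] y(2) eU k s by simp
    qed
    show ?thesis
    proof
      assume "corner_prod_rel m T a b (E r) (E s) z"
      then obtain x y where x: "x \<in> dual_line m T a" and y: "y \<in> second_corner m T"
        and rel: "comm_rel m T x b (E r)" "comm_rel m T a y (E s)" "comm_rel m T x y z"
        unfolding corner_prod_rel_def by blast
      have xd: "x \<in> corner_dual m T" using scale(4)[OF x y] .
      have "E r = E (pairing x b)" "E s = E (pairing a y)" "z = E (pairing x y)"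
        using rel corner_dual_pairing(1)[OF xd b] corner_dual_pairing(1)[OF a y] corner_dual_pairing(1)[OF xd y] by blast+
      then have "pairing x b = r" "pairing a y = s" "z = E (pairing x y)" using E_inj by metis+
      then show "z = E (r \<otimes> s \<otimes> inv e)" using val[OF x _ y] by simp
    next
      assume z: "z = E (r \<otimes> s \<otimes> inv e)"
      obtain x where x: "x \<in> dual_line m T a" "pairing x b = r" using onto_x[OF r] by blast
      obtain y where y: "y \<in> second_corner m T" "pairing a y = s" using onto_y[OF s] by blast
      have xd: "x \<in> corner_dual m T" using scale(4)[OF x(1) y(1)] .
      show "corner_prod_rel m T a b (E r) (E s) z"
        unfolding corner_prod_rel_def
      proof (intro bexI conjI)
        show "comm_rel m T x b (E r)" using corner_dual_pairing(1)[OF xd b] x(2) by simp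
        show "comm_rel m T a y (E s)" using corner_dual_pairing(1)[OF a y(1)] y(2) by simp
        show "comm_rel m T x y z" using corner_dual_pairing(1)[OF xd y(1)] val[OF x y] z by simp
      qed (use x y corner_dual_carrier[OF xd] second_corner_entries(1) in auto)
    qed
  qed
  have "corner_mult m T a b (E r) (E s) = E (r \<otimes> s \<otimes> inv e)" if "r \<in> carrier R" "s \<in> carrier R" for r s
  proof -
    have P: "(\<lambda>z. z \<in> carrier T \<and> corner_prod_rel m T a b (E r) (E s) z) = (\<lambda>z. z = E (r \<otimes> s \<otimes> inv e))"
      using rel[OF that] E_T[of "r \<otimes> s \<otimes> inv e"] that inv_e by auto
    show ?thesis unfolding corner_mult_def P by simp
  qed
  then show thesis using that eU one by blast
qed

lemma E_mult: "r \<in> carrier R \<Longrightarrow> s \<in> carrier R \<Longrightarrow> E r \<otimes>\<^bsub>T\<^esub> E s = E (r \<oplus> s)"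
  by (rule elem_mult_elem_T) (use n3 in auto)

lemma E_inv: "r \<in> carrier R \<Longrightarrow> inv\<^bsub>T\<^esub> (E r) = E (\<ominus> r)"
  by (rule T.inv_equality) (auto simp: E_mult[simplified] l_neg elem_zero_T E_T[simplified])

text \<open>The map from \<open>r\<close> to \<open>E (r \<otimes> e)\<close> is an isomorphism of
  \<open>R\<close> onto the ring of the frame: it sends 1 to \<open>E e\<close>, and dividing the
  product of \<open>r e\<close> and \<open>s e\<close> by \<open>e\<close> gives
  \<open>r s e\<close>. So every frame makes the same ring sentences true.\<close>

lemma corner_sat_iff:
  assumes "corner_frame m T a b" "fm_fv ring_trm_vars \<phi> = {}" "range e' \<subseteq> corner m T" "range e'' \<subseteq> carrier R"
  shows "sat (corner m T) (corner_trm_val m T a b) e' \<phi> \<longleftrightarrow> sat (carrier R) (ring_trm_val R) e'' \<phi>"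
proof -
  obtain e where e: "e \<in> Units R" "corner_one T a b = E e"
    and mult: "\<And>r s. r \<in> carrier R \<Longrightarrow> s \<in> carrier R \<Longrightarrow> corner_mult m T a b (E r) (E s) = E (r \<otimes> s \<otimes> inv e)"
    using corner_frame_mult[OF assms(1)] by blast
  have ec: "e \<in> carrier R" "inv e \<in> carrier R" "e \<otimes> inv e = \<one>" "inv e \<otimes> e = \<one>" using e(1) by auto
  let ?h = "\<lambda>r. E (r \<otimes> e)"
  have bij: "bij_betw ?h (carrier R) (corner m T)"
  proof (rule bij_betwI)
    show "?h \<in> carrier R \<rightarrow> corner m T" using ec by (auto simp: corner_T)
    show "(\<lambda>x. x $$ (0, n - 1) \<otimes> inv e) \<in> corner m T \<rightarrow> carrier R"
      using ec n3 by (auto simp: corner_T elem_entry)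
    show "?h r $$ (0, n - 1) \<otimes> inv e = r" if "r \<in> carrier R" for r
      using that ec n3 by (simp add: elem_entry m_assoc)
    show "?h (x $$ (0, n - 1) \<otimes> inv e) = x" if "x \<in> corner m T" for x
      using that ec n3 by (auto simp: corner_T elem_entry m_assoc)
  qed
  have R: "ring R" by unfold_locales
  have ev: "?h (ring_trm_val R f t) = corner_trm_val m T a b (\<lambda>i. ?h (f i)) t" if f: "range f \<subseteq> carrier R" for f t
  proof (induction t)
    case (RMult s t)
    let ?s = "ring_trm_val R f s" and ?t = "ring_trm_val R f t"
    have st: "?s \<in> carrier R" "?t \<in> carrier R" using ring_trm_val_closed[OF R f] by auto
    have "?s \<otimes> e \<otimes> (?t \<otimes> e) \<otimes> inv e = ?s \<otimes> ?t \<otimes> e \<otimes> (e \<otimes> inv e)"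
      unfolding m_assoc[OF m_closed m_closed ec(2), symmetric] using st ec(1,2) by (simp add: m_ac)
    also have "\<dots> = ?s \<otimes> ?t \<otimes> e" using st ec by simp
    finally show ?case using RMult[symmetric] mult[of "?s \<otimes> e" "?t \<otimes> e"] st ec by simp
  next
    case (RAdd s t)
    show ?case
      using ring_trm_val_closed[OF R f] ec E_mult RAdd[symmetric] by (simp add: l_distr)
  next
    case (RNeg t)
    show ?case using ring_trm_val_closed[OF R f, of t] ec E_inv RNeg[symmetric] by (simp add: l_minus)
  qed (use ec e in \<open>auto simp: elem_zero_T\<close>)
  have "sat (carrier R) (ring_trm_val R) e'' \<phi> \<longleftrightarrow> sat (corner m T) (corner_trm_val m T a b) (\<lambda>i. ?h (e'' i)) \<phi>"
    by (rule sat_iso[where h = ?h and A = "carrier R" and ev = "ring_trm_val R"])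
      (rule bij, rule ev, assumption, rule ring_trm_val_closed[OF R], assumption, rule assms(4))
  also have "\<dots> \<longleftrightarrow> sat (corner m T) (corner_trm_val m T a b) e' \<phi>"
  proof (rule sat_cong[of ring_trm_vars])
    show "corner_trm_val m T a b e1 t = corner_trm_val m T a b e2 t" if "\<forall>x\<in>ring_trm_vars t. e1 x = e2 x" for t e1 e2
      using that by (induction t) auto
  qed (use assms(2) in simp)
  finally show ?thesis by simp
qed

text \<open>The element \<open>elem 0 1 r\<close> pairs with \<open>y\<close> to
  \<open>r \<otimes> sec2 y\<close>, so \<open>r\<close> and \<open>sec2 y\<close> can be varied
  independently; this gives both surjectivity properties.\<close>

lemma standard_frame:
  shows "corner_frame m T (elem 0 1 \<one>) (elem 1 (n - 1) \<one>)"
    and "corner_one T (elem 0 1 \<one>) (elem 1 (n - 1) \<one>) = E \<one>"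
proof -
  let ?a = "elem 0 1 \<one>" and ?b = "elem 1 (n - 1) \<one>"
  have aT: "elem 0 1 r \<in> carrier T" if "r \<in> carrier R" for r using that n3 by (intro elem_T) auto
  have i: "(0::nat) \<noteq> 1" "0 < n" "1 < n" and i': "0 \<noteq> n - 1" "n - 1 < n" using n3 by auto
  have pairing_a: "pairing (elem 0 1 r) y = r \<otimes> sec2 y"
    if "r \<in> carrier R" "y \<in> carrier T" for r y
    unfolding pairing_def using that coords_closed[OF that(2)] n3
    by (auto simp: dual1_def dual2_def elem_entry a_minus_def)
  have comm: "comm_rel m T (elem 0 1 r) y (E (r \<otimes> sec2 y))"
    if r: "r \<in> carrier R" and y: "y \<in> second_corner m T" for r y
  proof -
    have yT: "y \<in> carrier T" using second_corner_entries(1)[OF y] .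
    have U: "y $$ (0, 0) \<in> Units R" using T_diag yT n3 by auto
    have s: "sec2 y \<in> carrier R" using coords_closed(4)[OF yT] .
    have yx: "y \<otimes>\<^bsub>T\<^esub> elem 0 1 r \<in> carrier T" using yT aT r by simp
    have "elem 0 1 r \<otimes>\<^bsub>T\<^esub> y = E (r \<otimes> sec2 y) \<otimes>\<^bsub>T\<^esub> (y \<otimes>\<^bsub>T\<^esub> elem 0 1 r)"
    proof (rule T_eqI)
      fix k l assume kl: "k < n" "l < n" "k \<le> l"
      have last: "(y \<otimes>\<^bsub>T\<^esub> elem 0 1 r) $$ (n - 1, l) = (if l = n - 1 then y $$ (0, 0) else \<zero>)"
        using T_upper[OF yx, of "n - 1" l] T_mult_diag[OF yT aT[OF r], of "n - 1"] kl n3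
          second_corner_entries(5)[OF y] T_entry[OF yT] by (auto simp: elem_entry)
      have "sec2 y \<otimes> y $$ (0, 0) = y $$ (1, n - 1)"
      proof -
        have "inv u \<otimes> v \<otimes> u = v" if "u \<in> Units R" "v \<in> carrier R" for u v
        proof -
          have "inv u \<otimes> v \<otimes> u = v \<otimes> (inv u \<otimes> u)"
            using that Units_closed[OF that(1)] Units_inv_closed[OF that(1)]
            by (simp add: m_comm[of "inv u" v] m_assoc)
          then show ?thesis using that by simp
        qed
        then show ?thesis unfolding sec2_def using U T_entry[OF yT] i i' by simp
      qed
      then have cy: "r \<otimes> sec2 y \<otimes> y $$ (0, 0) = r \<otimes> y $$ (1, n - 1)"
        using r s T_entry[OF yT] i by (simp add: m_assoc)
      \<comment> \<open>Left multiplication adds \<open>r\<close> times this row to row 0, right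
        multiplication adds \<open>r\<close> times column 0 to column 1. The shape of row 1 makes
        the results agree outside the corner.\<close>
      have row1: "y $$ (1, l) = (if l = 1 then y $$ (0, 0) else if l = n - 1 then y $$ (1, n - 1) else \<zero>)"
      proof -
        consider "l = 0" | "l = 1" | "l = n - 1" "l \<noteq> 1" | "1 < l" "l < n - 1" using kl by linarith
        then show ?thesis
        proof cases
          case 1
          then show ?thesis using T_upper[OF yT i(3), of 0] i' by simp
        next
          case 2
          then show ?thesis using second_corner_entries(5,6)[OF y] by simp
        next
          case 4
          then show ?thesis using second_corner_entries(4)[OF y] by simp
        qed simp
      qed
      have col0: "y $$ (k, 0) = (if k = 0 then y $$ (0, 0) else \<zero>)" using T_upper[OF yT, of k 0] kl by auto
      show "(elem 0 1 r \<otimes>\<^bsub>T\<^esub> y) $$ (k, l) = (E (r \<otimes> sec2 y) \<otimes>\<^bsub>T\<^esub> (y \<otimes>\<^bsub>T\<^esub> elem 0 1 r)) $$ (k, l)"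
        unfolding elem_mult_T[OF T_M[OF yT] r i kl(1,2)]
          elem_mult_T[OF T_M[OF yx] m_closed[OF r s] i'(1) i(2) i'(2) kl(1,2)]
          mult_elem_T[OF T_M[OF yT] r i kl(1,2)] last row1 col0
        using kl r s n3 T_entry[OF yT] cy by (auto simp: m_comm)
    qed (use yT aT r s E_T yx in auto)
    then show ?thesis unfolding comm_rel_def corner_T using r s by auto
  qed
  have dual: "elem 0 1 r \<in> corner_dual m T" if r: "r \<in> carrier R" for r
    unfolding corner_dual_def
  proof (intro CollectI conjI ballI impI)
    fix z assume "z \<in> corner m T"
    then obtain s where "s \<in> carrier R" "z = E s" by (auto simp: corner_T)
    then show "elem 0 1 r \<otimes>\<^bsub>T\<^esub> z = z \<otimes>\<^bsub>T\<^esub> elem 0 1 r"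
      using E_commutes[OF aT[OF r]] n3 by (simp add: elem_entry)
  next
    fix y assume y: "y \<in> second_corner m T"
    have "E (r \<otimes> sec2 y) \<in> carrier T" using r coords_closed(4)[OF second_corner_entries(1)[OF y]] E_T by simp
    then show "\<exists>z\<in>carrier T. comm_rel m T (elem 0 1 r) y z" using comm[OF r y] by blast
  qed (rule aT[OF r])
  have line: "elem 0 1 r \<in> dual_line m T ?a" if r: "r \<in> carrier R" for r
    unfolding dual_line_def
  proof (intro CollectI conjI ballI impI dual aT r)
    fix y assume y: "y \<in> second_corner m T" "?a \<otimes>\<^bsub>T\<^esub> y = y \<otimes>\<^bsub>T\<^esub> ?a"
    have yT: "y \<in> carrier T" using second_corner_entries(1)[OF y(1)] .
    have "sec2 y = \<zero>"
      using corner_dual_pairing(2)[OF dual[OF one_closed] y(1)] y(2) pairing_a[OF one_closed yT] coords_closed(4)[OF yT]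
      by simp
    then show "elem 0 1 r \<otimes>\<^bsub>T\<^esub> y = y \<otimes>\<^bsub>T\<^esub> elem 0 1 r"
      using corner_dual_pairing(2)[OF dual[OF r] y(1)] pairing_a[OF r yT] r by simp
  qed
  have second: "elem 1 (n - 1) s = second_elem \<zero> s" if "s \<in> carrier R" for s
    unfolding second_elem_def using that n3 elem_T[of s 1 "n - 1"] by (simp add: elem_zero_T)
  have b: "elem 1 (n - 1) s \<in> second_corner m T" "sec2 (elem 1 (n - 1) s) = s" if "s \<in> carrier R" for s
    using second_elem_in[of \<zero> s] second_elem_coords(2)[of \<zero> s] second[OF that] that by auto
  have comm': "comm_rel m T (elem 0 1 r) (elem 1 (n - 1) s) (E (r \<otimes> s))" if "r \<in> carrier R" "s \<in> carrier R" for r s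
    using comm[OF that(1) b(1)[OF that(2)]] b(2)[OF that(2)] by simp
  show "corner_frame m T ?a ?b"
    unfolding corner_frame_def
  proof (intro conjI ballI impI)
    fix y assume "y \<in> corner m T"
    then obtain s where s: "s \<in> carrier R" "y = E s" by (auto simp: corner_T)
    then show "\<exists>y'\<in>carrier T. y' \<in> second_corner m T \<and> comm_rel m T ?a y' y"
      using comm'[of \<one> s] b(1)[of s] second_corner_entries(1)[OF b(1)[of s]]
      by (intro bexI[of _ "elem 1 (n - 1) s"]) auto
  next
    fix x assume "x \<in> corner m T"
    then obtain r where r: "r \<in> carrier R" "x = E r" by (auto simp: corner_T)
    then show "\<exists>x'\<in>carrier T. x' \<in> dual_line m T ?a \<and> comm_rel m T x' ?b x"
      using comm'[of r \<one>] line[of r] aT[of r] by (intro bexI[of _ "elem 0 1 r"]) auto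
  qed (use dual b in auto)
  have "?a \<otimes>\<^bsub>T\<^esub> ?b = E \<one> \<otimes>\<^bsub>T\<^esub> (?b \<otimes>\<^bsub>T\<^esub> ?a)"
    using comm'[of \<one> \<one>] unfolding comm_rel_def by simp
  moreover have "?b \<in> carrier T" using second_corner_entries(1)[OF b(1)[of \<one>]] by simp
  ultimately show "corner_one T ?a ?b = E \<one>"
    unfolding corner_one_def using aT[of \<one>] E_T[of \<one>] by (simp add: T.m_assoc)
qed

lemma standard_mult:
  assumes "r \<in> carrier R" "s \<in> carrier R"
  shows "corner_mult m T (elem 0 1 \<one>) (elem 1 (n - 1) \<one>) (E r) (E s) = E (r \<otimes> s)"
proof -
  obtain e where e: "e \<in> Units R" "corner_one T (elem 0 1 \<one>) (elem 1 (n - 1) \<one>) = E e"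
    "corner_mult m T (elem 0 1 \<one>) (elem 1 (n - 1) \<one>) (E r) (E s) = E (r \<otimes> s \<otimes> inv e)"
    using corner_frame_mult[OF standard_frame(1)] assms by metis
  then have "e = \<one>" using standard_frame(2) E_inj by metis
  then show ?thesis using e(3) assms by simp
qed

lemma standard_ring_axioms:
  "corner_ring_axioms m T (elem 0 1 \<one>) (elem 1 (n - 1) \<one>)"
proof -
  have one: "\<one>\<^bsub>T\<^esub> = E \<zero>" by (simp add: elem_zero_T)
  show ?thesis
    unfolding corner_ring_axioms_def standard_frame(2) corner_T
    by (intro conjI ballI impI; (elim conjE imageE)?)
      (simp_all only: standard_mult E_mult E_inv one_closed m_closed a_closed a_inv_closed zero_closed one
        l_one l_distr m_assoc image_eqI m_comm a_comm refl imageI, simp_all add: m_ac a_ac l_distr r_distr)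
qed

end


section \<open>Standard coordinates\<close>

lemma (in abelian_monoid) foldr_add_eq_finsum:
  assumes "distinct xs" "f \<in> set xs \<rightarrow> carrier G"
  shows "foldr (\<lambda>k. add G (f k)) xs \<zero> = (\<Oplus>k\<in>set xs. f k)"
  using assms by (induction xs) (auto simp: finsum_insert)

lemma tri_word_cong:
  assumes "\<And>k. k < n \<Longrightarrow> d k = d' k" "\<And>i j. i < j \<Longrightarrow> j < n \<Longrightarrow> x (i, j) = x' (i, j)"
  shows "tri_word G n d x = tri_word G n d' x'"
proof -
  have "foldr (\<lambda>p. mult G (x p)) (upper_pairs n) \<one>\<^bsub>G\<^esub> = foldr (\<lambda>p. mult G (x' p)) (upper_pairs n) \<one>\<^bsub>G\<^esub>"
    by (rule foldr_cong) (use assms(2) in \<open>auto simp: set_upper_pairs\<close>)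
  then show ?thesis unfolding tri_word_def
    by (rule foldr_cong) (use assms(1) in auto)
qed

text \<open>The finite list \<open>\<sigma>\<close> contains all units and meets all classes modulo
  2; both finiteness conditions enter through it. Absence of 2-torsion lets sign matrices detect
  zero entries.\<close>

locale standard_params = torsion_matrices R n m
  for R :: "('a, 'm) ring_scheme" (structure) and n m :: nat +
  fixes \<sigma> :: "nat \<Rightarrow> 'a" and q ko kn :: nat
  assumes \<sigma>_closed: "k < q \<Longrightarrow> \<sigma> k \<in> carrier R"
    and ko: "ko < q" "\<sigma> ko = \<one>" and kn: "kn < q" "\<sigma> kn = \<ominus> \<one>"
    and mod_2: "r \<in> carrier R \<Longrightarrow> \<exists>k<q. \<exists>s\<in>carrier R. r = \<sigma> k \<oplus> (s \<oplus> s)"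
    and units_\<sigma>: "u \<in> Units R \<Longrightarrow> \<exists>k<q. \<sigma> k = u"
    and two_torsion_free: "r \<in> carrier R \<Longrightarrow> r \<oplus> r = \<zero> \<Longrightarrow> r = \<zero>"
begin

definition "unit_indices = {k. k < q \<and> \<sigma> k \<in> Units R}"

definition std :: "'a mat params" where
  "std = (\<lambda>(i, j, k). if i < j \<and> j < n \<and> k < q then elem i j (\<sigma> k)
     else if k \<in> unit_indices then diag i (\<sigma> k) else \<one>\<^bsub>T\<^esub>)"

lemma std_elem: "i < j \<Longrightarrow> j < n \<Longrightarrow> k < q \<Longrightarrow> std (i, j, k) = elem i j (\<sigma> k)"
  by (simp add: std_def)

lemma std_diag: "k \<in> unit_indices \<Longrightarrow> std (i, i, k) = diag i (\<sigma> k)"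
  by (simp add: std_def)

lemma std_T: "std x \<in> carrier T"
  by (auto simp: std_def unit_indices_def elem_T diag_T \<sigma>_closed split: prod.splits)

lemma neg_one_unit: "\<ominus> \<one> \<in> Units R"
  by (auto simp: Units_def l_minus r_minus intro!: bexI[of _ "\<ominus> \<one>"])

lemma kn_unit: "kn \<in> unit_indices"
  by (simp add: unit_indices_def kn neg_one_unit)

abbreviation sgn_mat :: "nat \<Rightarrow> 'a mat" where "sgn_mat i \<equiv> diag i (\<ominus> \<one>)"

lemma std_sign: "std (i, i, kn) = sgn_mat i"
  by (simp add: std_diag kn_unit kn(2))

lemma eq_neg_self: "r \<in> carrier R \<Longrightarrow> r = \<ominus> r \<Longrightarrow> r = \<zero>"
  using two_torsion_free r_neg by metis

text \<open>Of the two products with the sign matrix, exactly one negates the entry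
  \<open>(a, b)\<close>.\<close>

lemma commute_sign_entry:
  assumes y: "y \<in> carrier T" "y \<otimes>\<^bsub>T\<^esub> sgn_mat l = sgn_mat l \<otimes>\<^bsub>T\<^esub> y"
    and ab: "a < n" "b < n" "a \<noteq> b" "l = a \<or> l = b"
  shows "y $$ (a, b) = \<zero>"
proof -
  have neg: "\<ominus> \<one> \<in> carrier R" by simp
  have "(y \<otimes>\<^bsub>T\<^esub> sgn_mat l) $$ (a, b) = (sgn_mat l \<otimes>\<^bsub>T\<^esub> y) $$ (a, b)" using y(2) by simp
  then have "y $$ (a, b) = \<ominus> y $$ (a, b)"
    unfolding mult_diag_T[OF T_M[OF y(1)] neg ab(1,2)] diag_mult_T[OF T_M[OF y(1)] neg ab(1,2)]
    using ab T_entry[OF y(1) ab(1,2)] by (auto simp: l_minus r_minus)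
  then show ?thesis by (rule eq_neg_self[OF T_entry[OF y(1) ab(1,2)]])
qed

text \<open>Conjugation by the sign matrix negates the only off-diagonal entry of \<open>y\<close>.
  The commutator is therefore elementary, and its entry is minus twice \<open>y $$ (i, j)\<close>,
  divided by \<open>y $$ (j, j)\<close>.\<close>

lemma sign_commutator:
  assumes y: "y \<in> carrier T" and ij: "i < j" "j < n" and s: "s \<in> carrier R"
    and off: "\<And>a b. a < n \<Longrightarrow> b < n \<Longrightarrow> a \<noteq> b \<Longrightarrow> (a, b) \<noteq> (i, j) \<Longrightarrow> y $$ (a, b) = \<zero>"
    and eq: "s \<otimes> y $$ (j, j) = \<ominus> (y $$ (i, j) \<oplus> y $$ (i, j))"
  shows "elem i j s \<otimes>\<^bsub>T\<^esub> (y \<otimes>\<^bsub>T\<^esub> sgn_mat i) = sgn_mat i \<otimes>\<^bsub>T\<^esub> y"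
proof (rule T_eqI)
  have neg: "\<ominus> \<one> \<in> carrier R" by simp
  have ydT: "y \<otimes>\<^bsub>T\<^esub> sgn_mat i \<in> carrier T" using y diag_T[OF neg_one_unit] by simp
  show "elem i j s \<otimes>\<^bsub>T\<^esub> (y \<otimes>\<^bsub>T\<^esub> sgn_mat i) \<in> carrier T" "sgn_mat i \<otimes>\<^bsub>T\<^esub> y \<in> carrier T"
    using ydT elem_T[OF s ij] y diag_T[OF neg_one_unit] by auto
  fix a b assume ab: "a < n" "b < n" "a \<le> b"
  have i: "i \<noteq> j" "i < n" using ij by auto
  have row: "y $$ (j, b) = (if b = j then y $$ (j, j) else \<zero>)" using off[of j b] ab ij by auto
  have col: "a \<noteq> i \<Longrightarrow> y $$ (a, i) = \<zero>" using off[of a i] ab ij by auto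
  have cancel: "v \<oplus> \<ominus> (v \<oplus> v) = \<ominus> v" if "v \<in> carrier R" for v
    using that by (simp add: minus_add r_neg1 r_neg2 a_ac)
  show "(elem i j s \<otimes>\<^bsub>T\<^esub> (y \<otimes>\<^bsub>T\<^esub> sgn_mat i)) $$ (a, b) = (sgn_mat i \<otimes>\<^bsub>T\<^esub> y) $$ (a, b)"
    unfolding elem_mult_T[OF T_M[OF ydT] s i ij(2) ab(1,2)] mult_diag_T[OF T_M[OF y] neg ab(1,2)]
      mult_diag_T[OF T_M[OF y] neg ij(2) ab(2)] diag_mult_T[OF T_M[OF y] neg ab(1,2)] row
    using ij ab s off[of i b] col eq cancel[of "y $$ (i, j)"] T_entry[OF y] i
    by (auto simp: l_minus r_minus)
qed

text \<open>Commuting with the sign matrices at the other places leaves a diagonal matrix together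
  with the entry \<open>(i, j)\<close>. The commutator with one more sign matrix eliminates the
  unknown diagonal but produces only even entries; the factor with index \<open>k\<close> restores
  the other classes modulo 2.\<close>

lemma root_elem_std:
  assumes ij: "i < j" "j < n"
  shows "root_elem T n q kn std i j x \<longleftrightarrow> x \<in> elem i j ` carrier R"
proof
  assume "root_elem T n q kn std i j x"
  then obtain k w y where k: "k < q" and w: "w \<in> carrier T" and y: "y \<in> carrier T"
    and comm: "\<And>l. l < n \<Longrightarrow> l \<noteq> i \<Longrightarrow> l \<noteq> j \<Longrightarrow> y \<otimes>\<^bsub>T\<^esub> sgn_mat l = sgn_mat l \<otimes>\<^bsub>T\<^esub> y"
    and wy: "w \<otimes>\<^bsub>T\<^esub> (y \<otimes>\<^bsub>T\<^esub> sgn_mat i) = sgn_mat i \<otimes>\<^bsub>T\<^esub> y" and x: "x = elem i j (\<sigma> k) \<otimes>\<^bsub>T\<^esub> w"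
    unfolding root_elem_def std_sign using std_elem[OF ij] by auto
  have off: "y $$ (a, b) = \<zero>" if "a < n" "b < n" "a \<noteq> b" "(a, b) \<noteq> (i, j)" for a b
  proof (cases "b < a")
    case True
    then show ?thesis using T_upper y that by simp
  next
    case False
    then have "a < b" using that by simp
    \<comment> \<open>Two distinct pairs in increasing order differ as sets, so \<open>a\<close> or
      \<open>b\<close> lies outside \<open>{i, j}\<close>, and the sign matrix at that place may be
      used.\<close>
    then have "a \<noteq> i \<and> a \<noteq> j \<or> b \<noteq> i \<and> b \<noteq> j" using that(4) ij by auto
    then consider "a \<noteq> i \<and> a \<noteq> j" | "b \<noteq> i \<and> b \<noteq> j" by blast
    then show ?thesis
    proof cases
      case 1
      then show ?thesis using commute_sign_entry[OF y comm[of a] that(1,2,3)] that by auto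
    next
      case 2
      then show ?thesis using commute_sign_entry[OF y comm[of b] that(1,2,3)] that by auto
    qed
  qed
  have u: "y $$ (j, j) \<in> Units R" using T_diag y ij by simp
  have yij: "y $$ (i, j) \<in> carrier R" using T_entry y ij by simp
  define s where "s = \<ominus> (y $$ (i, j) \<oplus> y $$ (i, j)) \<otimes> inv (y $$ (j, j))"
  have s: "s \<in> carrier R" unfolding s_def using u yij by simp
  have "s \<otimes> y $$ (j, j) = \<ominus> (y $$ (i, j) \<oplus> y $$ (i, j))"
    unfolding s_def using u yij Units_closed[OF u] by (simp add: m_assoc)
  from sign_commutator[OF y ij s off this] have "elem i j s \<otimes>\<^bsub>T\<^esub> (y \<otimes>\<^bsub>T\<^esub> sgn_mat i) = sgn_mat i \<otimes>\<^bsub>T\<^esub> y" .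
  then have "elem i j s \<otimes>\<^bsub>T\<^esub> (y \<otimes>\<^bsub>T\<^esub> sgn_mat i) = w \<otimes>\<^bsub>T\<^esub> (y \<otimes>\<^bsub>T\<^esub> sgn_mat i)" using wy by simp
  then have "w = elem i j s" using w y elem_T[OF s ij] diag_T[OF neg_one_unit] by simp
  then have "x = elem i j (\<sigma> k \<oplus> s)" using x elem_mult_elem_T[OF \<sigma>_closed[OF k] s ij] by simp
  then show "x \<in> elem i j ` carrier R" using \<sigma>_closed[OF k] s by auto
next
  assume "x \<in> elem i j ` carrier R"
  then obtain r where r: "r \<in> carrier R" "x = elem i j r" by blast
  obtain k s where k: "k < q" and s: "s \<in> carrier R" "r = \<sigma> k \<oplus> (s \<oplus> s)" using mod_2[OF r(1)] by blast
  \<comment> \<open>The entry \<open>\<ominus> s\<close> is chosen so that the commutator with the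
    sign matrix has entry \<open>s \<oplus> s\<close>.\<close>
  let ?y = "elem i j (\<ominus> s)" and ?w = "elem i j (s \<oplus> s)"
  have y: "?y \<in> carrier T" and w: "?w \<in> carrier T" using s ij by (auto intro!: elem_T)
  have i: "i < n" using ij by simp
  have "?y \<otimes>\<^bsub>T\<^esub> sgn_mat l = sgn_mat l \<otimes>\<^bsub>T\<^esub> ?y" if "l \<noteq> i" "l \<noteq> j" for l
  proof (rule T_eqI)
    fix a b assume ab: "a < n" "b < n"
    have neg: "\<ominus> \<one> \<in> carrier R" by simp
    show "(?y \<otimes>\<^bsub>T\<^esub> sgn_mat l) $$ (a, b) = (sgn_mat l \<otimes>\<^bsub>T\<^esub> ?y) $$ (a, b)"
      unfolding mult_diag_T[OF T_M[OF y] neg ab] diag_mult_T[OF T_M[OF y] neg ab]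
      using that ab s by (auto simp: elem_entry)
  qed (use y diag_T[OF neg_one_unit] in auto)
  moreover have "?w \<otimes>\<^bsub>T\<^esub> (?y \<otimes>\<^bsub>T\<^esub> sgn_mat i) = sgn_mat i \<otimes>\<^bsub>T\<^esub> ?y"
    by (rule sign_commutator[OF y ij]) (use s ij i in \<open>auto simp: elem_entry minus_add\<close>)
  moreover have "x = elem i j (\<sigma> k) \<otimes>\<^bsub>T\<^esub> ?w"
    using elem_mult_elem_T[OF \<sigma>_closed[OF k] _ ij, of "s \<oplus> s"] s r by simp
  ultimately show "root_elem T n q kn std i j x"
    unfolding root_elem_def std_sign using k w y std_elem[OF ij k]
    by (intro bexI[of _ k] bexI[of _ ?w] bexI[of _ ?y]) auto
qed

lemma commutator_unique:
  assumes "r \<in> carrier R" "s \<in> carrier R" "i < j" "j < k" "k < n" "v \<in> carrier T"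
  shows "elem i j r \<otimes>\<^bsub>T\<^esub> elem j k s = v \<otimes>\<^bsub>T\<^esub> (elem j k s \<otimes>\<^bsub>T\<^esub> elem i j r) \<longleftrightarrow> v = elem i k (r \<otimes> s)"
proof -
  have "elem i j r \<in> carrier T" "elem j k s \<in> carrier T" "elem i k (r \<otimes> s) \<in> carrier T"
    using assms by (auto intro!: elem_T)
  then show ?thesis using elem_commutator[OF assms(1-5)] assms(6) by auto
qed

lemma root_coord_std:
  assumes ij: "i < j" "j < n" and r: "r \<in> carrier R" and v: "v \<in> carrier T"
  shows "root_coord T n ko std i j (elem i j r) v \<longleftrightarrow> v = E r"
proof -
  consider "i = 0" "j = n - 1" | "i = 0" "j < n - 1" | "0 < i" "j = n - 1" | "0 < i" "j < n - 1"
    using ij by linarith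
  then show ?thesis
  proof cases
    case 1
    then show ?thesis by (simp add: root_coord_def)
  next
    case 2
    then show ?thesis
      using commutator_unique[OF r one_closed, of 0 j "n - 1" v] ij v r std_elem[of j "n - 1" ko] ko
      by (simp add: root_coord_def)
  next
    case 3
    then show ?thesis
      using commutator_unique[OF one_closed r, of 0 i "n - 1" v] ij v r std_elem[of 0 i ko] ko
      by (simp add: root_coord_def)
  next
    case 4
    have w: "elem i (n - 1) r \<in> carrier T" using 4 ij r by (intro elem_T) auto
    have std1: "std (j, n - 1, ko) = elem j (n - 1) \<one>" "std (0, i, ko) = elem 0 i \<one>"
      using 4 ij ko std_elem[of j "n - 1" ko] std_elem[of 0 i ko] by auto
    have uniq: "elem i j r \<otimes>\<^bsub>T\<^esub> elem j (n - 1) \<one> = w \<otimes>\<^bsub>T\<^esub> (elem j (n - 1) \<one> \<otimes>\<^bsub>T\<^esub> elem i j r) \<longleftrightarrow>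
        w = elem i (n - 1) r" if "w \<in> carrier T" for w
      using commutator_unique[OF r one_closed ij(1) 4(2) _ that] r n3 by simp
    have "i \<noteq> 0" "j \<noteq> n - 1" using 4 by auto
    then have "root_coord T n ko std i j (elem i j r) v \<longleftrightarrow>
        (\<exists>w\<in>carrier T. elem i j r \<otimes>\<^bsub>T\<^esub> elem j (n - 1) \<one> = w \<otimes>\<^bsub>T\<^esub> (elem j (n - 1) \<one> \<otimes>\<^bsub>T\<^esub> elem i j r) \<and>
          elem 0 i \<one> \<otimes>\<^bsub>T\<^esub> w = v \<otimes>\<^bsub>T\<^esub> (w \<otimes>\<^bsub>T\<^esub> elem 0 i \<one>))"
      unfolding root_coord_def std1 by (simp only: if_False simp_thms)
    also have "\<dots> \<longleftrightarrow>
        (\<exists>w\<in>carrier T. w = elem i (n - 1) r \<and> elem 0 i \<one> \<otimes>\<^bsub>T\<^esub> w = v \<otimes>\<^bsub>T\<^esub> (w \<otimes>\<^bsub>T\<^esub> elem 0 i \<one>))"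
      by (intro bex_cong refl arg_cong2[of _ _ _ _ "(\<and>)"] uniq)
    also have "\<dots> \<longleftrightarrow> elem 0 i \<one> \<otimes>\<^bsub>T\<^esub> elem i (n - 1) r = v \<otimes>\<^bsub>T\<^esub> (elem i (n - 1) r \<otimes>\<^bsub>T\<^esub> elem 0 i \<one>)"
    proof
      assume "elem 0 i \<one> \<otimes>\<^bsub>T\<^esub> elem i (n - 1) r = v \<otimes>\<^bsub>T\<^esub> (elem i (n - 1) r \<otimes>\<^bsub>T\<^esub> elem 0 i \<one>)"
      with w show "\<exists>w\<in>carrier T. w = elem i (n - 1) r \<and> elem 0 i \<one> \<otimes>\<^bsub>T\<^esub> w = v \<otimes>\<^bsub>T\<^esub> (w \<otimes>\<^bsub>T\<^esub> elem 0 i \<one>)"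
        by (intro bexI[of _ "elem i (n - 1) r"] conjI refl)
    qed (elim bexE conjE, hypsubst)
    also have "\<dots> \<longleftrightarrow> v = E r"
      using commutator_unique[OF one_closed r, of 0 i "n - 1" v] 4 ij v r by simp
    finally show ?thesis .
  qed
qed

lemma std_frame: "std (0, 1, ko) = elem 0 1 \<one>" "std (1, n - 1, ko) = elem 1 (n - 1) \<one>"
  using std_elem[of 0 1 ko] std_elem[of 1 "n - 1" ko] ko n3 by auto

lemma std_mult: "r \<in> carrier R \<Longrightarrow> s \<in> carrier R \<Longrightarrow> params_mult m T n ko std (E r) (E s) = E (r \<otimes> s)"
  unfolding std_frame by (rule standard_mult)

lemma std_corner: "k < q \<Longrightarrow> std (0, n - 1, k) = E (\<sigma> k)"
  using n3 by (intro std_elem) auto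

lemma tri_word_std:
  assumes "\<And>i j. i < j \<Longrightarrow> j < n \<Longrightarrow> r i j \<in> carrier R" "\<And>k. k < n \<Longrightarrow> \<kappa> k \<in> unit_indices"
    "\<And>i j. i < j \<Longrightarrow> j < n \<Longrightarrow> x (i, j) = elem i j (r i j)"
  shows "tri_word T n (\<lambda>i. std (i, i, \<kappa> i)) x \<in> carrier T"
    "\<And>k l. k < n \<Longrightarrow> l < n \<Longrightarrow> tri_word T n (\<lambda>i. std (i, i, \<kappa> i)) x $$ (k, l) =
      (if k = l then \<sigma> (\<kappa> k) else if k < l then \<sigma> (\<kappa> k) \<otimes> r k l else \<zero>)"
proof -
  have u: "\<sigma> (\<kappa> k) \<in> Units R" if "k < n" for k using assms(2)[OF that] by (simp add: unit_indices_def)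
  have eq: "tri_word T n (\<lambda>i. std (i, i, \<kappa> i)) x = tri_word M n (\<lambda>k. diag k (\<sigma> (\<kappa> k))) (\<lambda>(i, j). elem i j (r i j))"
    unfolding tri_word_T by (rule tri_word_cong) (use assms std_diag in auto)
  note entries = tri_word_entry[of r "\<lambda>k. \<sigma> (\<kappa> k)", OF assms(1) u]
  interpret M: monoid M by (rule monoid_M)
  show "tri_word T n (\<lambda>i. std (i, i, \<kappa> i)) x $$ (k, l) =
      (if k = l then \<sigma> (\<kappa> k) else if k < l then \<sigma> (\<kappa> k) \<otimes> r k l else \<zero>)" if "k < n" "l < n" for k l
    unfolding eq by (rule entries(2)) (use that in auto)
  show "tri_word T n (\<lambda>i. std (i, i, \<kappa> i)) x \<in> carrier T"
    unfolding eq carrier_T using entries u by auto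
qed

lemma coord_mat_std:
  "coord_mat m T n ko std c \<longleftrightarrow> (\<exists>A\<in>carrier T. \<forall>i<n. \<forall>j<n. c (i, j) = E (A $$ (i, j)))"
proof
  assume c: "coord_mat m T n ko std c"
  define A where "A = mat n n (\<lambda>(i, j). SOME r. r \<in> carrier R \<and> c (i, j) = E r)"
  have A: "A $$ (i, j) \<in> carrier R \<and> c (i, j) = E (A $$ (i, j))" if "i < n" "j < n" for i j
  proof -
    have "\<exists>r. r \<in> carrier R \<and> c (i, j) = E r"
    proof -
      have "\<forall>i\<in>{..<n}. \<forall>j\<in>{..<n}. c (i, j) \<in> E ` carrier R"
        using c unfolding coord_mat_def corner_T by (elim conjE)
      then have "c (i, j) \<in> E ` carrier R" using that by simp
      then show ?thesis by blast
    qed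
    from someI_ex[OF this] show ?thesis using that by (simp add: A_def)
  qed
  have "A $$ (i, j) = \<zero>" if "i < n" "j < i" for i j
  proof -
    have "\<forall>i\<in>{..<n}. \<forall>j\<in>{..<i}. c (i, j) = \<one>\<^bsub>T\<^esub>" using c unfolding coord_mat_def by (elim conjE)
    then have "c (i, j) = E \<zero>" unfolding elem_zero_T using that by simp
    moreover have "c (i, j) = E (A $$ (i, j))" using A[of i j] that by linarith
    ultimately show ?thesis by (metis E_inj)
  qed
  moreover have "A $$ (i, i) \<in> Units R" if i: "i < n" for i
  proof -
    have "\<forall>i\<in>{..<n}. \<exists>y\<in>carrier T. y \<in> corner m T \<and>
        params_mult m T n ko std (c (i, i)) y = corner_one T (std (0, 1, ko)) (std (1, n - 1, ko))"
      using c unfolding coord_mat_def by (elim conjE)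
    then have "\<exists>y\<in>carrier T. y \<in> corner m T \<and>
        params_mult m T n ko std (c (i, i)) y = corner_one T (std (0, 1, ko)) (std (1, n - 1, ko))"
      by (rule bspec) (use i in simp)
    then obtain y where "y \<in> corner m T" "params_mult m T n ko std (c (i, i)) y = E \<one>"
      unfolding std_frame standard_frame(2) by (elim bexE conjE)
    then obtain s where s: "s \<in> carrier R" "params_mult m T n ko std (c (i, i)) (E s) = E \<one>"
      unfolding corner_T by blast
    have Aii: "A $$ (i, i) \<in> carrier R" "c (i, i) = E (A $$ (i, i))" using A[OF i i] by auto
    have "E (A $$ (i, i) \<otimes> s) = E \<one>" using std_mult[OF Aii(1) s(1)] s(2) unfolding Aii(2) by simp
    then have "A $$ (i, i) \<otimes> s = \<one>" by (rule E_inj)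
    then show ?thesis using Aii(1) s(1) by (auto simp: Units_def m_comm intro!: bexI[of _ s])
  qed
  moreover have "A \<in> carrier M"
    unfolding carrier_M
  proof (intro conjI allI impI)
    show "A \<in> carrier_mat n n" unfolding A_def by simp
  qed (use A in blast)
  ultimately have "A \<in> carrier T" unfolding carrier_T by blast
  then show "\<exists>A\<in>carrier T. \<forall>i<n. \<forall>j<n. c (i, j) = E (A $$ (i, j))" using A by blast
next
  assume "\<exists>A\<in>carrier T. \<forall>i<n. \<forall>j<n. c (i, j) = E (A $$ (i, j))"
  then obtain A where A: "A \<in> carrier T" and c: "\<And>i j. i < n \<Longrightarrow> j < n \<Longrightarrow> c (i, j) = E (A $$ (i, j))" by blast
  show "coord_mat m T n ko std c"
    unfolding coord_mat_def
  proof (intro conjI ballI)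
    fix i assume "i \<in> {..<n}"
    then have i: "i < n" by simp
    have u: "A $$ (i, i) \<in> Units R" using T_diag A i by simp
    have cl: "A $$ (i, i) \<in> carrier R" "inv (A $$ (i, i)) \<in> carrier R" using u by auto
    show "\<exists>y\<in>carrier T. y \<in> corner m T \<and>
        params_mult m T n ko std (c (i, i)) y = corner_one T (std (0, 1, ko)) (std (1, n - 1, ko))"
    proof (intro bexI conjI)
      show "params_mult m T n ko std (c (i, i)) (E (inv (A $$ (i, i)))) = corner_one T (std (0, 1, ko)) (std (1, n - 1, ko))"
        unfolding c[OF i i] std_mult[OF cl] Units_r_inv[OF u] unfolding std_frame standard_frame(2) ..
    qed (use cl E_T corner_T in blast)+
  next
    fix i j assume "i \<in> {..<n}" "j \<in> {..<n}"
    then show "c (i, j) \<in> corner m T" using c[of i j] T_entry[OF A, of i j] corner_T by simp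
  next
    fix i j assume "i \<in> {..<n}" "j \<in> {..<i}"
    then have "i < n" "j < i" "j < n" by auto
    then show "c (i, j) = \<one>\<^bsub>T\<^esub>" unfolding c[OF \<open>i < n\<close> \<open>j < n\<close>] T_upper[OF A \<open>i < n\<close> \<open>j < i\<close>]
      by (simp only: elem_zero_T)
  qed
qed

text \<open>From left to right, \<open>root_coord_std\<close> determines the codes and
  \<open>tri_word_std\<close> multiplies out the word. From right to left, every diagonal entry is a
  unit and so occurs among the \<open>\<sigma> k\<close>.\<close>

lemma coord_rel_std:
  assumes c: "coord_mat m T n ko std c"
  shows "coord_rel m T n q ko kn unit_indices std c g \<longleftrightarrow>
    g \<in> carrier T \<and> (\<forall>i<n. \<forall>j<n. c (i, j) = E (g $$ (i, j)))"
proof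
  assume "coord_rel m T n q ko kn unit_indices std c g"
  then obtain \<kappa> x y where \<kappa>: "\<kappa> \<in> {..<n} \<rightarrow>\<^sub>E unit_indices"
    and diag: "\<forall>i\<in>{..<n}. c (i, i) = std (0, n - 1, \<kappa> i)"
    and xy: "\<forall>i\<in>{..<n}. \<forall>j\<in>{i<..<n}. y (i, j) \<in> corner m T \<and> root_elem T n q kn std i j (x (i, j)) \<and>
         root_coord T n ko std i j (x (i, j)) (y (i, j)) \<and>
         c (i, j) = params_mult m T n ko std (std (0, n - 1, \<kappa> i)) (y (i, j))"
    and g: "g = tri_word T n (\<lambda>i. std (i, i, \<kappa> i)) x"
    unfolding coord_rel_def by (elim bexE conjE exE) (rule that; assumption)
  have \<kappa>U: "\<kappa> k \<in> unit_indices" if "k < n" for k using \<kappa> that by auto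
  then have \<kappa>q: "\<kappa> k < q" "\<sigma> (\<kappa> k) \<in> carrier R" if "k < n" for k
    using that \<sigma>_closed unfolding unit_indices_def by auto
  have "\<exists>s. s \<in> carrier R \<and> x (i, j) = elem i j s" if "i < j" "j < n" for i j
    using xy that root_elem_std[OF that, of "x (i, j)"] by auto
  then obtain r where r: "\<And>i j. i < j \<Longrightarrow> j < n \<Longrightarrow> r i j \<in> carrier R"
    "\<And>i j. i < j \<Longrightarrow> j < n \<Longrightarrow> x (i, j) = elem i j (r i j)" by metis
  have cij: "c (i, j) = E (\<sigma> (\<kappa> i) \<otimes> r i j)" if "i < j" "j < n" for i j
  proof -
    have all: "y (i, j) \<in> corner m T \<and> root_elem T n q kn std i j (x (i, j)) \<and>
         root_coord T n ko std i j (x (i, j)) (y (i, j)) \<and>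
         c (i, j) = params_mult m T n ko std (std (0, n - 1, \<kappa> i)) (y (i, j))"
      using xy that by (meson lessThan_iff greaterThanLessThan_iff less_trans)
    then have *: "y (i, j) \<in> carrier T" "root_coord T n ko std i j (elem i j (r i j)) (y (i, j))"
      "c (i, j) = params_mult m T n ko std (std (0, n - 1, \<kappa> i)) (y (i, j))"
      using corner_carrier[of "y (i, j)" m T] unfolding r(2)[OF that] by (elim conjE; simp)+
    then have "y (i, j) = E (r i j)" using root_coord_std[OF that r(1)[OF that]] by blast
    then show ?thesis using *(3) std_corner \<kappa>q[of i] that std_mult r(1)[OF that] by simp
  qed
  have gT: "g \<in> carrier T"
    unfolding g by (rule tri_word_std(1)[where r = r]) (rule r \<kappa>U | assumption)+
  have gw: "g $$ (k, l) = (if k = l then \<sigma> (\<kappa> k) else if k < l then \<sigma> (\<kappa> k) \<otimes> r k l else \<zero>)"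
    if "k < n" "l < n" for k l
    unfolding g by (rule tri_word_std(2)[where r = r]) (rule r \<kappa>U that | assumption)+
  have "c (i, j) = E (g $$ (i, j))" if ij: "i < n" "j < n" for i j
  proof -
    consider "i = j" | "i < j" | "j < i" by linarith
    then show ?thesis
    proof cases
      case 1
      then show ?thesis using gw[OF ij] diag ij std_corner \<kappa>q by simp
    next
      case 2
      then show ?thesis using gw[OF ij] cij ij by simp
    next
      case 3
      then show ?thesis using gw[OF ij] c ij unfolding coord_mat_def by (simp add: elem_zero_T)
    qed
  qed
  then show "g \<in> carrier T \<and> (\<forall>i<n. \<forall>j<n. c (i, j) = E (g $$ (i, j)))" using gT by blast
next
  assume *: "g \<in> carrier T \<and> (\<forall>i<n. \<forall>j<n. c (i, j) = E (g $$ (i, j)))"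
  then have g: "g \<in> carrier T" and cg: "\<And>i j. i < n \<Longrightarrow> j < n \<Longrightarrow> c (i, j) = E (g $$ (i, j))" by auto
  have "\<exists>k. k \<in> unit_indices \<and> \<sigma> k = g $$ (i, i)" if "i < n" for i
    using units_\<sigma>[OF T_diag[OF g that]] T_diag[OF g that] unfolding unit_indices_def by auto
  then obtain \<kappa>0 where \<kappa>0: "\<And>i. i < n \<Longrightarrow> \<kappa>0 i \<in> unit_indices" "\<And>i. i < n \<Longrightarrow> \<sigma> (\<kappa>0 i) = g $$ (i, i)"
    by metis
  define \<kappa> where "\<kappa> = restrict \<kappa>0 {..<n}"
  have \<kappa>: "\<kappa> \<in> {..<n} \<rightarrow>\<^sub>E unit_indices" "\<And>i. i < n \<Longrightarrow> \<kappa> i \<in> unit_indices" "\<And>i. i < n \<Longrightarrow> \<sigma> (\<kappa> i) = g $$ (i, i)"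
    using \<kappa>0 unfolding \<kappa>_def by auto
  have \<kappa>q: "\<kappa> i < q" if "i < n" for i using \<kappa>(2)[OF that] by (simp add: unit_indices_def)
  \<comment> \<open>Dividing row \<open>i\<close> by its diagonal entry gives the unipotent factor
    of \<open>g\<close>.\<close>
  define r where "r i j = inv (g $$ (i, i)) \<otimes> g $$ (i, j)" for i j
  have r: "r i j \<in> carrier R" "g $$ (i, i) \<otimes> r i j = g $$ (i, j)" if "i < j" "j < n" for i j
  proof -
    have u: "g $$ (i, i) \<in> Units R" using T_diag[OF g, of i] that by simp
    have e: "g $$ (i, j) \<in> carrier R" using T_entry[OF g] that by simp
    show "r i j \<in> carrier R" unfolding r_def using u e by simp
    show "g $$ (i, i) \<otimes> r i j = g $$ (i, j)"
      unfolding r_def using u e Units_closed[OF u] by (simp add: m_assoc[symmetric])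
  qed
  define x where "x = (\<lambda>(i, j). if i < j \<and> j < n then elem i j (r i j) else \<one>\<^bsub>T\<^esub>)"
  define y where "y = (\<lambda>(i, j). if i < j \<and> j < n then E (r i j) else \<one>\<^bsub>T\<^esub>)"
  have x: "x (i, j) = elem i j (r i j)" and y: "y (i, j) = E (r i j)" if "i < j" "j < n" for i j
    using that unfolding x_def y_def by auto
  have carr: "x ij \<in> carrier T" "y ij \<in> carrier T" for ij
    using r(1) elem_T E_T unfolding x_def y_def by (auto split: prod.split)
  have word: "g = tri_word T n (\<lambda>i. std (i, i, \<kappa> i)) x"
  proof (rule T_eqI[OF g])
    show "tri_word T n (\<lambda>i. std (i, i, \<kappa> i)) x \<in> carrier T"
      by (rule tri_word_std(1)[where r = r]) (rule r(1) \<kappa>(2) x | assumption)+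
    fix k l assume kl: "k < n" "l < n" "k \<le> l"
    have "tri_word T n (\<lambda>i. std (i, i, \<kappa> i)) x $$ (k, l) =
        (if k = l then \<sigma> (\<kappa> k) else if k < l then \<sigma> (\<kappa> k) \<otimes> r k l else \<zero>)"
      by (rule tri_word_std(2)[where r = r]) (rule r(1) \<kappa>(2) x kl | assumption)+
    then show "g $$ (k, l) = tri_word T n (\<lambda>i. std (i, i, \<kappa> i)) x $$ (k, l)"
      using \<kappa>(3) r(2) kl by auto
  qed
  have diag: "\<forall>i\<in>{..<n}. c (i, i) = std (0, n - 1, \<kappa> i)" using cg std_corner \<kappa>q \<kappa>(3) by auto
  have "\<forall>i\<in>{..<n}. \<forall>j\<in>{i<..<n}. y (i, j) \<in> corner m T \<and> root_elem T n q kn std i j (x (i, j)) \<and>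
         root_coord T n ko std i j (x (i, j)) (y (i, j)) \<and>
         c (i, j) = params_mult m T n ko std (std (0, n - 1, \<kappa> i)) (y (i, j))"
  proof (intro ballI)
    fix i j assume "i \<in> {..<n}" "j \<in> {i<..<n}"
    then have ij: "i < j" "j < n" "i < n" by auto
    have "std (0, n - 1, \<kappa> i) = E (g $$ (i, i))" using std_corner \<kappa>q \<kappa>(3) ij by simp
    then have "params_mult m T n ko std (std (0, n - 1, \<kappa> i)) (y (i, j)) = c (i, j)"
      using std_mult[of "g $$ (i, i)" "r i j"] T_entry[OF g] ij r[OF ij(1,2)] y[OF ij(1,2)] cg[of i j] by simp
    moreover have "y (i, j) \<in> corner m T" using y ij r(1) corner_T by auto
    moreover have "root_elem T n q kn std i j (x (i, j))"
      using root_elem_std[OF ij(1,2)] x[OF ij(1,2)] r(1)[OF ij(1,2)] by auto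
    moreover have "root_coord T n ko std i j (x (i, j)) (y (i, j))"
      using root_coord_std[OF ij(1,2) r(1)[OF ij(1,2)] carr(2)[of "(i, j)"]] x[OF ij(1,2)] y[OF ij(1,2)] by simp
    ultimately show "y (i, j) \<in> corner m T \<and> root_elem T n q kn std i j (x (i, j)) \<and>
         root_coord T n ko std i j (x (i, j)) (y (i, j)) \<and>
         c (i, j) = params_mult m T n ko std (std (0, n - 1, \<kappa> i)) (y (i, j))" by simp
  qed
  then show "coord_rel m T n q ko kn unit_indices std c g"
    unfolding coord_rel_def using \<kappa>(1) diag carr word by blast
qed

lemma coord_prod_std:
  assumes A: "A \<in> carrier T" "\<And>i j. i < n \<Longrightarrow> j < n \<Longrightarrow> c (i, j) = E (A $$ (i, j))"
    and B: "B \<in> carrier T" "\<And>i j. i < n \<Longrightarrow> j < n \<Longrightarrow> d (i, j) = E (B $$ (i, j))"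
    and ij: "i < n" "j < n"
  shows "coord_prod m T n ko std c d (i, j) = E ((A \<otimes>\<^bsub>T\<^esub> B) $$ (i, j))"
proof -
  let ?f = "\<lambda>k. A $$ (i, k) \<otimes> B $$ (k, j)"
  have f: "?f k \<in> carrier R" if "k < n" for k using T_entry[OF A(1)] T_entry[OF B(1)] ij that by simp
  have loop: "foldr (\<lambda>k. mult T (params_mult m T n ko std (c (i, k)) (d (k, j)))) xs \<one>\<^bsub>T\<^esub> = E (foldr (\<lambda>k. add R (?f k)) xs \<zero>)
      \<and> foldr (\<lambda>k. add R (?f k)) xs \<zero> \<in> carrier R"
    if "set xs \<subseteq> {..<n}" for xs
    using that
  proof (induction xs)
    case Nil
    show ?case by (simp add: elem_zero_T)
  next
    case (Cons k xs)
    then have k: "k < n" by simp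
    have "params_mult m T n ko std (c (i, k)) (d (k, j)) = E (?f k)"
      using A(2)[OF ij(1) k] B(2)[OF k ij(2)] std_mult T_entry[OF A(1)] T_entry[OF B(1)] ij k by simp
    then show ?case using Cons f[OF k] E_mult by simp
  qed
  have "set [0..<n] \<subseteq> {..<n}" by auto
  from loop[OF this] have "coord_prod m T n ko std c d (i, j) = E (foldr (\<lambda>k. add R (?f k)) [0..<n] \<zero>)"
    unfolding coord_prod_def prod.case by (rule conjunct1)
  also have "foldr (\<lambda>k. add R (?f k)) [0..<n] \<zero> = (\<Oplus>k\<in>{..<n}. ?f k)"
    using foldr_add_eq_finsum[of "[0..<n]" ?f] f by (auto simp: atLeast0LessThan)
  also have "\<dots> = (A \<otimes>\<^bsub>T\<^esub> B) $$ (i, j)" unfolding mult_T mult_entry[OF ij] ..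
  finally show ?thesis .
qed

text \<open>For the standard parameters the codes are \<open>E\<close> of the matrix entries, so
  every clause reduces to a fact about matrices.\<close>

lemma coordinatized_std: "coordinatized m T n q ko kn unit_indices std"
  unfolding coordinatized_def
proof (intro conjI allI impI ballI)
  show "corner_frame m T (std (0, 1, ko)) (std (1, n - 1, ko))"
    "corner_ring_axioms m T (std (0, 1, ko)) (std (1, n - 1, ko))"
    unfolding std_frame by (rule standard_frame standard_ring_axioms)+
next
  fix c assume c: "coord_mat m T n ko std c"
  then obtain A where "A \<in> carrier T" "\<forall>i<n. \<forall>j<n. c (i, j) = E (A $$ (i, j))" unfolding coord_mat_std by blast
  then show "\<exists>g\<in>carrier T. coord_rel m T n q ko kn unit_indices std c g" unfolding coord_rel_std[OF c] by blast
next
  fix g assume g: "g \<in> carrier T"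
  define c where "c = (\<lambda>(i, j). if i < n \<and> j < n then E (g $$ (i, j)) else \<one>\<^bsub>T\<^esub>)"
  have c: "coord_mat m T n ko std c" unfolding coord_mat_std using g by (intro bexI[of _ g]) (auto simp: c_def)
  have "coord_rel m T n q ko kn unit_indices std c g" unfolding coord_rel_std[OF c] using g by (auto simp: c_def)
  moreover have "\<forall>ij. c ij \<in> carrier T" using T_entry[OF g] E_T by (auto simp: c_def)
  ultimately show "\<exists>c. (\<forall>ij. c ij \<in> carrier T) \<and> coord_mat m T n ko std c \<and> coord_rel m T n q ko kn unit_indices std c g"
    using c by blast
next
  fix c d g h
  assume "coord_mat m T n ko std c \<and> coord_mat m T n ko std d \<and>
     coord_rel m T n q ko kn unit_indices std c g \<and> coord_rel m T n q ko kn unit_indices std d h"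
  then have g: "g \<in> carrier T" "\<And>i j. i < n \<Longrightarrow> j < n \<Longrightarrow> c (i, j) = E (g $$ (i, j))"
    and h: "h \<in> carrier T" "\<And>i j. i < n \<Longrightarrow> j < n \<Longrightarrow> d (i, j) = E (h $$ (i, j))"
    using coord_rel_std[of c g] coord_rel_std[of d h] by auto
  show "g = h \<longleftrightarrow> (\<forall>i\<in>{..<n}. \<forall>j\<in>{..<n}. c (i, j) = d (i, j))"
  proof
    assume eq: "\<forall>i\<in>{..<n}. \<forall>j\<in>{..<n}. c (i, j) = d (i, j)"
    show "g = h"
    proof (rule T_eqI[OF g(1) h(1)])
      fix i j assume "i < n" "j < n"
      then show "g $$ (i, j) = h $$ (i, j)" using eq g(2) h(2) E_inj by (metis lessThan_iff)
    qed
  qed (use g h in auto)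
  fix f gh assume gh: "gh = g \<otimes>\<^bsub>T\<^esub> h" and f: "\<forall>i\<in>{..<n}. \<forall>j\<in>{..<n}. f (i, j) = coord_prod m T n ko std c d (i, j)"
  have fe: "f (i, j) = E (gh $$ (i, j))" if "i < n" "j < n" for i j
    using f coord_prod_std[of g c h d, OF g h that] that gh by auto
  have ghT: "gh \<in> carrier T" using gh g h by simp
  have "coord_mat m T n ko std f" unfolding coord_mat_std using fe ghT by blast
  from coord_rel_std[OF this] show "coord_rel m T n q ko kn unit_indices std f gh" using fe ghT by blast
qed

end


section \<open>Rings of integers\<close>

context cring
begin

abbreviation int_mult :: "int \<Rightarrow> 'a \<Rightarrow> 'a" where
  "int_mult c x \<equiv> add_pow R c x"

lemma int_mult_0: "int_mult 0 x = \<zero>"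
  by (simp add: add_pow_int_ge)

lemma int_mult_1: "x \<in> carrier R \<Longrightarrow> int_mult 1 x = x"
  by (simp add: add_pow_int_ge)

fun int_span :: "'a list \<Rightarrow> 'a set" where
  "int_span [] = {\<zero>}"
| "int_span (v # vs) = {int_mult c v \<oplus> y | (c::int) y. y \<in> int_span vs}"

lemma int_span_in_carrier: "set vs \<subseteq> carrier R \<Longrightarrow> int_span vs \<subseteq> carrier R"
  by (induction vs) auto

lemma additive_subgroup_int_pow:
  assumes "additive_subgroup S R" "x \<in> S"
  shows "int_mult c x \<in> S"
  using add.subgroup_int_pow_closed assms unfolding additive_subgroup_def by blast

lemma additive_subgroupI:
  assumes "S \<subseteq> carrier R" "\<zero> \<in> S" "\<And>x y. x \<in> S \<Longrightarrow> y \<in> S \<Longrightarrow> x \<oplus> y \<in> S"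
    "\<And>x. x \<in> S \<Longrightarrow> \<ominus> x \<in> S"
  shows "additive_subgroup S R"
  unfolding additive_subgroup_def
  by (rule add.subgroupI) (use assms in \<open>auto simp: a_inv_def\<close>)

lemma additive_subgroup_int_span:
  assumes "set vs \<subseteq> carrier R"
  shows "additive_subgroup (int_span vs) R"
  using assms
proof (induction vs)
  case Nil
  then show ?case by (intro additive_subgroupI) auto
next
  case (Cons v vs)
  then interpret V: additive_subgroup "int_span vs" R by simp
  have v: "v \<in> carrier R" and sub: "int_span vs \<subseteq> carrier R"
    using Cons.prems int_span_in_carrier by auto
  show ?case
  proof (rule additive_subgroupI)
    show "int_span (v # vs) \<subseteq> carrier R" using Cons.prems by (rule int_span_in_carrier)
    show "\<zero> \<in> int_span (v # vs)"
      using v V.zero_closed by (auto intro!: exI[of _ "0::int"] exI[of _ \<zero>] simp: int_mult_0)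
  next
    fix x y assume "x \<in> int_span (v # vs)" "y \<in> int_span (v # vs)"
    then obtain c d a b where "x = int_mult c v \<oplus> a" "y = int_mult d v \<oplus> b"
      and ab: "a \<in> int_span vs" "b \<in> int_span vs" by auto
    then have "x \<oplus> y = int_mult (c + d) v \<oplus> (a \<oplus> b)"
      using v sub by (auto simp: add.int_pow_mult a_ac subset_iff)
    then show "x \<oplus> y \<in> int_span (v # vs)" using ab by auto
  next
    fix x assume "x \<in> int_span (v # vs)"
    then obtain c a where x: "x = int_mult c v \<oplus> a" and a: "a \<in> int_span vs" by auto
    then have "\<ominus> x = int_mult (- c) v \<oplus> \<ominus> a"
      using v sub by (auto simp: add.int_pow_neg minus_add subset_iff)
    then show "\<ominus> x \<in> int_span (v # vs)" using a by auto
  qed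
qed

lemma int_span_superset: "set vs \<subseteq> carrier R \<Longrightarrow> set vs \<subseteq> int_span vs"
proof (induction vs)
  case (Cons v vs)
  then interpret V: additive_subgroup "int_span vs" R
    using additive_subgroup_int_span[of vs] by simp
  have v: "v \<in> carrier R" using Cons.prems by simp
  have "v \<in> int_span (v # vs)"
    using v V.zero_closed by (auto intro!: exI[of _ "1::int"] exI[of _ \<zero>] simp: int_mult_1)
  moreover have "x \<in> int_span (v # vs)" if "x \<in> int_span vs" for x
    using v that V.a_Hcarr by (auto intro!: exI[of _ "0::int"] exI[of _ x] simp: int_mult_0)
  ultimately show ?case using Cons by auto
qed simp

lemma int_span_minimal:
  assumes "additive_subgroup S R" "set vs \<subseteq> S"
  shows "int_span vs \<subseteq> S"
  using assms(2)
proof (induction vs)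
  case Nil
  then show ?case using additive_subgroup.zero_closed[OF assms(1)] by auto
next
  case (Cons v vs)
  then show ?case
    using additive_subgroup.a_closed[OF assms(1)] additive_subgroup_int_pow[OF assms(1)] by auto
qed

lemma int_span_mult:
  assumes "set vs \<subseteq> carrier R" "additive_subgroup S R" "w \<in> carrier R" "\<And>v. v \<in> set vs \<Longrightarrow> w \<otimes> v \<in> S"
    "z \<in> int_span vs"
  shows "w \<otimes> z \<in> S"
proof -
  interpret S: additive_subgroup S R by (rule assms(2))
  have "additive_subgroup {z \<in> carrier R. w \<otimes> z \<in> S} R"
    by (rule additive_subgroupI) (use assms(3) S.a_inv_closed in \<open>auto simp: r_distr r_minus\<close>)
  then show ?thesis using int_span_minimal[of _ vs] assms by blast
qed

text \<open>The least positive \<open>d\<close> in the union divides every member of every set of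
  the chain: the remainder of a later member modulo \<open>d\<close> is again a member and smaller
  than \<open>d\<close>. So the chain stops where \<open>d\<close> first appears.\<close>

lemma int_ideal_chain:
  fixes I :: "nat \<Rightarrow> int set"
  assumes add: "\<And>k x y. x \<in> I k \<Longrightarrow> y \<in> I k \<Longrightarrow> x + y \<in> I k"
    and mult: "\<And>k x c. x \<in> I k \<Longrightarrow> c * x \<in> I k"
    and mono: "\<And>k l. k \<le> l \<Longrightarrow> I k \<subseteq> I l"
  shows "\<exists>N. \<forall>k\<ge>N. I k \<subseteq> I N"
proof (cases "\<exists>k x. x \<in> I k \<and> x \<noteq> 0")
  case False
  then have "I k \<subseteq> {0}" for k by auto
  show ?thesis
  proof (cases "\<exists>k. 0 \<in> I k")
    case True
    then obtain k where "0 \<in> I k" by blast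
    then show ?thesis using \<open>\<And>k. I k \<subseteq> {0}\<close> by (intro exI[of _ k]) blast
  qed (use \<open>\<And>k. I k \<subseteq> {0}\<close> in blast)
next
  case True
  then obtain k x where kx: "x \<in> I k" "x \<noteq> 0" by blast
  have "(if x < 0 then (-1) * x else x) \<in> I k" using mult[OF kx(1), of "-1"] kx(1) by auto
  then have "\<exists>d>0. \<exists>k. int d \<in> I k"
    using kx by (intro exI[of _ "nat \<bar>x\<bar>"] conjI exI[of _ k]) (auto split: if_splits simp: abs_if)
  define d where "d = (LEAST d. d > 0 \<and> (\<exists>k. int d \<in> I k))"
  have d: "d > 0 \<and> (\<exists>k. int d \<in> I k)" unfolding d_def by (rule LeastI_ex) fact
  then obtain N where N: "int d \<in> I N" by blast
  have least: "d \<le> e" if "e > 0" "int e \<in> I k" for e k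
    unfolding d_def using that by (intro Least_le) blast
  have "I k \<subseteq> I N" if "N \<le> k" for k
  proof
    fix x assume x: "x \<in> I k"
    have "(- (x div int d)) * int d \<in> I k" using mult N mono[OF that] by blast
    from add[OF x this] have m: "x mod int d \<in> I k"
      by (simp add: minus_div_mult_eq_mod[symmetric])
    have "x mod int d = 0"
    proof (rule ccontr)
      assume "x mod int d \<noteq> 0"
      moreover have "0 \<le> x mod int d" "x mod int d < int d" using d by auto
      ultimately show False using least[of "nat (x mod int d)" k] m by auto
    qed
    then have "x = (x div int d) * int d" by (metis add.right_neutral div_mult_mod_eq)
    then show "x \<in> I N" using mult[OF N] by metis
  qed
  then show ?thesis by blast
qed

text \<open>The Noetherian property, by induction on the generators: a subgroup of the span is
  controlled by its coefficients at \<open>v\<close> and by its intersection with the span of the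
  remaining generators.\<close>

lemma int_span_chain:
  fixes S :: "nat \<Rightarrow> 'a set"
  assumes "set vs \<subseteq> carrier R" "\<And>k. additive_subgroup (S k) R" "\<And>k l. k \<le> l \<Longrightarrow> S k \<subseteq> S l"
    "\<And>k. S k \<subseteq> int_span vs"
  shows "\<exists>N. \<forall>k\<ge>N. S k \<subseteq> S N"
  using assms
proof (induction vs arbitrary: S)
  case Nil
  have "S k = {\<zero>}" for k
    using Nil(4)[of k] additive_subgroup.zero_closed[OF Nil(2), of k] by auto
  then show ?case by auto
next
  case (Cons v vs)
  have v: "v \<in> carrier R" and vs: "set vs \<subseteq> carrier R" using Cons.prems(1) by auto
  note sg = Cons.prems(2)
  note sp = additive_subgroup_int_span[OF vs]
  have carr: "x \<in> carrier R" if "x \<in> int_span vs" for x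
    using that int_span_in_carrier[OF vs] by blast
  \<comment> \<open>The generators may be dependent, so all coefficients that occur in some
    representation are collected.\<close>
  define I where "I k = {c::int. \<exists>y\<in>int_span vs. int_mult c v \<oplus> y \<in> S k}" for k
  have "\<exists>N. \<forall>k\<ge>N. I k \<subseteq> I N"
  proof (rule int_ideal_chain[of I])
    fix k x y assume "x \<in> I k" "y \<in> I k"
    then obtain a b where ab: "a \<in> int_span vs" "b \<in> int_span vs"
      "int_mult x v \<oplus> a \<in> S k" "int_mult y v \<oplus> b \<in> S k" unfolding I_def by blast
    have "(int_mult x v \<oplus> a) \<oplus> (int_mult y v \<oplus> b) = int_mult (x + y) v \<oplus> (a \<oplus> b)"
      using v ab carr by (simp add: add.int_pow_mult a_ac)
    then have "int_mult (x + y) v \<oplus> (a \<oplus> b) \<in> S k"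
      using additive_subgroup.a_closed[OF sg ab(3,4)] by simp
    then show "x + y \<in> I k"
      unfolding I_def using additive_subgroup.a_closed[OF sp ab(1,2)] by blast
  next
    fix k x c assume "x \<in> I k"
    then obtain a where a: "a \<in> int_span vs" "int_mult x v \<oplus> a \<in> S k" unfolding I_def by blast
    have "int_mult c (int_mult x v \<oplus> a) = int_mult (c * x) v \<oplus> int_mult c a"
      using v a carr by (simp add: add.int_pow_distrib add.int_pow_pow mult.commute)
    then have "int_mult (c * x) v \<oplus> int_mult c a \<in> S k"
      using additive_subgroup_int_pow[OF sg a(2), of c] by simp
    then show "c * x \<in> I k"
      unfolding I_def using additive_subgroup_int_pow[OF sp a(1)] by blast
  qed (use Cons.prems(3) in \<open>auto simp: I_def\<close>)
  then obtain N1 where N1: "\<And>k. k \<ge> N1 \<Longrightarrow> I k \<subseteq> I N1" by blast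
  have "\<exists>N. \<forall>k\<ge>N. S k \<inter> int_span vs \<subseteq> S N \<inter> int_span vs"
  proof (rule Cons.IH[OF vs])
    show "additive_subgroup (S k \<inter> int_span vs) R" for k
      using sg[of k] sp unfolding additive_subgroup_def by (rule add.subgroups_Inter_pair)
  qed (use Cons.prems(3) in auto)
  then obtain N2 where N2: "\<And>k. k \<ge> N2 \<Longrightarrow> S k \<inter> int_span vs \<subseteq> S N2" by blast
  define N where "N = max N1 N2"
  have "S k \<subseteq> S N" if k: "N \<le> k" for k
  proof
    fix s assume s: "s \<in> S k"
    then obtain c y where cy: "s = int_mult c v \<oplus> y" "y \<in> int_span vs"
      using Cons.prems(4)[of k] by auto
    then have "c \<in> I k" using s unfolding I_def by blast
    then have "c \<in> I N1" using N1[of k] k unfolding N_def by auto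
    then obtain z where z: "z \<in> int_span vs" "int_mult c v \<oplus> z \<in> S N1" unfolding I_def by blast
    then have zN: "int_mult c v \<oplus> z \<in> S N" using Cons.prems(3)[of N1 N] unfolding N_def by auto
    then have zk: "int_mult c v \<oplus> z \<in> S k" using Cons.prems(3)[OF k] by blast
    \<comment> \<open>Two members with the same coefficient at \<open>v\<close> differ by an element
      of the smaller span, where the second bound applies.\<close>
    have eq: "s \<ominus> (int_mult c v \<oplus> z) = y \<ominus> z"
      using v cy z carr by (simp add: a_minus_def minus_add a_ac r_neg r_neg1 r_neg2)
    have "s \<ominus> (int_mult c v \<oplus> z) \<in> S k"
      unfolding a_minus_def
      by (intro additive_subgroup.a_closed[OF sg] s additive_subgroup.a_inv_closed[OF sg] zk)
    moreover have "y \<ominus> z \<in> int_span vs"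
      unfolding a_minus_def
      by (intro additive_subgroup.a_closed[OF sp] cy z additive_subgroup.a_inv_closed[OF sp])
    ultimately have "y \<ominus> z \<in> S N2" using N2[of k] k unfolding eq N_def by auto
    then have "y \<ominus> z \<in> S N" using Cons.prems(3)[of N2 N] unfolding N_def by auto
    from additive_subgroup.a_closed[OF sg zN this]
    show "s \<in> S N" using v cy z carr by (simp add: a_minus_def a_ac r_neg r_neg1 r_neg2)
  qed
  then show ?case by blast
qed

section \<open>Integral elements form a ring\<close>

abbreviation "int_multiples \<equiv> range (\<lambda>k. int_mult k \<one>)"

text \<open>Powers are listed in decreasing order because coefficient lists start with the leading
  one. The lists have fixed length \<open>k\<close> and may begin with zeros.\<close>

lemma int_span_powers_iff_eval:
  assumes "x \<in> carrier R"
  shows "z \<in> int_span (map (\<lambda>i. x [^] i) (rev [0..<k])) \<longleftrightarrow>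
    (\<exists>q. length q = k \<and> set q \<subseteq> int_multiples \<and> eval q x = z)"
proof (induction k arbitrary: z)
  case (Suc k)
  have pow: "(int_mult c \<one>) \<otimes> x [^] k = int_mult c (x [^] k)" for c
    using assms by (simp add: add_pow_ldistr_int)
  show ?case
  proof
    assume "z \<in> int_span (map (\<lambda>i. x [^] i) (rev [0..<Suc k]))"
    then obtain c y where cy: "z = int_mult c (x [^] k) \<oplus> y"
      "y \<in> int_span (map (\<lambda>i. x [^] i) (rev [0..<k]))" by auto
    then obtain q where "length q = k" "set q \<subseteq> int_multiples" "eval q x = y" using Suc by blast
    then show "\<exists>q. length q = Suc k \<and> set q \<subseteq> int_multiples \<and> eval q x = z"
      using cy pow by (intro exI[of _ "int_mult c \<one> # q"]) auto
  next
    assume "\<exists>q. length q = Suc k \<and> set q \<subseteq> int_multiples \<and> eval q x = z"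
    then obtain a q where "length q = k" "set (a # q) \<subseteq> int_multiples" "eval (a # q) x = z"
      by (metis length_Suc_conv)
    then show "z \<in> int_span (map (\<lambda>i. x [^] i) (rev [0..<Suc k]))"
      using pow Suc[of "eval q x"] by fastforce
  qed
qed auto

text \<open>Moving the leading power to the other side turns a monic equation of degree
  \<open>k\<close> into membership of \<open>x [^] k\<close> in the span of the lower
  powers.\<close>

lemma integral_over_int_iff:
  assumes "x \<in> carrier R" "\<one> \<noteq> \<zero>"
  shows "integral_over_int R x \<longleftrightarrow> (\<exists>k. x [^] (k::nat) \<in> int_span (map (\<lambda>i. x [^] i) (rev [0..<k])))"
proof
  assume "integral_over_int R x"
  then obtain p where p: "p \<in> carrier (univ_poly R int_multiples)" "p \<noteq> []" "hd p = \<one>" "eval p x = \<zero>"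
    unfolding integral_over_int_def by blast
  then obtain q where "p = \<one> # q" by (cases p) auto
  then have q: "set q \<subseteq> int_multiples" "eval (\<one> # q) x = \<zero>"
    using p by (simp_all add: univ_poly_def polynomial_def)
  let ?k = "length q"
  let ?S = "int_span (map (\<lambda>i. x [^] i) (rev [0..<?k]))"
  have S: "additive_subgroup ?S R" by (rule additive_subgroup_int_span) (use assms in auto)
  have e: "eval q x \<in> ?S" using int_span_powers_iff_eval[OF assms(1)] q(1) by blast
  then have "eval q x \<in> carrier R" using additive_subgroup.a_Hcarr[OF S] by blast
  then have "x [^] ?k = \<ominus> eval q x" using q(2) assms by (simp add: sum_zero_eq_neg)
  then have "x [^] ?k \<in> ?S" using additive_subgroup.a_inv_closed[OF S e] by simp
  then show "\<exists>k. x [^] (k::nat) \<in> int_span (map (\<lambda>i. x [^] i) (rev [0..<k]))" by blast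
next
  assume "\<exists>k. x [^] (k::nat) \<in> int_span (map (\<lambda>i. x [^] i) (rev [0..<k]))"
  then obtain k :: nat where k: "x [^] k \<in> int_span (map (\<lambda>i. x [^] i) (rev [0..<k]))" by blast
  have S: "additive_subgroup (int_span (map (\<lambda>i. x [^] i) (rev [0..<k]))) R"
    by (rule additive_subgroup_int_span) (use assms in auto)
  obtain q where q: "length q = k" "set q \<subseteq> int_multiples" "eval q x = \<ominus> (x [^] k)"
    using additive_subgroup.a_inv_closed[OF S k] int_span_powers_iff_eval[OF assms(1)] by blast
  have "\<one> \<in> int_multiples" by (auto intro!: image_eqI[of _ _ 1] simp: int_mult_1)
  then have "\<one> # q \<in> carrier (univ_poly R int_multiples)"
    using q assms(2) by (auto simp: univ_poly_def polynomial_def)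
  moreover have "eval (\<one> # q) x = \<zero>" using q assms(1) by (simp add: r_neg)
  ultimately show "integral_over_int R x" unfolding integral_over_int_def by force
qed

text \<open>All powers of \<open>w\<close> lie in \<open>int_span vs\<close>, because 1 does. The
  spans of the first \<open>k\<close> powers form an ascending chain there, and once the chain
  stops, the next power depends on the lower ones.\<close>

lemma integral_over_int_stable:
  assumes "\<one> \<noteq> \<zero>" "set vs \<subseteq> carrier R" "\<one> \<in> int_span vs" "w \<in> carrier R"
    and stable: "\<And>z. z \<in> int_span vs \<Longrightarrow> w \<otimes> z \<in> int_span vs"
  shows "integral_over_int R w"
proof -
  have pow: "w [^] i \<in> int_span vs" for i :: nat
    by (induction i) (use assms stable m_comm in auto)
  let ?S = "\<lambda>k. int_span (map (\<lambda>i. w [^] i) (rev [0..<k]))"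
  have in_carr: "set (map (\<lambda>i. w [^] i) (rev [0..<k])) \<subseteq> carrier R" for k
    using assms(4) by auto
  have mono: "?S k \<subseteq> ?S l" if "k \<le> l" for k l
    by (rule int_span_minimal[OF additive_subgroup_int_span[OF in_carr]])
      (use that in \<open>auto intro!: subsetD[OF int_span_superset[OF in_carr]]\<close>)
  have "\<exists>N. \<forall>k\<ge>N. ?S k \<subseteq> ?S N"
  proof (rule int_span_chain[OF assms(2)])
    show "?S k \<subseteq> int_span vs" for k
      by (rule int_span_minimal[OF additive_subgroup_int_span[OF assms(2)]]) (use pow in auto)
    show "additive_subgroup (?S k) R" for k by (rule additive_subgroup_int_span[OF in_carr])
  qed (fact mono)
  then obtain N where N: "?S (Suc N) \<subseteq> ?S N" by (meson le_SucI order_refl)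
  have "w [^] N \<in> ?S (Suc N)" by (rule subsetD[OF int_span_superset[OF in_carr]]) auto
  then show ?thesis using N integral_over_int_iff[OF assms(4,1)] by blast
qed

text \<open>The monomials \<open>x [^] i \<otimes> y [^] j\<close> with exponents below
  \<open>a\<close> and \<open>b\<close> span a subgroup that is stable under \<open>x\<close> and
  \<open>y\<close>, hence under their sum, product and negatives.\<close>

lemma integral_over_int_closed:
  assumes one: "\<one> \<noteq> \<zero>" and x: "x \<in> carrier R" "integral_over_int R x"
    and y: "y \<in> carrier R" "integral_over_int R y"
  shows "integral_over_int R (x \<oplus> y)" "integral_over_int R (x \<otimes> y)" "integral_over_int R (\<ominus> x)"
proof -
  obtain a where a: "x [^] a \<in> int_span (map (\<lambda>i. x [^] i) (rev [0..<a]))"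
    using x integral_over_int_iff one by blast
  obtain b where b: "y [^] b \<in> int_span (map (\<lambda>i. y [^] i) (rev [0..<b]))"
    using y integral_over_int_iff one by blast
  \<comment> \<open>For exponent 0 the relation would place 1 in the span of the empty list, which
    is zero.\<close>
  have pos: "0 < a" "0 < b"
    using a b one by (auto intro!: Nat.gr0I)
  define vs where "vs = [x [^] i \<otimes> y [^] j. i \<leftarrow> [0..<a], j \<leftarrow> [0..<b]]"
  have set_vs: "set vs = {x [^] i \<otimes> y [^] j | i j. i < a \<and> j < b}"
    unfolding vs_def by (auto; blast)
  have vs: "set vs \<subseteq> carrier R" using set_vs x y by auto
  note sub = additive_subgroup_int_span[OF vs]
  have in_vs: "x [^] i \<otimes> y [^] j \<in> int_span vs" if "i < a" "j < b" for i j
    using that set_vs int_span_superset[OF vs] by blast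
  have sx: "x \<otimes> z \<in> int_span vs" if z: "z \<in> int_span vs" for z
  proof (rule int_span_mult[OF vs sub x(1) _ z])
    fix v assume "v \<in> set vs"
    then obtain i j where ij: "v = x [^] i \<otimes> y [^] j" "i < a" "j < b" using set_vs by blast
    then have v: "x \<otimes> v = x [^] (Suc i) \<otimes> y [^] j" using x y by (simp add: m_ac)
    show "x \<otimes> v \<in> int_span vs"
    proof (cases "Suc i < a")
      case True
      then show ?thesis using v ij in_vs by metis
    next
      case False
      \<comment> \<open>At the top exponent, the relation for \<open>x [^] a\<close> leads back to
        lower powers.\<close>
      then have "Suc i = a" using ij by simp
      moreover have "y [^] j \<otimes> x [^] a \<in> int_span vs"
        by (rule int_span_mult[OF _ sub _ _ a]) (use x y in_vs ij in \<open>auto simp: m_comm\<close>)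
      ultimately show ?thesis using v x y by (simp add: m_comm)
    qed
  qed
  have sy: "y \<otimes> z \<in> int_span vs" if z: "z \<in> int_span vs" for z
  proof (rule int_span_mult[OF vs sub y(1) _ z])
    fix v assume "v \<in> set vs"
    then obtain i j where ij: "v = x [^] i \<otimes> y [^] j" "i < a" "j < b" using set_vs by blast
    then have v: "y \<otimes> v = x [^] i \<otimes> y [^] (Suc j)" using x y by (simp add: m_ac)
    show "y \<otimes> v \<in> int_span vs"
    proof (cases "Suc j < b")
      case True
      then show ?thesis using v ij in_vs by metis
    next
      case False
      then have "Suc j = b" using ij by simp
      moreover have "x [^] i \<otimes> y [^] b \<in> int_span vs"
        by (rule int_span_mult[OF _ sub _ _ b]) (use x y in_vs ij in auto)
      ultimately show ?thesis using v by simp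
    qed
  qed
  have one_in: "\<one> \<in> int_span vs" using in_vs[OF pos] by simp
  have carr: "z \<in> carrier R" if "z \<in> int_span vs" for z
    using that int_span_in_carrier[OF vs] by blast
  note st = integral_over_int_stable[OF one vs one_in]
  show "integral_over_int R (x \<oplus> y)"
    by (rule st) (use x y sx sy carr additive_subgroup.a_closed[OF sub] in \<open>auto simp: l_distr\<close>)
  show "integral_over_int R (x \<otimes> y)"
    by (rule st) (use x y sx sy carr in \<open>auto simp: m_assoc\<close>)
  show "integral_over_int R (\<ominus> x)"
    by (rule st) (use x sx carr additive_subgroup.a_inv_closed[OF sub] in \<open>auto simp: l_minus\<close>)
qed

lemma integral_over_int_one:
  assumes "\<one> \<noteq> \<zero>"
  shows "integral_over_int R \<one>"
proof (rule integral_over_int_stable[OF assms, of "[\<one>]"])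
  have "\<one> \<in> int_span [\<one>]" using int_span_superset[of "[\<one>]"] by simp
  then show "\<one> \<in> int_span [\<one>]" .
  show "\<one> \<otimes> z \<in> int_span [\<one>]" if "z \<in> int_span [\<one>]" for z
    using that int_span_in_carrier[of "[\<one>]"] by auto
qed auto

end

lemma domain_ring_of_integers:
  assumes "field K"
  shows "domain (ring_of_integers K)" "subring (carrier (ring_of_integers K)) K"
proof -
  interpret field K by fact
  show sub: "subring (carrier (ring_of_integers K)) K"
    unfolding ring_of_integers_def
    by (rule subringI) (auto simp: integral_over_int_closed integral_over_int_one)
  have "ring_of_integers K = K\<lparr>carrier := carrier (ring_of_integers K)\<rparr>"
    by (simp add: ring_of_integers_def)
  then show "domain (ring_of_integers K)"
    using subdomainI'[OF sub] subdomain_is_domain by metis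
qed


section \<open>Finiteness of the ring of integers modulo 2\<close>

context cring
begin

fun int_comb :: "int list \<Rightarrow> 'a list \<Rightarrow> 'a" where
  "int_comb (c # cs) (v # vs) = int_mult c v \<oplus> int_comb cs vs"
| "int_comb _ _ = \<zero>"

lemma int_comb_closed:
  "additive_subgroup S R \<Longrightarrow> set vs \<subseteq> S \<Longrightarrow> int_comb cs vs \<in> S"
  by (induction cs vs rule: int_comb.induct)
    (auto intro: additive_subgroup.a_closed additive_subgroup.zero_closed additive_subgroup_int_pow)

lemma additive_subgroup_carrier: "additive_subgroup (carrier R) R"
  by (rule additive_subgroupI) auto

lemma int_comb_carrier [simp]: "set vs \<subseteq> carrier R \<Longrightarrow> int_comb cs vs \<in> carrier R"
  by (rule int_comb_closed[OF additive_subgroup_carrier])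

lemma int_comb_mult:
  "set vs \<subseteq> carrier R \<Longrightarrow> int_comb (map ((*) k) cs) vs = int_mult k (int_comb cs vs)"
proof (induction cs vs rule: int_comb.induct)
  case (1 c cs v vs)
  then show ?case
    by (simp add: add.int_pow_distrib add.int_pow_pow mult.commute)
qed (simp_all add: add.int_pow_one)

text \<open>Choosing representatives outside the finitely many classes modulo 2 already generated
  makes the \<open>xs\<close> linearly independent modulo 2.\<close>

lemma independent_mod_2:
  assumes S: "additive_subgroup S R"
    and inf: "\<And>F. finite F \<Longrightarrow> F \<subseteq> S \<Longrightarrow> \<exists>x\<in>S. \<forall>s\<in>F. \<forall>y\<in>S. x \<noteq> s \<oplus> (y \<oplus> y)"
  shows "\<exists>xs. length xs = k \<and> set xs \<subseteq> S \<and>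
    (\<forall>cs. length cs = k \<longrightarrow> (\<exists>y\<in>S. int_comb cs xs = y \<oplus> y) \<longrightarrow> (\<forall>c\<in>set cs. even c))"
proof (induction k)
  case (Suc k)
  interpret S: additive_subgroup S R by (rule S)
  obtain xs where xs: "length xs = k" "set xs \<subseteq> S"
    and even: "\<And>cs. length cs = k \<Longrightarrow> \<exists>y\<in>S. int_comb cs xs = y \<oplus> y \<Longrightarrow> \<forall>c\<in>set cs. even c"
    using Suc by blast
  \<comment> \<open>The combinations with coefficients 0 and 1; up to doubles, they represent all
    combinations of \<open>xs\<close>.\<close>
  define F where "F = (\<lambda>bs. int_comb bs xs) ` {bs. set bs \<subseteq> {0, 1} \<and> length bs = k}"
  have finF: "finite F" unfolding F_def by (intro finite_imageI finite_lists_length_eq) auto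
  have subF: "F \<subseteq> S" unfolding F_def using int_comb_closed[OF S xs(2)] by auto
  obtain x where xS: "x \<in> S" and xF: "\<forall>s\<in>F. \<forall>y\<in>S. x \<noteq> s \<oplus> (y \<oplus> y)"
    using inf[OF finF subF] by (elim bexE)
  have x: "x \<in> S" "\<And>s y. s \<in> F \<Longrightarrow> y \<in> S \<Longrightarrow> x \<noteq> s \<oplus> (y \<oplus> y)"
    using xS xF by auto
  note carr = S.a_Hcarr
  \<comment> \<open>The minus sign is there so that the combination becomes a member of
    \<open>F\<close> once it is moved to the other side of an equation for \<open>x\<close>.\<close>
  have decomp: "\<exists>bs y. set bs \<subseteq> {0, 1} \<and> length bs = length cs \<and> y \<in> S \<and>
      int_comb cs ys = \<ominus> int_comb bs ys \<oplus> (y \<oplus> y)" if "set ys \<subseteq> S" for cs ys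
    using that
  proof (induction cs ys rule: int_comb.induct)
    case (1 c cs v vs)
    then obtain bs y where bs: "set bs \<subseteq> {0, 1}" "length bs = length cs" "y \<in> S"
      "int_comb cs vs = \<ominus> int_comb bs vs \<oplus> (y \<oplus> y)" by auto
    have v: "v \<in> S" and vs: "set vs \<subseteq> S" using 1 by auto
    have cb: "int_comb bs vs \<in> carrier R" using vs carr by (intro int_comb_carrier) auto
    define b where "b = c mod 2"
    \<comment> \<open>\<open>c\<close> and \<open>b\<close> have the same parity, so
      \<open>c = - b + (q + q)\<close>.\<close>
    define q where "q = (c + b) div 2"
    have "c = - b + (q + q)" unfolding q_def b_def by presburger
    then have "int_mult c v = \<ominus> int_mult b v \<oplus> (int_mult q v \<oplus> int_mult q v)"
      using v carr by (metis add.int_pow_mult add.int_pow_neg)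
    then have "int_comb (c # cs) (v # vs) = \<ominus> int_comb (b # bs) (v # vs) \<oplus>
        ((int_mult q v \<oplus> y) \<oplus> (int_mult q v \<oplus> y))"
      using bs v cb carr by (simp add: minus_add a_ac)
    moreover have "int_mult q v \<oplus> y \<in> S" using additive_subgroup_int_pow[OF S v] bs(3) by simp
    moreover have "set (b # bs) \<subseteq> {0, 1}" using bs(1) unfolding b_def by auto
    ultimately show ?case using bs(2) by (intro exI[of _ "b # bs"] exI[of _ "int_mult q v \<oplus> y"]) simp
  next
    case ("2_1" vs)
    then show ?case using S.zero_closed by (intro exI[of _ "[]"] exI[of _ \<zero>]) auto
  next
    case ("2_2" cs)
    have "int_comb bs [] = \<zero>" for bs by (cases bs) auto
    then show ?case using S.zero_closed
      by (intro exI[of _ "replicate (length cs) 0"] exI[of _ \<zero>]) auto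
  qed
  have parity: "even c \<and> (\<forall>c\<in>set cs. even c)"
    if len: "length cs = k" and y: "y \<in> S" "int_comb (c # cs) (x # xs) = y \<oplus> y" for c cs y
  proof -
    have ic: "int_comb cs xs \<in> S" using int_comb_closed[OF S xs(2)] .
    define q where "q = c div 2"
    have qx: "int_mult q x \<in> S" using additive_subgroup_int_pow[OF S x(1)] .
    have rest: "int_mult (c mod 2) x \<oplus> int_comb cs xs = (y \<ominus> int_mult q x) \<oplus> (y \<ominus> int_mult q x)"
    proof -
      have "c = (q + q) + c mod 2" unfolding q_def by presburger
      then have "int_mult c x = (int_mult q x \<oplus> int_mult q x) \<oplus> int_mult (c mod 2) x"
        using x carr by (metis add.int_pow_mult)
      then have yy: "y \<oplus> y = (int_mult q x \<oplus> int_mult q x) \<oplus> (int_mult (c mod 2) x \<oplus> int_comb cs xs)"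
        using y(2) x ic carr by (simp add: a_assoc)
      have "(y \<ominus> int_mult q x) \<oplus> (y \<ominus> int_mult q x) = (y \<oplus> y) \<ominus> (int_mult q x \<oplus> int_mult q x)"
        using y qx carr by (simp add: a_minus_def minus_add a_ac)
      also have "\<dots> = int_mult (c mod 2) x \<oplus> int_comb cs xs"
      proof -
        have "(b \<oplus> a) \<ominus> b = a" if "a \<in> carrier R" "b \<in> carrier R" for a b
          using that by (simp add: a_minus_def a_ac r_neg r_neg1 r_neg2)
        then show ?thesis unfolding yy using x ic carr qx by simp
      qed
      finally show ?thesis by simp
    qed
    have yq: "y \<ominus> int_mult q x \<in> S" using y qx by (simp add: a_minus_def)
    have "even c"
    proof (rule ccontr)
      assume "odd c"
      then have "c mod 2 = 1" by presburger
      then have eq: "x \<oplus> int_comb cs xs = (y \<ominus> int_mult q x) \<oplus> (y \<ominus> int_mult q x)"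
        using rest x carr by (simp add: int_mult_1)
      obtain bs z where bs: "set bs \<subseteq> {0, 1}" "length bs = length cs" "z \<in> S"
        "int_comb cs xs = \<ominus> int_comb bs xs \<oplus> (z \<oplus> z)" using decomp[OF xs(2), of cs] by blast
      define w where "w = y \<ominus> int_mult q x"
      have cb: "int_comb bs xs \<in> S" using int_comb_closed[OF S xs(2)] .
      have "x = x \<oplus> int_comb cs xs \<ominus> int_comb cs xs"
        using x ic carr by (simp add: a_minus_def a_assoc r_neg)
      also have "\<dots> = (w \<oplus> w) \<ominus> (\<ominus> int_comb bs xs \<oplus> (z \<oplus> z))"
        using eq bs(4) unfolding w_def by simp
      also have "\<dots> = int_comb bs xs \<oplus> ((w \<ominus> z) \<oplus> (w \<ominus> z))"
        using cb yq bs(3) carr unfolding w_def[symmetric] by (simp add: a_minus_def minus_add a_ac)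
      finally have "x = int_comb bs xs \<oplus> ((w \<ominus> z) \<oplus> (w \<ominus> z))" .
      moreover have "w \<ominus> z \<in> S" using yq bs(3) unfolding w_def[symmetric] by (simp add: a_minus_def)
      moreover have "int_comb bs xs \<in> F" unfolding F_def using bs len by auto
      ultimately show False using x(2) by blast
    qed
    then have "c mod 2 = 0" by presburger
    then have "int_comb cs xs = (y \<ominus> int_mult q x) \<oplus> (y \<ominus> int_mult q x)"
      using rest ic carr by (simp add: int_mult_0)
    then show ?thesis using even[OF len] yq \<open>even c\<close> by blast
  qed
  then have "\<forall>c\<in>set cs. even c"
    if "length cs = Suc k" "\<exists>y\<in>S. int_comb cs (x # xs) = y \<oplus> y" for cs
  proof -
    from that obtain c ds y where cs: "cs = c # ds" "length ds = k" and "y \<in> S"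
      "int_comb (c # ds) (x # xs) = y \<oplus> y" unfolding length_Suc_conv by blast
    then have "even c \<and> (\<forall>c\<in>set ds. even c)" by (intro parity)
    then show ?thesis using cs by simp
  qed
  then show ?case using xs x(1) by (intro exI[of _ "x # xs"]) simp
qed (auto intro: exI[of _ "[]"])

text \<open>Infinite descent: all coefficients of a relation are even, and because there is no
  2-torsion, halving them gives another relation, with half the sum of absolute values.\<close>

lemma even_int_comb_descent:
  assumes "set xs \<subseteq> carrier R"
    and tf: "\<And>x. x \<in> carrier R \<Longrightarrow> int_mult 2 x = \<zero> \<Longrightarrow> x = \<zero>"
    and even: "\<And>cs. length cs = length xs \<Longrightarrow> int_comb cs xs = \<zero> \<Longrightarrow> \<forall>c\<in>set cs. even c"
    and "length cs = length xs" "int_comb cs xs = \<zero>"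
  shows "set cs \<subseteq> {0}"
  using assms(4,5)
proof (induction "sum_list (map (\<lambda>c. nat \<bar>c\<bar>) cs)" arbitrary: cs rule: less_induct)
  case less
  define ds where "ds = map (\<lambda>c. c div 2) cs"
  have "map ((*) 2) ds = cs"
    unfolding ds_def using even[OF less.prems] by (auto intro!: map_idI)
  then have cs: "cs = map ((*) 2) ds" by simp
  then have "int_mult 2 (int_comb ds xs) = \<zero>" using int_comb_mult[OF assms(1), of 2 ds] less.prems by simp
  then have ds: "int_comb ds xs = \<zero>" using tf assms(1) by simp
  show ?case
  proof (rule ccontr)
    assume "\<not> set cs \<subseteq> {0}"
    then have "\<not> set ds \<subseteq> {0}" using cs by auto
    moreover from this have "0 < sum_list (map (\<lambda>c. nat \<bar>c\<bar>) ds)"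
      by (auto simp: zero_less_iff_neq_zero sum_list_eq_0_iff)
    moreover have "sum_list (map (\<lambda>c. nat \<bar>c\<bar>) cs) = 2 * sum_list (map (\<lambda>c. nat \<bar>c\<bar>) ds)"
      unfolding cs by (induction ds) (auto simp: abs_mult nat_mult_distrib)
    ultimately show False using less.hyps[of ds] less.prems(1) ds by (auto simp: ds_def)
  qed
qed

end

lemma common_denominator: "\<exists>d>0. \<forall>q\<in>set qs. \<exists>c. of_int d * q = (of_int c :: rat)"
proof (induction qs)
  case (Cons q qs)
  then obtain d where d: "d > 0" "\<forall>q\<in>set qs. \<exists>c. of_int d * q = (of_int c :: rat)" by blast
  obtain a b where ab: "quotient_of q = (a, b)" by fastforce
  then have b: "b > 0" "q = of_int a / of_int b"
    using quotient_of_denom_pos quotient_of_div by blast+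
  have "\<exists>c. of_int (b * d) * r = (of_int c :: rat)" if "r \<in> set (q # qs)" for r
  proof (cases "r = q")
    case True
    then show ?thesis using b by (intro exI[of _ "d * a"]) simp
  next
    case False
    then have "r \<in> set qs" using that by simp
    then obtain c where "of_int d * r = (of_int c :: rat)" using d(2) by metis
    then show ?thesis by (intro exI[of _ "b * c"]) (simp add: mult.assoc)
  qed
  then show ?case using b d by (intro exI[of _ "b * d"]) auto
qed (auto intro: exI[of _ 1])

text \<open>If finitely many classes modulo 2 never sufficed, there would be more integral elements
  independent modulo 2 than the degree of the field. They are linearly dependent over the rationals;
  clearing denominators gives an integer relation, and the descent shows that all its coefficients
  vanish.\<close>

lemma number_field_char_0_finite_mod_2:
  assumes "number_field K"
  shows "\<And>m. 0 < (m::nat) \<Longrightarrow> add_pow K m \<one>\<^bsub>K\<^esub> \<noteq> \<zero>\<^bsub>K\<^esub>"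
    and "\<exists>F. finite F \<and> F \<subseteq> carrier (ring_of_integers K) \<and>
      (\<forall>x\<in>carrier (ring_of_integers K). \<exists>s\<in>F. \<exists>y\<in>carrier (ring_of_integers K). x = s \<oplus>\<^bsub>K\<^esub> (y \<oplus>\<^bsub>K\<^esub> y))"
proof -
  interpret field K using assms unfolding number_field_def by blast
  interpret Q: field rat_ring
    by (unfold_locales) (auto simp: Units_def algebra_simps intro: exI[of _ "- _"] right_inverse)
  obtain h where h: "h \<in> ring_hom rat_ring K" and fin: "finite_dimension (range h) (carrier K)"
    using assms unfolding number_field_def by blast
  interpret h: ring_hom_ring rat_ring K h
    using h by (intro ring_hom_ringI2) unfold_locales
  have h_add: "h (a + b) = h a \<oplus>\<^bsub>K\<^esub> h b" and h_mult: "h (a * b) = h a \<otimes>\<^bsub>K\<^esub> h b"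
    and h1: "h 1 = \<one>\<^bsub>K\<^esub>" and h0: "h 0 = \<zero>\<^bsub>K\<^esub>" and h_carr: "h a \<in> carrier K" for a b
    using h.hom_add[of a b] h.hom_mult[of a b] h.hom_one h.hom_zero h.hom_closed[of a] by auto
  have h_nat: "h (of_nat m) = add_pow K m \<one>\<^bsub>K\<^esub>" for m :: nat
    by (induction m) (auto simp: h0 h1 h_add a_comm)
  have h_int: "h (of_int c) = int_mult c \<one>\<^bsub>K\<^esub>" for c
  proof (cases "c \<ge> 0")
    case True
    then show ?thesis using h_nat[of "nat c"] by (simp add: add_pow_int_ge)
  next
    case False
    have "h (of_int c) \<oplus>\<^bsub>K\<^esub> h (of_nat (nat (- c))) = \<zero>\<^bsub>K\<^esub>"
      using False h_add[of "of_int c" "of_nat (nat (- c))"] h0 by simp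
    then show ?thesis using False h_nat[of "nat (- c)"] h_carr
      by (simp add: add_pow_int_lt sum_zero_eq_neg)
  qed
  have h_nz: "h a \<noteq> \<zero>\<^bsub>K\<^esub>" if "a \<noteq> 0" for a
    using h_mult[of a "inverse a"] that h1 h_carr by auto
  show char0: "add_pow K m \<one>\<^bsub>K\<^esub> \<noteq> \<zero>\<^bsub>K\<^esub>" if "0 < m" for m :: nat
    using h_nz[of "of_nat m"] that h_nat by simp
  define I where "I = carrier (ring_of_integers K)"
  have I: "subring I K" using domain_ring_of_integers[OF field_axioms] unfolding I_def by simp
  have addI: "additive_subgroup I K"
    using subringE(1,2,5,7)[OF I] by (intro additive_subgroupI) auto
  have sf: "subfield (range h) K"
    using h.img_is_subfield(2)[OF Q.carrier_is_subfield one_not_zero] by simp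
  obtain d where d: "dimension d (range h) (carrier K)" using fin by blast
  show "\<exists>F. finite F \<and> F \<subseteq> carrier (ring_of_integers K) \<and>
      (\<forall>x\<in>carrier (ring_of_integers K). \<exists>s\<in>F. \<exists>y\<in>carrier (ring_of_integers K). x = s \<oplus>\<^bsub>K\<^esub> (y \<oplus>\<^bsub>K\<^esub> y))"
    unfolding I_def[symmetric]
  proof (rule ccontr)
    assume "\<nexists>F. finite F \<and> F \<subseteq> I \<and> (\<forall>x\<in>I. \<exists>s\<in>F. \<exists>y\<in>I. x = s \<oplus>\<^bsub>K\<^esub> (y \<oplus>\<^bsub>K\<^esub> y))"
    note none = this
    have inf: "\<exists>x\<in>I. \<forall>s\<in>F. \<forall>y\<in>I. x \<noteq> s \<oplus>\<^bsub>K\<^esub> (y \<oplus>\<^bsub>K\<^esub> y)" if F: "finite F" "F \<subseteq> I" for F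
    proof (rule ccontr)
      assume "\<not> ?thesis"
      then have "\<forall>x\<in>I. \<exists>s\<in>F. \<exists>y\<in>I. x = s \<oplus>\<^bsub>K\<^esub> (y \<oplus>\<^bsub>K\<^esub> y)" by simp
      with F have "\<exists>F. finite F \<and> F \<subseteq> I \<and> (\<forall>x\<in>I. \<exists>s\<in>F. \<exists>y\<in>I. x = s \<oplus>\<^bsub>K\<^esub> (y \<oplus>\<^bsub>K\<^esub> y))"
        by (intro exI[of _ F] conjI)
      with none show False by (rule notE)
    qed
    \<comment> \<open>One element more than the dimension \<open>d\<close> over the rationals, which
      forces a rational relation.\<close>
    obtain xs where xs: "length xs = Suc d" "set xs \<subseteq> I"
      and xs_even: "\<forall>cs. length cs = Suc d \<longrightarrow> (\<exists>y\<in>I. int_comb cs xs = y \<oplus>\<^bsub>K\<^esub> y) \<longrightarrow> (\<forall>c\<in>set cs. even c)"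
    proof -
      have "\<exists>xs. length xs = Suc d \<and> set xs \<subseteq> I \<and>
        (\<forall>cs. length cs = Suc d \<longrightarrow> (\<exists>y\<in>I. int_comb cs xs = y \<oplus>\<^bsub>K\<^esub> y) \<longrightarrow> (\<forall>c\<in>set cs. even c))"
        by (rule independent_mod_2[OF addI]) (rule inf)
      then show thesis using that by (elim exE conjE)
    qed
    have xsK: "set xs \<subseteq> carrier K" using xs(2) subringE(1)[OF I] by blast
    have dep: "dependent (range h) xs"
      using independent_length_le_dimension[OF sf d, of xs] xs(1) xsK by force
    obtain Ks where Ks: "length Ks = length xs"
      "combine Ks xs = \<zero>\<^bsub>K\<^esub>" "set Ks \<subseteq> range h" "set Ks \<noteq> {\<zero>\<^bsub>K\<^esub>}"
      by (rule dependent_imp_non_trivial_combine[OF sf xsK dep])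
    then obtain qs where qs: "Ks = map h qs"
      by (metis ex_map_conv subset_iff rangeE)
    obtain D where D: "D > 0" "\<forall>q\<in>set qs. \<exists>c. of_int D * q = (of_int c :: rat)"
      using common_denominator by blast
    define cs where "cs = map (\<lambda>q. \<lfloor>of_int D * q\<rfloor>) qs"
    have cs: "of_int \<lfloor>of_int D * q\<rfloor> = of_int D * q" if "q \<in> set qs" for q
      using D that by (metis floor_of_int)
    have comb: "combine (map (\<lambda>q. h (of_int D * q)) qs) ys = int_comb (map (\<lambda>q. \<lfloor>of_int D * q\<rfloor>) qs) ys"
      if "\<And>q. q \<in> set qs \<Longrightarrow> of_int \<lfloor>of_int D * q\<rfloor> = of_int D * q" "set ys \<subseteq> carrier K" for qs ys
      using that
    proof (induction qs arbitrary: ys)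
      case (Cons q qs)
      show ?case
      proof (cases ys)
        case (Cons y ys')
        have "h (of_int D * q) = int_mult \<lfloor>of_int D * q\<rfloor> \<one>\<^bsub>K\<^esub>"
          using h_int[of "\<lfloor>of_int D * q\<rfloor>"] Cons.prems(1)[OF list.set_intros(1)] by (simp only:)
        then have "h (of_int D * q) \<otimes>\<^bsub>K\<^esub> y = int_mult \<lfloor>of_int D * q\<rfloor> y"
          using Cons.prems(2) \<open>ys = y # ys'\<close> by (simp add: add_pow_ldistr_int)
        then show ?thesis using Cons.IH[of ys'] Cons.prems \<open>ys = y # ys'\<close> by simp
      qed simp
    qed simp
    have "combine (map (\<lambda>q. h (of_int D * q)) qs) xs = h (of_int D) \<otimes>\<^bsub>K\<^esub> combine Ks xs"
    proof -
      have "set Ks \<subseteq> carrier K" using qs h_carr by auto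
      from combine_r_distr[OF this xsK h_carr[of "of_int D"]] show ?thesis
        using qs by (simp add: h_mult comp_def)
    qed
    then have "int_comb cs xs = \<zero>\<^bsub>K\<^esub>" using comb[OF cs xsK] Ks h_carr unfolding cs_def by simp
    moreover have "length cs = length xs" using Ks qs unfolding cs_def by simp
    moreover have "x = \<zero>\<^bsub>K\<^esub>" if "x \<in> carrier K" "int_mult 2 x = \<zero>\<^bsub>K\<^esub>" for x
    proof -
      have "int_mult 2 x = h 2 \<otimes>\<^bsub>K\<^esub> x" using h_int[of 2] that(1) by (simp add: add_pow_ldistr_int)
      then show ?thesis using that h_nz[of 2] h_carr integral by force
    qed
    moreover have "\<forall>c\<in>set cs. even c" if "length cs = length xs" "int_comb cs xs = \<zero>\<^bsub>K\<^esub>" for cs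
    proof -
      \<comment> \<open>Zero is the double of zero, so independence modulo 2 applies to a
        relation.\<close>
      have "\<exists>y\<in>I. int_comb cs xs = y \<oplus>\<^bsub>K\<^esub> y"
        using that additive_subgroup.zero_closed[OF addI] by (intro bexI[of _ "\<zero>\<^bsub>K\<^esub>"]) simp_all
      then show ?thesis using xs_even[rule_format, of cs] xs(1) that by simp
    qed
    ultimately have z: "set cs \<subseteq> {0}" using even_int_comb_descent[OF xsK, of cs] by blast
    have "q = 0" if "q \<in> set qs" for q
    proof -
      have "\<lfloor>of_int D * q\<rfloor> = 0" using z that unfolding cs_def by auto
      then show ?thesis using cs[OF that] D(1) by simp
    qed
    then have "set Ks \<subseteq> {\<zero>\<^bsub>K\<^esub>}" using qs h0 by auto
    moreover have "Ks \<noteq> []" using Ks(1) xs(1) by auto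
    ultimately show False using Ks(4) by (metis set_empty subset_singletonD)
  qed
qed


section \<open>Groups elementarily equivalent to a triangular group\<close>

lemma corner_sat_cong:
  assumes "fm_fv ring_trm_vars \<phi> = {}"
  shows "sat A (corner_trm_val m G a b) e \<phi> \<longleftrightarrow> sat A (corner_trm_val m G a b) e' \<phi>"
proof (rule sat_cong[of ring_trm_vars])
  show "corner_trm_val m G a b e1 t = corner_trm_val m G a b e2 t" if "\<forall>x\<in>ring_trm_vars t. e1 x = e2 x" for t e1 e2
    using that by (induction t) auto
qed (use assms in simp)

lemma ring_sat_cong:
  assumes "fm_fv ring_trm_vars \<phi> = {}"
  shows "sat A (ring_trm_val R) e \<phi> \<longleftrightarrow> sat A (ring_trm_val R) e' \<phi>"
proof (rule sat_cong[of ring_trm_vars])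
  show "ring_trm_val R e1 t = ring_trm_val R e2 t" if "\<forall>x\<in>ring_trm_vars t. e1 x = e2 x" for t e1 e2
    using that by (induction t) auto
qed (use assms in simp)

lemma models_ring_iff:
  assumes "fm_fv ring_trm_vars \<phi> = {}" "range e \<subseteq> carrier R"
  shows "models (carrier R) (ring_trm_val R) \<phi> \<longleftrightarrow> sat (carrier R) (ring_trm_val R) e \<phi>"
  unfolding models_def using assms ring_sat_cong by blast

text \<open>Quantification over all frames removes the parameters. The property can thus be
  transferred for each \<open>\<phi>\<close> separately, whichever frame is used in the other
  group.\<close>

definition frame_forces :: "nat \<Rightarrow> ('a, 'm) monoid_scheme \<Rightarrow> ring_trm fm \<Rightarrow> bool" where
  "frame_forces m G \<phi> \<longleftrightarrow> (\<forall>b\<in>carrier G. \<forall>a\<in>carrier G. corner_frame m G a b \<longrightarrow>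
     sat (corner m G) (corner_trm_val m G a b) (\<lambda>_. \<one>\<^bsub>G\<^esub>) \<phi>)"

text \<open>The translation evaluates \<open>\<phi>\<close> at the current assignment; as
  \<open>\<phi>\<close> is closed, the constant assignment may be put in its place.\<close>

lemma (in group_pair) definable_frame_forces:
  assumes "fm_fv ring_trm_vars \<phi> = {}"
  shows "definable (\<lambda>e. frame_forces m G \<phi>) (\<lambda>e. frame_forces m H \<phi>)"
proof -
  have body: "definable
     (\<lambda>e. sat (corner m G) (corner_trm_val m G (e 0) (e (Suc 0))) (\<lambda>i. e (Suc (Suc i))) \<phi>)
     (\<lambda>e. sat (corner m H) (corner_trm_val m H (e 0) (e (Suc 0))) (\<lambda>i. e (Suc (Suc i))) \<phi>)"
    using definable_corner_sat[of m \<phi>] by simp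
  have "definable
     (\<lambda>e. \<forall>b\<in>carrier G. \<forall>a\<in>carrier G. corner_frame m G a b \<longrightarrow>
        sat (corner m G) (corner_trm_val m G a b) (\<lambda>i. e i) \<phi>)
     (\<lambda>e. \<forall>b\<in>carrier H. \<forall>a\<in>carrier H. corner_frame m H a b \<longrightarrow>
        sat (corner m H) (corner_trm_val m H a b) (\<lambda>i. e i) \<phi>)"
    by (rule definable_All, rule definable_All, rule definable_imp, rule definable_corner_frame, rule body)
  then show ?thesis
    unfolding frame_forces_def
    by (rule definable_cong) (intro ball_cong refl imp_cong corner_sat_cong[OF assms])+
qed

lemma (in group_pair) definable_Ex_coordinatized:
  assumes "finite U"
  shows "definable (\<lambda>e. \<exists>p. (\<forall>x. p x \<in> carrier G) \<and> coordinatized m G n q ko kn U p)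
     (\<lambda>e. \<exists>p. (\<forall>x. p x \<in> carrier H) \<and> coordinatized m H n q ko kn U p)"
  by (rule definable_Ex_fun) (rule definable_coordinatized[OF assms])

section \<open>From coordinates to an isomorphism\<close>

lemma coord_prod_eq_mult:
  assumes "cring (corner_ring m G (p (0, 1, ko)) (p (1, n - 1, ko)))"
    and A: "A \<in> carrier (triangular_group n (corner_ring m G (p (0, 1, ko)) (p (1, n - 1, ko))))"
    and B: "B \<in> carrier (triangular_group n (corner_ring m G (p (0, 1, ko)) (p (1, n - 1, ko))))"
    and ij: "i < n" "j < n"
    and c: "\<And>i j. i < n \<Longrightarrow> j < n \<Longrightarrow> c (i, j) = A $$ (i, j)"
    and d: "\<And>i j. i < n \<Longrightarrow> j < n \<Longrightarrow> d (i, j) = B $$ (i, j)"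
  shows "(A \<otimes>\<^bsub>triangular_group n (corner_ring m G (p (0, 1, ko)) (p (1, n - 1, ko)))\<^esub> B) $$ (i, j) =
    coord_prod m G n ko p c d (i, j)"
proof -
  define S where "S = corner_ring m G (p (0, 1, ko)) (p (1, n - 1, ko))"
  interpret S: matrices S n using assms(1) unfolding S_def matrices_def .
  have AB: "A \<in> carrier S.M" "B \<in> carrier S.M" using A B S.carrier_T unfolding S_def[symmetric] by auto
  let ?f = "\<lambda>k. A $$ (i, k) \<otimes>\<^bsub>S\<^esub> B $$ (k, j)"
  have f: "?f \<in> set [0..<n] \<rightarrow> carrier S"
    using S.entry_closed[OF AB(1) ij(1)] S.entry_closed[OF AB(2) _ ij(2)] by auto
  have "(A \<otimes>\<^bsub>S.T\<^esub> B) $$ (i, j) = foldr (\<lambda>k. add S (?f k)) [0..<n] \<zero>\<^bsub>S\<^esub>"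
    unfolding S.mult_T S.mult_entry[OF ij] S.foldr_add_eq_finsum[OF distinct_upt f] by (simp add: atLeast0LessThan)
  also have "\<dots> = coord_prod m G n ko p c d (i, j)"
    unfolding coord_prod_def prod.case
  proof (rule foldr_cong)
    fix a k assume "k \<in> set [0..<n]"
    then have k: "k < n" by simp
    show "?f k \<oplus>\<^bsub>S\<^esub> a = params_mult m G n ko p (c (i, k)) (d (k, j)) \<otimes>\<^bsub>G\<^esub> a"
      unfolding c[OF ij(1) k] d[OF k ij(2)] S_def by simp
  qed (simp_all add: S_def)
  finally show ?thesis unfolding S_def .
qed

text \<open>Only the clauses of \<open>coordinatized\<close> are available here, and they speak
  about a relation. A choice function \<open>f\<close> is extracted from it; since equal coordinates
  mean equal elements, the choice is forced, and injectivity and multiplicativity follow from the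
  same clause.\<close>

lemma coordinatized_iso:
  assumes "group G" and p: "\<And>x. p x \<in> carrier G" and co: "coordinatized m G n q ko kn U p"
  defines "S \<equiv> corner_ring m G (p (0, 1, ko)) (p (1, n - 1, ko))"
  shows "cring S" "G \<cong> triangular_group n S"
proof -
  interpret G: group G by fact
  have "corner_ring_axioms m G (p (0, 1, ko)) (p (1, n - 1, ko))"
    using co unfolding coordinatized_def by (elim conjE)
  then show cr: "cring S" unfolding S_def by (rule cring_corner_ringI[OF assms(1)])
  interpret S: matrices S n using cr unfolding matrices_def .
  let ?mat = "coord_mat m G n ko p" and ?rel = "coord_rel m G n q ko kn U p"
  have S_simps: "carrier S = corner m G" "\<zero>\<^bsub>S\<^esub> = \<one>\<^bsub>G\<^esub>" by (simp_all add: S_def)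
  have ex_g: "\<exists>g\<in>carrier G. ?rel c g" if "\<And>ij. c ij \<in> carrier G" "?mat c" for c
  proof -
    have "\<forall>c. (\<forall>ij. c ij \<in> carrier G) \<longrightarrow> ?mat c \<longrightarrow> (\<exists>g\<in>carrier G. ?rel c g)"
      using co unfolding coordinatized_def by (elim conjE)
    then show ?thesis using that by blast
  qed
  have ex_c: "\<exists>c. (\<forall>ij. c ij \<in> carrier G) \<and> ?mat c \<and> ?rel c g" if "g \<in> carrier G" for g
  proof -
    have "\<forall>g\<in>carrier G. \<exists>c. (\<forall>ij. c ij \<in> carrier G) \<and> ?mat c \<and> ?rel c g"
      using co unfolding coordinatized_def by (elim conjE)
    then show ?thesis using that by blast
  qed
  have both: "(g = h \<longleftrightarrow> (\<forall>i\<in>{..<n}. \<forall>j\<in>{..<n}. c (i, j) = d (i, j))) \<and>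
      (\<forall>f. (\<forall>ij. f ij \<in> carrier G) \<longrightarrow> (\<forall>gh\<in>carrier G. gh = g \<otimes>\<^bsub>G\<^esub> h \<longrightarrow>
         (\<forall>i\<in>{..<n}. \<forall>j\<in>{..<n}. f (i, j) = coord_prod m G n ko p c d (i, j)) \<longrightarrow> ?rel f gh))"
    if "\<forall>ij. c ij \<in> carrier G" "\<forall>ij. d ij \<in> carrier G" "g \<in> carrier G" "h \<in> carrier G"
      and "?mat c \<and> ?mat d \<and> ?rel c g \<and> ?rel d h" for c d g h
  proof -
    have "\<forall>c. (\<forall>ij. c ij \<in> carrier G) \<longrightarrow> (\<forall>d. (\<forall>ij. d ij \<in> carrier G) \<longrightarrow>
        (\<forall>g\<in>carrier G. \<forall>h\<in>carrier G. ?mat c \<and> ?mat d \<and> ?rel c g \<and> ?rel d h \<longrightarrow>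
          (g = h \<longleftrightarrow> (\<forall>i\<in>{..<n}. \<forall>j\<in>{..<n}. c (i, j) = d (i, j))) \<and>
          (\<forall>f. (\<forall>ij. f ij \<in> carrier G) \<longrightarrow> (\<forall>gh\<in>carrier G. gh = g \<otimes>\<^bsub>G\<^esub> h \<longrightarrow>
             (\<forall>i\<in>{..<n}. \<forall>j\<in>{..<n}. f (i, j) = coord_prod m G n ko p c d (i, j)) \<longrightarrow> ?rel f gh))))"
      using co unfolding coordinatized_def by (elim conjE)
    note for_c = mp[OF spec[OF this, of c] that(1)]
    note for_cd = mp[OF spec[OF for_c, of d] that(2)]
    show ?thesis by (rule mp[OF bspec[OF bspec[OF for_cd that(3)] that(4)] that(5)])
  qed
  \<comment> \<open>Padded with the identity outside the matrix, because the tuples in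
    \<open>coordinatized\<close> are indexed by all pairs.\<close>
  define coords where "coords A = (\<lambda>(i, j). if i < n \<and> j < n then A $$ (i, j) else \<one>\<^bsub>G\<^esub>)" for A :: "'a mat"
  have coords: "coords A (i, j) = A $$ (i, j)" if "i < n" "j < n" for A i j
    using that by (simp add: coords_def)
  have coords_carrier: "\<forall>ij. coords A ij \<in> carrier G" if "A \<in> carrier S.T" for A
  proof -
    have "A \<in> carrier S.M" using that S.carrier_T by blast
    then show ?thesis
      using S.entry_closed[of A] unfolding S_simps coords_def by (auto intro: corner_carrier)
  qed
  have coords_mat: "?mat (coords A)" if A: "A \<in> carrier S.T" for A
    unfolding coord_mat_def
  proof (intro conjI ballI)
    fix i j assume "i \<in> {..<n}" "j \<in> {..<n}"
    then show "coords A (i, j) \<in> corner m G"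
      using A S.carrier_T S.entry_closed[of A i j] coords[of i j A] unfolding S_simps by simp
  next
    fix i j assume "i \<in> {..<n}" "j \<in> {..<i}"
    then show "coords A (i, j) = \<one>\<^bsub>G\<^esub>" using A coords[of i j A] unfolding S.carrier_T S_simps by simp
  next
    fix i assume "i \<in> {..<n}"
    then have i: "i < n" by simp
    then have "A $$ (i, i) \<in> Units S" using A S.carrier_T by blast
    then obtain y where "y \<in> carrier S" "A $$ (i, i) \<otimes>\<^bsub>S\<^esub> y = \<one>\<^bsub>S\<^esub>" unfolding Units_def by blast
    then show "\<exists>y\<in>carrier G. y \<in> corner m G \<and>
        params_mult m G n ko p (coords A (i, i)) y = corner_one G (p (0, 1, ko)) (p (1, n - 1, ko))"
      using coords[OF i i, of A] corner_carrier[of y m G] by (intro bexI[of _ y]) (simp_all add: S_def)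
  qed
  define f where "f A = (SOME g. g \<in> carrier G \<and> ?rel (coords A) g)" for A
  have f: "f A \<in> carrier G" "?rel (coords A) (f A)" if A: "A \<in> carrier S.T" for A
  proof -
    have "\<exists>g. g \<in> carrier G \<and> ?rel (coords A) g"
      using ex_g[OF _ coords_mat[OF A]] coords_carrier[OF A] by blast
    from someI_ex[OF this] show "f A \<in> carrier G" "?rel (coords A) (f A)" unfolding f_def by auto
  qed
  have group_ST: "group S.T" by (rule S.group_T)
  interpret ST: group S.T by (rule group_ST)
  have hom: "f (A \<otimes>\<^bsub>S.T\<^esub> B) = f A \<otimes>\<^bsub>G\<^esub> f B" if A: "A \<in> carrier S.T" and B: "B \<in> carrier S.T" for A B
  proof -
    let ?AB = "A \<otimes>\<^bsub>S.T\<^esub> B"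
    have AB: "?AB \<in> carrier S.T" using A B by simp
    have gh: "f A \<otimes>\<^bsub>G\<^esub> f B \<in> carrier G" using f A B by simp
    have "\<forall>i\<in>{..<n}. \<forall>j\<in>{..<n}. coords ?AB (i, j) = coord_prod m G n ko p (coords A) (coords B) (i, j)"
    proof (intro ballI)
      fix i j assume "i \<in> {..<n}" "j \<in> {..<n}"
      then have ij: "i < n" "j < n" by auto
      show "coords ?AB (i, j) = coord_prod m G n ko p (coords A) (coords B) (i, j)"
        unfolding coords[OF ij] S_def
        by (rule coord_prod_eq_mult) (use cr A B ij coords in \<open>auto simp: S_def\<close>)
    qed
    moreover note b = both[OF coords_carrier[OF A] coords_carrier[OF B] f(1)[OF A] f(1)[OF B]]
    ultimately have rel: "?rel (coords ?AB) (f A \<otimes>\<^bsub>G\<^esub> f B)"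
      using b coords_mat A B f coords_carrier[OF AB] gh by blast
    show ?thesis
      using both[OF coords_carrier[OF AB] coords_carrier[OF AB] f(1)[OF AB] gh] rel f(2)[OF AB] coords_mat[OF AB]
      by blast
  qed
  have inj: "A = B" if A: "A \<in> carrier S.T" and B: "B \<in> carrier S.T" and eq: "f A = f B" for A B
  proof (rule S.M_eqI)
    have all: "\<forall>i\<in>{..<n}. \<forall>j\<in>{..<n}. coords A (i, j) = coords B (i, j)"
      using both[OF coords_carrier[OF A] coords_carrier[OF B] f(1)[OF A] f(1)[OF B]] f(2) A B coords_mat eq by blast
    show "A $$ (i, j) = B $$ (i, j)" if "i < n" "j < n" for i j
      using all that coords[OF that, of A] coords[OF that, of B] by simp
  qed (use A B S.carrier_T in blast)+
  have surj: "\<exists>A\<in>carrier S.T. f A = g" if g: "g \<in> carrier G" for g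
  proof -
    obtain c where c: "\<forall>ij. c ij \<in> carrier G" "?mat c" "?rel c g" using ex_c[OF g] by blast
    define A where "A = mat n n c"
    have Aij: "A $$ (i, j) = c (i, j)" if "i < n" "j < n" for i j using that by (simp add: A_def)
    have in_corner: "\<forall>i\<in>{..<n}. \<forall>j\<in>{..<n}. c (i, j) \<in> corner m G"
      and lower: "\<forall>i\<in>{..<n}. \<forall>j\<in>{..<i}. c (i, j) = \<one>\<^bsub>G\<^esub>"
      and unit: "\<forall>i\<in>{..<n}. \<exists>y\<in>carrier G. y \<in> corner m G \<and>
        params_mult m G n ko p (c (i, i)) y = corner_one G (p (0, 1, ko)) (p (1, n - 1, ko))"
      using c(2)[unfolded coord_mat_def] by simp_all
    have "A \<in> carrier S.T"
      unfolding S.carrier_T S.carrier_M S_simps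
    proof (intro conjI allI impI)
      show "A \<in> carrier_mat n n" unfolding A_def by simp
      show "A $$ (i, j) \<in> corner m G" if "i < n" "j < n" for i j using in_corner that Aij by simp
      show "A $$ (i, j) = \<one>\<^bsub>G\<^esub>" if "i < n" "j < i" for i j using lower that Aij by simp
      show "A $$ (i, i) \<in> Units S" if i: "i < n" for i
      proof -
        obtain y where y: "y \<in> carrier S" "A $$ (i, i) \<otimes>\<^bsub>S\<^esub> y = \<one>\<^bsub>S\<^esub>"
          using unit i Aij[OF i i] by (auto simp: S_def)
        have "A $$ (i, i) \<in> carrier S" using in_corner i Aij[OF i i] by (simp add: S_simps)
        then show ?thesis using y S.m_comm unfolding Units_def by auto
      qed
    qed
    moreover have "f A = g"
      using both[OF coords_carrier[OF calculation] c(1) f(1)[OF calculation] g] f(2)[OF calculation]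
        coords_mat[OF calculation] c coords[of _ _ A] Aij by auto
    ultimately show ?thesis by blast
  qed
  have "f \<in> iso S.T G"
  proof (rule isoI)
    show "f \<in> hom S.T G" by (rule homI) (use f hom in auto)
    show "bij_betw f (carrier S.T) (carrier G)"
      unfolding bij_betw_def inj_on_def using inj surj f(1) by blast
  qed
  then have "S.T \<cong> G" unfolding is_iso_def by blast
  then show "G \<cong> triangular_group n S" by (rule ST.iso_sym)
qed

text \<open>Number fields enter only through four properties: a domain of characteristic 0 with
  finitely many units and finitely many classes modulo 2.\<close>

lemma triangular_group_rigid:
  fixes R :: "('a, 'm) ring_scheme" and H :: "('h, 'p) monoid_scheme"
  assumes n: "3 \<le> n" and "domain R" and fin: "finite (Units R)"
    and char0: "\<And>k. 0 < (k::nat) \<Longrightarrow> add_pow R k \<one>\<^bsub>R\<^esub> \<noteq> \<zero>\<^bsub>R\<^esub>"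
    and F: "finite F" "F \<subseteq> carrier R"
      "\<And>x. x \<in> carrier R \<Longrightarrow> \<exists>s\<in>F. \<exists>y\<in>carrier R. x = s \<oplus>\<^bsub>R\<^esub> (y \<oplus>\<^bsub>R\<^esub> y)"
    and "group H" and equiv: "group_elem_equiv H (triangular_group n R)"
  shows "\<exists>S :: 'h ring. cring S \<and> ring_elem_equiv S R \<and> H \<cong> triangular_group n S"
proof -
  interpret R: domain R by fact
  interpret H: group H by fact
  \<comment> \<open>By Lagrange, the order of the unit group annihilates every unit.\<close>
  define m where "m = card (Units R)"
  have "\<one>\<^bsub>R\<^esub> \<in> Units R" by simp
  then have "0 < m" unfolding m_def using fin card_gt_0_iff by blast
  have pow: "u [^]\<^bsub>R\<^esub> m = \<one>\<^bsub>R\<^esub>" if u: "u \<in> Units R" for u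
  proof -
    interpret U: group "units_of R" by (rule R.units_group)
    have "u [^]\<^bsub>units_of R\<^esub> order (units_of R) = \<one>\<^bsub>units_of R\<^esub>"
      using u U.pow_order_eq_1[of u] by (simp add: units_of_carrier)
    then show ?thesis using u R.units_of_pow[of u] by (simp add: m_def order_def units_of_carrier units_of_one)
  qed
  \<comment> \<open>One list serves two purposes: units for the diagonal entries and representatives
    modulo 2 for the root subgroups.\<close>
  obtain scalars where scalars: "set scalars = F \<union> Units R" using finite_list fin F(1) by (metis finite_UnI)
  define \<sigma> where "\<sigma> k = scalars ! k" for k
  define q where "q = length scalars"
  have index: "\<exists>k<q. \<sigma> k = s" if "s \<in> F \<union> Units R" for s
    using that scalars unfolding \<sigma>_def q_def by (metis in_set_conv_nth)
  have neg_unit: "\<ominus>\<^bsub>R\<^esub> \<one>\<^bsub>R\<^esub> \<in> Units R"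
    by (auto simp: Units_def R.l_minus R.r_minus intro!: bexI[of _ "\<ominus>\<^bsub>R\<^esub> \<one>\<^bsub>R\<^esub>"])
  obtain ko where ko: "ko < q" "\<sigma> ko = \<one>\<^bsub>R\<^esub>" using index[of "\<one>\<^bsub>R\<^esub>"] by auto
  obtain kn where kn: "kn < q" "\<sigma> kn = \<ominus>\<^bsub>R\<^esub> \<one>\<^bsub>R\<^esub>" using index[of "\<ominus>\<^bsub>R\<^esub> \<one>\<^bsub>R\<^esub>"] neg_unit by auto
  interpret P: standard_params R n m \<sigma> q ko kn
  proof unfold_locales
    show "\<sigma> k \<in> carrier R" if "k < q" for k
    proof -
      have "\<sigma> k \<in> F \<union> Units R" using that scalars nth_mem unfolding \<sigma>_def q_def by blast
      then show ?thesis using F(2) by auto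
    qed
    show "\<exists>k<q. \<exists>s\<in>carrier R. r = \<sigma> k \<oplus>\<^bsub>R\<^esub> (s \<oplus>\<^bsub>R\<^esub> s)" if r: "r \<in> carrier R" for r
    proof -
      obtain s y where sy: "s \<in> F" "y \<in> carrier R" "r = s \<oplus>\<^bsub>R\<^esub> (y \<oplus>\<^bsub>R\<^esub> y)" using F(3)[OF r] by blast
      obtain k where "k < q" "\<sigma> k = s" using index[of s] sy(1) by blast
      then show ?thesis using sy by blast
    qed
    show "r = \<zero>\<^bsub>R\<^esub>" if "r \<in> carrier R" "r \<oplus>\<^bsub>R\<^esub> r = \<zero>\<^bsub>R\<^esub>" for r
    proof -
      have "add_pow R (2::nat) \<one>\<^bsub>R\<^esub> = \<one>\<^bsub>R\<^esub> \<oplus>\<^bsub>R\<^esub> \<one>\<^bsub>R\<^esub>" by (simp add: numeral_2_eq_2)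
      then have "\<one>\<^bsub>R\<^esub> \<oplus>\<^bsub>R\<^esub> \<one>\<^bsub>R\<^esub> \<noteq> \<zero>\<^bsub>R\<^esub>" using char0[of 2] by simp
      moreover have "(\<one>\<^bsub>R\<^esub> \<oplus>\<^bsub>R\<^esub> \<one>\<^bsub>R\<^esub>) \<otimes>\<^bsub>R\<^esub> r = \<zero>\<^bsub>R\<^esub>" using that by (simp add: R.l_distr)
      ultimately show ?thesis using R.integral that by blast
    qed
  qed (use n pow char0[OF \<open>0 < m\<close>] ko kn index in auto)
  let ?U = P.unit_indices
  have finU: "finite ?U" unfolding P.unit_indices_def by simp
  interpret HT: group_pair H P.T by (intro group_pair.intro assms(8) P.group_T)
  \<comment> \<open>Existence of suitable parameters is parameter-free, so it passes to
    \<open>H\<close>, although the parameters found there are unrelated to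
    \<open>P.std\<close>.\<close>
  have "\<exists>p. (\<forall>x. p x \<in> carrier P.T) \<and> coordinatized m P.T n q ko kn ?U p"
    using P.std_T P.coordinatized_std by blast
  then obtain p where p: "\<And>x. p x \<in> carrier H" and co: "coordinatized m H n q ko kn ?U p"
    using HT.definable_elem_equiv[OF equiv HT.definable_Ex_coordinatized[OF finU]] by blast
  define a b where "a = p (0, 1, ko)" and "b = p (1, n - 1, ko)"
  define S where "S = corner_ring m H a b"
  have iso: "cring S" "H \<cong> triangular_group n S"
    using coordinatized_iso[OF assms(8) p co] unfolding S_def a_def b_def by auto
  interpret S: cring S by (rule iso(1))
  have frame: "corner_frame m H a b" using co unfolding coordinatized_def a_def b_def by (elim conjE)
  have one_H: "\<one>\<^bsub>H\<^esub> \<in> corner m H" using S.zero_closed by (simp add: S_def)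
  have forces_T: "frame_forces m P.T \<phi> \<longleftrightarrow> sat (carrier R) (ring_trm_val R) (\<lambda>_. \<one>\<^bsub>R\<^esub>) \<phi>"
    if \<phi>: "fm_fv ring_trm_vars \<phi> = {}" for \<phi>
  proof -
    have "P.E \<zero>\<^bsub>R\<^esub> \<in> corner m P.T" unfolding P.corner_T by blast
    then have e: "range (\<lambda>_::nat. \<one>\<^bsub>P.T\<^esub>) \<subseteq> corner m P.T" by (auto simp: P.elem_zero_T)
    have iff: "sat (corner m P.T) (corner_trm_val m P.T a b) (\<lambda>_. \<one>\<^bsub>P.T\<^esub>) \<phi> \<longleftrightarrow>
        sat (carrier R) (ring_trm_val R) (\<lambda>_. \<one>\<^bsub>R\<^esub>) \<phi>" if "corner_frame m P.T a b" for a b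
      by (rule P.corner_sat_iff[OF that \<phi> e]) auto
    have "corner_frame m P.T (P.std (0, 1, ko)) (P.std (1, n - 1, ko))"
      using P.coordinatized_std unfolding coordinatized_def by (elim conjE)
    then show ?thesis unfolding frame_forces_def using iff P.std_T by blast
  qed
  have forces_H: "frame_forces m H \<phi> \<longleftrightarrow> sat (carrier R) (ring_trm_val R) (\<lambda>_. \<one>\<^bsub>R\<^esub>) \<phi>"
    if "fm_fv ring_trm_vars \<phi> = {}" for \<phi>
    using HT.definable_elem_equiv[OF equiv HT.definable_frame_forces[OF that, of m]] forces_T[OF that] by simp
  have force: "sat (corner m H) (corner_trm_val m H a b) (\<lambda>_. \<one>\<^bsub>H\<^esub>) \<phi>" if "frame_forces m H \<phi>" for \<phi>
    using that frame p unfolding frame_forces_def a_def b_def by blast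
  have "ring_elem_equiv S R"
    unfolding ring_elem_equiv_def
  proof (intro allI impI)
    fix \<phi> :: "ring_trm fm" assume \<phi>: "fm_fv ring_trm_vars \<phi> = {}"
    then have n\<phi>: "fm_fv ring_trm_vars (Neg \<phi>) = {}" by simp
    have eH: "range (\<lambda>_::nat. \<one>\<^bsub>H\<^esub>) \<subseteq> corner m H" using one_H by auto
    have "models (carrier S) (ring_trm_val S) \<phi> \<longleftrightarrow> sat (carrier S) (ring_trm_val S) (\<lambda>_. \<one>\<^bsub>H\<^esub>) \<phi>"
      by (rule models_ring_iff[OF \<phi>]) (use eH in \<open>simp add: S_def\<close>)
    also have "\<dots> \<longleftrightarrow> sat (corner m H) (corner_trm_val m H a b) (\<lambda>_. \<one>\<^bsub>H\<^esub>) \<phi>"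
      unfolding S_def corner_ring_simps
      by (rule sat_ev_cong[OF corner_trm_val_eq eH])
        (use assms(8) S.ring_axioms in \<open>simp_all add: S_def\<close>)
    \<comment> \<open>All frames of the triangular group agree on \<open>\<phi>\<close>, so
      \<open>\<phi>\<close> or \<open>Neg \<phi>\<close> is forced there and hence in
      \<open>H\<close>, and the chosen frame has to comply.\<close>
    also have "\<dots> \<longleftrightarrow> sat (carrier R) (ring_trm_val R) (\<lambda>_. \<one>\<^bsub>R\<^esub>) \<phi>"
      using force[of \<phi>] force[of "Neg \<phi>"] forces_H[OF \<phi>] forces_H[OF n\<phi>] unfolding sat.simps by blast
    also have "\<dots> \<longleftrightarrow> models (carrier R) (ring_trm_val R) \<phi>"
      by (rule models_ring_iff[OF \<phi>, symmetric]) auto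
    finally show "models (carrier S) (ring_trm_val S) \<phi> \<longleftrightarrow> models (carrier R) (ring_trm_val R) \<phi>" .
  qed
  then show ?thesis using iso by blast
qed

lemma add_pow_carrier_update: "add_pow (K\<lparr>carrier := A\<rparr>) (k::nat) x = add_pow K k x"
  by (simp add: add_pow_def nat_pow_def)

theorem theorem3p6:
  fixes n :: nat
    and K :: "('k, 'm) ring_scheme"
    and H :: "('h, 'p) monoid_scheme"
  assumes "3 \<le> n"
    and "number_field K"
    and "finite (Units (ring_of_integers K))"
    and "group H"
    and "group_elem_equiv H (triangular_group n (ring_of_integers K))"
  shows "\<exists>R :: 'h ring. cring R \<and> ring_elem_equiv R (ring_of_integers K)
            \<and> H \<cong> triangular_group n R"
proof -
  have field: "field K" using assms(2) by (simp add: number_field_def)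
  have ops: "add (ring_of_integers K) = add K" "\<one>\<^bsub>ring_of_integers K\<^esub> = \<one>\<^bsub>K\<^esub>" "\<zero>\<^bsub>ring_of_integers K\<^esub> = \<zero>\<^bsub>K\<^esub>"
    by (simp_all add: ring_of_integers_def)
  have char0: "add_pow (ring_of_integers K) k \<one>\<^bsub>ring_of_integers K\<^esub> \<noteq> \<zero>\<^bsub>ring_of_integers K\<^esub>" if "0 < k" for k :: nat
    using number_field_char_0_finite_mod_2(1)[OF assms(2) that] unfolding ring_of_integers_def by (simp add: add_pow_carrier_update)
  obtain F where F: "finite F" "F \<subseteq> carrier (ring_of_integers K)"
    "\<forall>x\<in>carrier (ring_of_integers K). \<exists>s\<in>F. \<exists>y\<in>carrier (ring_of_integers K).
       x = s \<oplus>\<^bsub>ring_of_integers K\<^esub> (y \<oplus>\<^bsub>ring_of_integers K\<^esub> y)"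
    using number_field_char_0_finite_mod_2(2)[OF assms(2)] unfolding ops by blast
  show ?thesis
    by (rule triangular_group_rigid[OF assms(1) domain_ring_of_integers(1)[OF field] assms(3) char0 F(1,2) _ assms(4,5)])
      (use F(3) in auto)
qed

end
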